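(* Let $0\le s<1$. Let $\gamma=\gamma_N\in(NP)\cap L^*$ be a lattice point (depending on $N$) such that $\mathcal P_N^c(\gamma)\neq0$ for every sufficiently large $N$, and assume that $\gamma$ has the form $$\gamma=Nm_S^*+d_N(\gamma),\qquad d_N(\gamma)=O(N^s).$$ Then, as $N\to\infty$, $$\mathcal P_N^c(\gamma)=(2\pi N)^{-m/2}\,\frac{|\Pi(S)|\,e^{N\delta_c(S,\gamma/N)}}{\sqrt{\det A}}\,\bigl(1+O(N^{-(1-s)})\bigr).$$ Furthermore, if $0\le s\le 2/3$ and $d_N(\gamma)=o(N^s)$, then $$\mathcal P_N^c(\gamma)=(2\pi N)^{-m/2}\,\frac{|\Pi(S)|\,V(S)^N e^{-\langle A^{-1}d_N(\gamma),d_N(\gamma)\rangle/(2N)}}{\sqrt{\det A}}\,(1+\varepsilon_N),$$ where $\varepsilon_N=O(N^{-(1-s)})$ for $0\le s\le1/2$ and $\varepsilon_N=o(N^{3s-2})$ for $1/2<s\le2/3$.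
   Context: $X$ is a real vector space of finite dimension $m$, $L\subset X$ a (full rank) lattice, $X^*$ the dual space and $L^*=\{\beta\in X^*:\langle\beta,x\rangle\in\mathbb Z\ \forall x\in L\}$ the dual lattice. $S\subset L^*$ is a finite set with $\#S\ge2$ such that $D(S)=\{\beta-\beta':\beta,\beta'\in S\}$ spans $X^*$ over $\mathbb R$; $P$ is the convex hull of $S$ and $P^o$ its interior. $L(S)^*=\mathrm{span}_{\mathbb Z}D(S)\subset L^*$, $L(S)\supset L$ is its dual lattice in $X$, and $|\Pi(S)|$ is the order of the finite group $\Pi(S)=L(S)/L$. $c:S\to\mathbb R_{>0}$ is a strictly positive function, $V(S)=\sum_{\beta\in S}c(\beta)$, and $m_S^*=\frac{1}{V(S)}\sum_{\beta\in S}c(\beta)\beta\in P^o$. The weighted number of lattice paths is $$\mathcal P_N^c(\gamma)=\sum_{\beta_1,\dots,\beta_N\in S,\ \beta_1+\cdots+\beta_N=\gamma}c(\beta_1)\cdots c(\beta_N).$$ The map $\mu_P:X\to P^o$, $\mu_P(\tau)=\sum_{\beta\in S}\frac{c(\beta)e^{\langle\beta,\tau\rangle}}{\sum_{\beta'\in S}c(\beta')e^{\langle\beta',\tau\rangle}}\beta$, is a diffeomorphism with inverse $\tau_P:P^o\to X$. For $x\in P^o$, $$\delta_c(S,x)=\log\Bigl(\sum_{\beta\in S}c(\beta)e^{\langle\beta-x,\tau_P(x)\rangle}\Bigr),$$ $$A_c(S,x)=\sum_{\beta\in S}\frac{c(\beta)e^{\langle\beta,\tau_P(x)\rangle}}{\sum_{\beta'\in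 S}c(\beta')e^{\langle\beta',\tau_P(x)\rangle}}\,\beta\otimes\beta-x\otimes x:\ X\to X^*$$ (a positive definite map, with $(\beta\otimes\beta)y=\langle\beta,y\rangle\beta$), and $A=A_c(S,m_S^* )$. Determinants of maps $X\to X^*$ are taken with respect to a $\mathbb Z$-basis of $L$ and its dual basis. (Since $\gamma/N\to m_S^*\in P^o$, $\delta_c(S,\gamma/N)$ is defined for large $N$.) *)

theory Defs
  imports
    "HOL-Analysis.Analysis"
    "HOL-Library.Landau_Symbols"
    "HOL-Computational_Algebra.Group_Closure"
begin

text \<open>
  The ambient space is a finite-dimensional real vector space \<open>'a::euclidean_space\<close>, whose inner
  product is never used; its norm enters only through big-O statements and is irrelevant up to
  equivalence. The dual space is the space of (automatically bounded) linear functionals, and the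
  pairing of \<open>\<beta>\<close> and \<open>x\<close> is \<open>blinfun_apply \<beta> x\<close>. The integral span of a set is \<open>group_closure\<close>.
\<close>

type_synonym 'a dual = "'a \<Rightarrow>\<^sub>L real"

text \<open>A lattice of full rank is a subgroup possessing a \<open>\<int>\<close>-basis that is also an \<open>\<real>\<close>-basis of the
  ambient space. The basis is indexed by a finite type, so that \<^const>\<open>det\<close> applies; the conditions
  force \<open>CARD('n) = DIM('a)\<close>.\<close>

definition lattice_basis :: "('n::finite \<Rightarrow> 'a::euclidean_space) \<Rightarrow> 'a set \<Rightarrow> bool" where
  "lattice_basis b L \<longleftrightarrow>
     inj b \<and> independent (range b) \<and> span (range b) = UNIV \<and> L = group_closure (range b)"

definition dual_lattice :: "'a::euclidean_space set \<Rightarrow> 'a dual set" where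
  "dual_lattice L = {\<beta>. \<forall>x\<in>L. blinfun_apply \<beta> x \<in> \<int>}"

definition predual_lattice :: "'a::euclidean_space dual set \<Rightarrow> 'a set" where
  "predual_lattice M = {x. \<forall>\<beta>\<in>M. blinfun_apply \<beta> x \<in> \<int>}"

definition diff_set :: "'a::euclidean_space dual set \<Rightarrow> 'a dual set" where
  "diff_set S = {\<beta> - \<beta>' |\<beta> \<beta>'. \<beta> \<in> S \<and> \<beta>' \<in> S}"

text \<open>\<open>lattice_of S\<close> is the lattice \<open>L(S)\<close> in the ambient space, i.e. the dual of
  \<open>L(S)\<^sup>* = span\<^sub>\<int> D(S)\<close>.\<close>

definition lattice_of :: "'a::euclidean_space dual set \<Rightarrow> 'a set" where
  "lattice_of S = predual_lattice (group_closure (diff_set S))"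

definition Pi_group :: "'a::euclidean_space set \<Rightarrow> 'a dual set \<Rightarrow> 'a set set" where
  "Pi_group L S =
     lattice_of S // {(x, y). x \<in> lattice_of S \<and> y \<in> lattice_of S \<and> x - y \<in> L}"

definition total_weight ::
    "('a::euclidean_space dual \<Rightarrow> real) \<Rightarrow> 'a dual set \<Rightarrow> real" where
  "total_weight c S = (\<Sum>\<beta>\<in>S. c \<beta>)"

definition barycenter ::
    "('a::euclidean_space dual \<Rightarrow> real) \<Rightarrow> 'a dual set \<Rightarrow> 'a dual" where
  "barycenter c S = (1 / total_weight c S) *\<^sub>R (\<Sum>\<beta>\<in>S. c \<beta> *\<^sub>R \<beta>)"

definition weighted_paths ::
    "('a::euclidean_space dual \<Rightarrow> real) \<Rightarrow> 'a dual set \<Rightarrow> nat \<Rightarrow> 'a dual \<Rightarrow> real" where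
  "weighted_paths c S N \<gamma> =
     (\<Sum>p \<in> {p \<in> {1..N} \<rightarrow>\<^sub>E S. (\<Sum>i=1..N. p i) = \<gamma>}. \<Prod>i=1..N. c (p i))"

definition gibbs_weight ::
    "('a::euclidean_space dual \<Rightarrow> real) \<Rightarrow> 'a dual set \<Rightarrow> 'a \<Rightarrow> 'a dual \<Rightarrow> real" where
  "gibbs_weight c S \<tau> \<beta> =
     c \<beta> * exp (blinfun_apply \<beta> \<tau>) / (\<Sum>\<beta>'\<in>S. c \<beta>' * exp (blinfun_apply \<beta>' \<tau>))"

definition moment_map ::
    "('a::euclidean_space dual \<Rightarrow> real) \<Rightarrow> 'a dual set \<Rightarrow> 'a \<Rightarrow> 'a dual" where
  "moment_map c S \<tau> = (\<Sum>\<beta>\<in>S. gibbs_weight c S \<tau> \<beta> *\<^sub>R \<beta>)"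

text \<open>The moment map is a bijection from the whole space onto the interior of the convex hull of
  \<open>S\<close>, so \<open>inv\<close> yields its inverse there; values outside that interior carry no meaning.\<close>

definition moment_map_inv ::
    "('a::euclidean_space dual \<Rightarrow> real) \<Rightarrow> 'a dual set \<Rightarrow> 'a dual \<Rightarrow> 'a" where
  "moment_map_inv c S = inv (moment_map c S)"

definition delta_c ::
    "('a::euclidean_space dual \<Rightarrow> real) \<Rightarrow> 'a dual set \<Rightarrow> 'a dual \<Rightarrow> real" where
  "delta_c c S x = ln (\<Sum>\<beta>\<in>S. c \<beta> * exp (blinfun_apply (\<beta> - x) (moment_map_inv c S x)))"

definition tensor_square :: "'a::euclidean_space dual \<Rightarrow> 'a \<Rightarrow> 'a dual" where
  "tensor_square \<beta> y = blinfun_apply \<beta> y *\<^sub>R \<beta>"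

definition A_map ::
    "('a::euclidean_space dual \<Rightarrow> real) \<Rightarrow> 'a dual set \<Rightarrow> 'a dual \<Rightarrow> 'a \<Rightarrow> 'a dual" where
  "A_map c S x y =
     (\<Sum>\<beta>\<in>S. gibbs_weight c S (moment_map_inv c S x) \<beta> *\<^sub>R tensor_square \<beta> y)
     - tensor_square x y"

text \<open>The matrix of \<open>F\<close> with respect to a basis \<open>b\<close> and its dual basis \<open>b\<^sup>*\<close> is read off from
  \<open>F (b j) = (\<Sum>i. blinfun_apply (F (b j)) (b i) *\<^sub>R b\<^sup>* i)\<close>.\<close>

definition dual_det :: "('n::finite \<Rightarrow> 'a::euclidean_space) \<Rightarrow> ('a \<Rightarrow> 'a dual) \<Rightarrow> real" where
  "dual_det b F = det (\<chi> i j. blinfun_apply (F (b j)) (b i))"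

end

theory Submission
  imports Defs "HOL-Probability.Probability" "HOL-Real_Asymp.Real_Asymp"
begin

text \<open>
  Tilting removes the large-deviation part exactly. Put \<open>x = \<gamma>/N\<close> and let \<open>\<tau>\<close> solve
  \<open>moment_map c S \<tau> = x\<close>. Every path from \<open>0\<close> to \<open>\<gamma>\<close> has the same factor \<open>exp \<langle>\<gamma>, \<tau>\<rangle>\<close>, so replacing the
  weights \<open>c\<close> by the probabilities \<open>gibbs_weight c S \<tau>\<close> multiplies the path sum by
  \<open>exp (- N * delta_c c S x)\<close> (lemma \<open>weighted_paths_tilt\<close>). What remains is the probability that a random
  walk with steps in \<open>S\<close> is, after \<open>N\<close> steps, exactly at its mean.

  That probability is computed by Fourier inversion in coordinates dual to the basis \<open>b\<close>. It is the
  integral over the unit cube of the \<open>N\<close>-th power of the characteristic function \<open>\<phi>\<close> of a centered step.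
  The modulus of \<open>\<phi>\<close> is 1 exactly at the points of \<open>L(S)\<close>, and because \<open>\<gamma>\<close> is reachable, \<open>\<phi>\<^sup>N\<close> is invariant
  under \<open>L(S)\<close>. So the \<open>|\<Pi>(S)|\<close> peaks in one period cell contribute equally
  (\<open>periodic_integral_unfold\<close>, \<open>card_periods_translate_in_unit_cube\<close>), and away from the peaks the integrand is
  exponentially small (\<open>oscillation_gap\<close>). Near the peak at the origin \<open>\<phi>\<^sup>N\<close> is close to a Gaussian whose
  matrix is a multiple of the covariance, that is, of \<open>A_c(S,x)\<close>. The relative error is \<open>1/N\<close> and not \<open>1/sqrt N\<close>: the mean is hit exactly, the
  cubic term of \<open>log \<phi>\<close> is purely imaginary, and only the real part of the integral counts
  (\<open>Re_charfun_power_approx\<close>). All constants depend only on a positive lower bound for the step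
  probabilities, so \<open>local_limit_theorem\<close> is uniform in the tilt.

  Since \<open>x\<close> tends to the barycenter \<open>m\<close> and \<open>moment_map c S 0 = m\<close>, only tilts near \<open>0\<close> occur. There the moment
  map is \<open>m + A \<tau> + O(|\<tau>|\<^sup>2)\<close> with \<open>A\<close> positive definite, hence locally onto, and it is injective because
  \<open>exp\<close> is strictly increasing (\<open>moment_map_inj\<close>, \<open>moment_map_surj_near_0\<close>). Thus \<open>\<tau> = O(|d|/N)\<close>, and
  replacing the determinant at \<open>x\<close> by the one at \<open>m\<close> costs a factor \<open>1 + O(|d|/N) = 1 + O(N powr (s - 1))\<close>. This
  is the first assertion. For the second, the Legendre-type expansion
  \<open>delta_c c S (m + y) = ln V - \<langle>y, A\<^sup>-\<^sup>1 y\<rangle>/2 + O(|y|\<^sup>3)\<close> (\<open>delta_expansion\<close>) is inserted with \<open>y = d/N\<close>. The cubic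
  term contributes \<open>N * O(|d/N|\<^sup>3)\<close> to the exponent, which is \<open>o(N powr (3 * s - 2))\<close>.
\<close>

section \<open>Gaussian integrals of quadratic forms\<close>

lemma nn_integral_gaussian_real:
  assumes "a > 0"
  shows "(\<integral>\<^sup>+x. ennreal (exp (- a * x\<^sup>2)) \<partial>lborel) = ennreal (sqrt (pi / a))"
proof -
  define \<sigma> where "\<sigma> = 1 / sqrt (2 * a)"
  have \<sigma>: "\<sigma> > 0" and \<sigma>2: "\<sigma>\<^sup>2 = 1 / (2 * a)"
    using assms by (auto simp: \<sigma>_def power_divide)
  have eq: "exp (- a * x\<^sup>2) = sqrt (pi / a) * normal_density 0 \<sigma> x" for x
    using assms by (simp add: normal_density_def \<sigma>2 real_sqrt_divide field_simps)
  have "(\<integral>\<^sup>+x. ennreal (exp (- a * x\<^sup>2)) \<partial>lborel) = (\<integral>x. sqrt (pi / a) * normal_density 0 \<sigma> x \<partial>lborel)"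
    unfolding eq using assms \<sigma>
    by (intro nn_integral_eq_integral) (auto intro!: integrable_mult_right)
  then show ?thesis
    using \<sigma> by simp
qed

lemma nn_integral_gaussian:
  assumes "a > 0"
  shows "(\<integral>\<^sup>+x. ennreal (exp (- a * (norm (x::'a::euclidean_space))\<^sup>2)) \<partial>lborel)
           = ennreal ((pi / a) powr (real DIM('a) / 2))"
proof -
  have "(\<integral>\<^sup>+x. ennreal (exp (- a * (norm (x::'a))\<^sup>2)) \<partial>lborel)
      = (\<integral>\<^sup>+x. (\<Prod>b\<in>Basis. ennreal (exp (- a * ((x::'a) \<bullet> b)\<^sup>2))) \<partial>lborel)"
  proof (intro nn_integral_cong)
    fix x :: 'a
    have "- a * (norm x)\<^sup>2 = (\<Sum>b\<in>Basis. - a * (x \<bullet> b)\<^sup>2)"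
      unfolding power2_norm_eq_inner by (subst euclidean_inner) (simp add: sum_distrib_left power2_eq_square)
    then show "ennreal (exp (- a * (norm x)\<^sup>2)) = (\<Prod>b\<in>Basis. ennreal (exp (- a * (x \<bullet> b)\<^sup>2)))"
      by (simp add: exp_sum prod_ennreal)
  qed
  also have "\<dots> = (\<Prod>b\<in>(Basis::'a set). (\<integral>\<^sup>+x. ennreal (exp (- a * x\<^sup>2)) \<partial>lborel))"
    by (rule nn_integral_lborel_prod) auto
  also have "\<dots> = ennreal (sqrt (pi / a) ^ DIM('a))"
    using assms by (simp only: nn_integral_gaussian_real[OF assms] prod_constant) (simp add: ennreal_power)
  also have "sqrt (pi / a) ^ DIM('a) = (pi / a) powr (real DIM('a) / 2)"
    using assms by (simp add: powr_half_sqrt[symmetric] powr_powr flip: powr_realpow)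
  finally show ?thesis .
qed

text \<open>
  By Fubini the coordinate along \<open>u\<close> is integrated first; on each such line the shear is a translation.
\<close>

lemma nn_integral_lborel_shear:
  fixes F :: "'a::euclidean_space \<Rightarrow> ennreal"
  assumes [measurable]: "F \<in> borel_measurable borel" and u: "u \<in> Basis" and v: "v \<in> Basis" "u \<noteq> v"
  shows "(\<integral>\<^sup>+x. F (x + (x \<bullet> v) *\<^sub>R u) \<partial>lborel) = (\<integral>\<^sup>+x. F x \<partial>lborel)"
proof -
  interpret product_sigma_finite "\<lambda>_::'a. lborel :: real measure" ..
  have *: "(\<integral>\<^sup>+x. G x \<partial>lborel) =
      (\<integral>\<^sup>+f. (\<integral>\<^sup>+y. G ((\<Sum>b\<in>Basis - {u}. f b *\<^sub>R b) + y *\<^sub>R u) \<partial>lborel) \<partial>(\<Pi>\<^sub>M b\<in>Basis - {u}. lborel))"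
    if [measurable]: "G \<in> borel_measurable borel" for G :: "'a \<Rightarrow> ennreal"
  proof -
    have ins: "Basis = insert u (Basis - {u})" using u by auto
    have m: "(\<lambda>f. G (\<Sum>b\<in>Basis. f b *\<^sub>R b)) \<in> borel_measurable (\<Pi>\<^sub>M b\<in>insert u (Basis - {u}). lborel)"
      unfolding ins[symmetric] by measurable
    have "(\<integral>\<^sup>+x. G x \<partial>lborel) = (\<integral>\<^sup>+f. G (\<Sum>b\<in>Basis. f b *\<^sub>R b) \<partial>(\<Pi>\<^sub>M b\<in>insert u (Basis - {u}). lborel))"
      unfolding ins[symmetric] by (subst lborel_eq) (simp add: nn_integral_distr)
    also have "\<dots> = (\<integral>\<^sup>+f. (\<integral>\<^sup>+y. G (\<Sum>b\<in>Basis. (f(u := y)) b *\<^sub>R b) \<partial>lborel) \<partial>(\<Pi>\<^sub>M b\<in>Basis - {u}. lborel))"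
      by (rule product_nn_integral_insert[OF _ _ m]) auto
    also have "(\<lambda>f y. (\<Sum>b\<in>Basis. (f(u := y)) b *\<^sub>R b)) = (\<lambda>f y. (\<Sum>b\<in>Basis - {u}. f b *\<^sub>R b) + y *\<^sub>R u)"
    proof (intro ext)
      fix f :: "'a \<Rightarrow> real" and y
      have "(\<Sum>b\<in>Basis. (f(u := y)) b *\<^sub>R b) = y *\<^sub>R u + (\<Sum>b\<in>Basis - {u}. (f(u := y)) b *\<^sub>R b)"
        using u by (subst sum.remove[of _ u]) auto
      also have "(\<Sum>b\<in>Basis - {u}. (f(u := y)) b *\<^sub>R b) = (\<Sum>b\<in>Basis - {u}. f b *\<^sub>R b)"
        by (intro sum.cong) auto
      finally show "(\<Sum>b\<in>Basis. (f(u := y)) b *\<^sub>R b) = (\<Sum>b\<in>Basis - {u}. f b *\<^sub>R b) + y *\<^sub>R u"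
        by simp
    qed
    finally show ?thesis by (simp add: fun_eq_iff)
  qed
  show ?thesis
  proof (subst (1 2) *)
    show "(\<lambda>x. F (x + (x \<bullet> v) *\<^sub>R u)) \<in> borel_measurable borel" "F \<in> borel_measurable borel"
      by measurable
    let ?w = "\<lambda>f. (\<Sum>b\<in>Basis - {u}. f b *\<^sub>R b)"
    have "(\<integral>\<^sup>+y. F (?w f + y *\<^sub>R u + ((?w f + y *\<^sub>R u) \<bullet> v) *\<^sub>R u) \<partial>lborel) = (\<integral>\<^sup>+y. F (?w f + y *\<^sub>R u) \<partial>lborel)" for f
    proof -
      have eq: "?w f + y *\<^sub>R u + ((?w f + y *\<^sub>R u) \<bullet> v) *\<^sub>R u = ?w f + (?w f \<bullet> v + 1 * y) *\<^sub>R u" for y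
        using u v by (simp add: inner_left_distrib inner_not_same_Basis scaleR_left_distrib)
      have "(\<integral>\<^sup>+y. F (?w f + y *\<^sub>R u + ((?w f + y *\<^sub>R u) \<bullet> v) *\<^sub>R u) \<partial>lborel)
          = (\<integral>\<^sup>+y. F (?w f + (?w f \<bullet> v + 1 * y) *\<^sub>R u) \<partial>lborel)"
        unfolding eq ..
      also have "\<dots> = (\<integral>\<^sup>+y. F (?w f + y *\<^sub>R u) \<partial>lborel)"
        by (subst (2) nn_integral_real_affine[of _ 1 "?w f \<bullet> v"]) auto
      finally show ?thesis .
    qed
    then show "(\<integral>\<^sup>+f. (\<integral>\<^sup>+y. F (?w f + y *\<^sub>R u + ((?w f + y *\<^sub>R u) \<bullet> v) *\<^sub>R u) \<partial>lborel) \<partial>(\<Pi>\<^sub>M b\<in>Basis - {u}. lborel))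
        = (\<integral>\<^sup>+f. (\<integral>\<^sup>+y. F (?w f + y *\<^sub>R u) \<partial>lborel) \<partial>(\<Pi>\<^sub>M b\<in>Basis - {u}. lborel))"
      by simp
  qed
qed

lemma nn_integral_lborel_transpose:
  fixes F :: "real^'n \<Rightarrow> ennreal" and m n :: 'n
  assumes [measurable]: "F \<in> borel_measurable borel"
  shows "(\<integral>\<^sup>+x. F (\<chi> i. x $ Transposition.transpose m n i) \<partial>lborel) = (\<integral>\<^sup>+x. F x \<partial>lborel)"
proof -
  let ?g = "\<lambda>x::real^'n. \<chi> i. x $ Transposition.transpose m n i"
  have lin: "linear ?g"
    by (rule linearI) (auto simp: vec_eq_iff)
  then have [measurable]: "?g \<in> borel \<rightarrow>\<^sub>M borel"
    by (simp add: borel_measurable_continuous_onI linear_continuous_on linear_linear)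
  have "lborel = distr lborel borel ?g"
  proof (rule lborel_eqI)
    fix l u :: "real^'n" assume le: "\<And>b. b \<in> Basis \<Longrightarrow> l \<bullet> b \<le> u \<bullet> b"
    have lu: "l $ i \<le> u $ i" for i
      using le[of "axis i 1"] by (simp add: cart_eq_inner_axis axis_in_Basis_iff)
    have vim: "?g -` box l u = box (?g l) (?g u)"
      by (auto simp: mem_box_cart vimage_def) (metis transpose_involutory)+
    have prd: "(\<Prod>b\<in>(Basis :: (real^'n) set). w \<bullet> b) = (\<Prod>i\<in>UNIV. w $ i)" for w :: "real^'n"
    proof -
      have "Basis = (\<lambda>i::'n. axis i (1::real)) ` UNIV"
        by (auto simp: Basis_vec_def)
      then show ?thesis
        by (subst \<open>Basis = _\<close>, subst prod.reindex) (auto simp: inj_on_def axis_eq_axis inner_axis)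
    qed
    have "emeasure lborel (box (?g l) (?g u)) = ennreal (\<Prod>i\<in>UNIV. (?g u - ?g l) $ i)"
    proof (subst emeasure_lborel_box)
      show "?g l \<bullet> b \<le> ?g u \<bullet> b" if "b \<in> Basis" for b
        using that lu by (auto simp: Basis_vec_def inner_axis)
    qed (simp only: prd)
    also have "(\<Prod>i\<in>UNIV. (?g u - ?g l) $ i) = (\<Prod>i\<in>UNIV. (u - l) $ i)"
      by (rule prod.reindex_bij_witness[of _ "Transposition.transpose m n" "Transposition.transpose m n"]) auto
    finally show "emeasure (distr lborel borel ?g) (box l u) = ennreal (\<Prod>b\<in>Basis. (u - l) \<bullet> b)"
      by (simp add: emeasure_distr vim prd)
  qed simp
  then have "(\<integral>\<^sup>+x. F x \<partial>lborel) = (\<integral>\<^sup>+x. F x \<partial>distr lborel borel ?g)"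
    by simp
  then show ?thesis
    by (simp add: nn_integral_distr)
qed

text \<open>
  Linear maps are generated by diagonal maps, transpositions of coordinates and shears, and the formula
  is multiplicative under composition. A product of such maps has nonzero determinant only if all factors do.
\<close>

lemma nn_integral_lborel_linear:
  fixes g :: "real^'n \<Rightarrow> real^'n" and F :: "real^'n \<Rightarrow> ennreal"
  assumes g: "linear g" and det: "det (matrix g) \<noteq> 0" and F: "F \<in> borel_measurable borel"
  shows "(\<integral>\<^sup>+x. F x \<partial>lborel) = ennreal \<bar>det (matrix g)\<bar> * (\<integral>\<^sup>+x. F (g x) \<partial>lborel)"
proof -
  define P where "P = (\<lambda>g::real^'n\<Rightarrow>real^'n. linear g \<and> (det (matrix g) \<noteq> 0 \<longrightarrow> (\<forall>F::real^'n \<Rightarrow> ennreal. F \<in> borel_measurable borel \<longrightarrow>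
     (\<integral>\<^sup>+x. F x \<partial>lborel) = ennreal \<bar>det (matrix g)\<bar> * (\<integral>\<^sup>+x. F (g x) \<partial>lborel))))"
  have meas: "h \<in> borel \<rightarrow>\<^sub>M borel" if "linear h" for h :: "real^'n \<Rightarrow> real^'n"
    using that by (simp add: borel_measurable_continuous_onI linear_continuous_on linear_linear)
  have "P g"
  proof (rule induct_linear_elementary[where P = P, OF g], goal_cases)
    case (1 f g)
    note [measurable] = meas[OF 1(1)] meas[OF 1(2)]
    show ?case
      unfolding P_def
    proof (intro conjI impI allI)
      show "linear (f \<circ> g)" using 1 linear_compose by blast
      have dt: "det (matrix (f \<circ> g)) = det (matrix f) * det (matrix g)"
        using 1(1,2) by (simp add: matrix_compose det_mul)
      fix F :: "real^'n \<Rightarrow> ennreal" assume d: "det (matrix (f \<circ> g)) \<noteq> 0" and [measurable]: "F \<in> borel_measurable borel"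
      have "(\<integral>\<^sup>+x. F x \<partial>lborel) = ennreal \<bar>det (matrix f)\<bar> * (\<integral>\<^sup>+x. F (f x) \<partial>lborel)"
      proof -
        have "det (matrix f) \<noteq> 0" "F \<in> borel_measurable borel" using d dt by auto
        then show ?thesis using 1(3) unfolding P_def by blast
      qed
      also have "(\<integral>\<^sup>+x. F (f x) \<partial>lborel) = ennreal \<bar>det (matrix g)\<bar> * (\<integral>\<^sup>+x. F (f (g x)) \<partial>lborel)"
      proof -
        have "(\<lambda>x. F (f x)) \<in> borel_measurable borel" by measurable
        moreover have "det (matrix g) \<noteq> 0" using d dt by auto
        ultimately show ?thesis using 1(4) unfolding P_def by blast
      qed
      finally show "(\<integral>\<^sup>+x. F x \<partial>lborel) = ennreal \<bar>det (matrix (f \<circ> g))\<bar> * (\<integral>\<^sup>+x. F ((f \<circ> g) x) \<partial>lborel)"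
        by (simp add: dt abs_mult ennreal_mult mult.assoc)
    qed
  next
    case (2 f i)
    have "row i (matrix f) = 0"
      using 2 by (simp add: row_def matrix_def vec_eq_iff)
    then have "det (matrix f) = 0"
      by (rule det_zero_row)
    then show ?case using 2 by (simp add: P_def)
  next
    case (3 c)
    let ?g = "\<lambda>x::real^'n. \<chi> i. c i * x $ i"
    have mat: "matrix ?g = (\<chi> i j. if i = j then c i else 0)"
      by (auto simp: matrix_def vec_eq_iff axis_def)
    have dt: "det (matrix ?g) = prod c UNIV"
      unfolding mat by (subst det_diagonal) auto
    have lin: "linear ?g"
      by (rule linearI) (auto simp: vec_eq_iff algebra_simps)
    note [measurable] = meas[OF lin]
    have BI: "Basis = (\<lambda>i::'n. axis i (1::real)) ` UNIV"
      by (auto simp: Basis_vec_def)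
    have inj: "inj (\<lambda>i::'n. axis i (1::real))"
      by (auto simp: inj_on_def axis_eq_axis)
    have "(\<integral>\<^sup>+x. F x \<partial>lborel) = ennreal \<bar>det (matrix ?g)\<bar> * (\<integral>\<^sup>+x. F (?g x) \<partial>lborel)"
      if nz: "det (matrix ?g) \<noteq> 0" and [measurable]: "F \<in> borel_measurable borel" for F
    proof -
      define c' where "c' = (\<lambda>b. c (inv (\<lambda>i::'n. axis i (1::real)) b))"
      have c': "c' (axis i 1) = c i" for i
        unfolding c'_def inv_f_f[OF inj] ..
      have nz': "c' j \<noteq> 0" if "j \<in> Basis" for j
        using that nz unfolding dt BI by (auto simp: c')
      have T: "(\<Sum>j\<in>Basis. (c' j * (x \<bullet> j)) *\<^sub>R j) = ?g x" for x
      proof -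
        have "(\<Sum>j\<in>Basis. (c' j * (x \<bullet> j)) *\<^sub>R j) = (\<Sum>i\<in>UNIV. (c i * x $ i) *\<^sub>R axis i 1)"
          unfolding BI by (subst sum.reindex[OF inj]) (simp add: c' inner_axis)
        also have "\<dots> = ?g x"
          by (simp add: vec_eq_iff axis_def if_distrib cong: if_cong)
        finally show ?thesis .
      qed
      have "lborel = density (distr lborel borel (\<lambda>x. 0 + (\<Sum>j\<in>Basis. (c' j * (x \<bullet> j)) *\<^sub>R j))) (\<lambda>_. (\<Prod>j\<in>Basis. \<bar>c' j\<bar>))"
        by (rule lborel_affine_euclidean) (use nz' in auto)
      also have "(\<Prod>j\<in>Basis. \<bar>c' j\<bar>) = \<bar>prod c UNIV\<bar>"
        unfolding BI by (subst prod.reindex[OF inj]) (simp add: c' abs_prod)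
      finally have "lborel = density (distr lborel borel ?g) (\<lambda>_. ennreal \<bar>prod c UNIV\<bar>)"
        by (simp add: T)
      then have "(\<integral>\<^sup>+x. F x \<partial>lborel) = (\<integral>\<^sup>+x. F x \<partial>density (distr lborel borel ?g) (\<lambda>_. ennreal \<bar>prod c UNIV\<bar>))"
        by simp
      also have "\<dots> = ennreal \<bar>prod c UNIV\<bar> * (\<integral>\<^sup>+x. F (?g x) \<partial>lborel)"
        by (subst nn_integral_density) (auto simp: nn_integral_distr nn_integral_cmult)
      finally show ?thesis by (simp add: dt)
    qed
    then show ?case using lin by (simp add: P_def)
  next
    case (4 m n)
    let ?g = "\<lambda>x::real^'n. \<chi> i. x $ Transposition.transpose m n i"
    have lin: "linear ?g"
      by (rule linearI) (auto simp: vec_eq_iff)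
    have "?g \<circ> ?g = id" by (auto simp: vec_eq_iff)
    then have "det (matrix ?g) * det (matrix ?g) = 1"
      using lin by (metis det_I det_mul matrix_compose matrix_id_mat_1)
    then have "\<bar>det (matrix ?g)\<bar> = 1"
      by (metis abs_1 abs_mult_self_eq abs_square_eq_1 power2_eq_square)
    then show ?case
      using lin unfolding P_def by (auto simp: nn_integral_lborel_transpose)
  next
    case (5 m n)
    let ?g = "\<lambda>x::real^'n. \<chi> i. if i = m then x $ m + x $ n else x $ i"
    have lin: "linear ?g"
      by (rule linearI) (auto simp: vec_eq_iff algebra_simps)
    have "matrix ?g = (\<chi> k. if k = m then row m (mat 1) + 1 *s row n (mat 1) else row k (mat 1))"
      by (auto simp: vec_eq_iff matrix_def row_def mat_def axis_def)
    then have "det (matrix ?g) = 1"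
      using det_row_operation[OF 5, where c = 1 and A = "mat 1::real^'n^'n"] by simp
    moreover have "?g x = x + (x \<bullet> axis n 1) *\<^sub>R axis m 1" for x
      by (auto simp: vec_eq_iff inner_axis) (auto simp: axis_def)
    ultimately show ?case
      using lin 5 unfolding P_def by (auto simp: nn_integral_lborel_shear axis_eq_axis)
  qed
  then show ?thesis
    using det F unfolding P_def by blast
qed


lemma symmetric_inner_commute:
  fixes M :: "real^'n^'n"
  assumes "transpose M = M"
  shows "x \<bullet> (M *v y) = y \<bullet> (M *v x)"
  by (metis assms dot_lmul_matrix inner_commute transpose_matrix_vector)

text \<open>
  Gram-Schmidt for the inner product \<open>x \<bullet> (M *v y)\<close>: as long as fewer than \<open>CARD('n)\<close> vectors have been chosen,
  some nonzero vector is orthogonal to all their images under \<open>M\<close>. The columns of \<open>B\<close> are the resulting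
  orthonormal basis.
\<close>

lemma positive_definite_congruent_mat_1:
  fixes M :: "real^'n^'n"
  assumes sym: "transpose M = M" and pos: "\<And>x. x \<noteq> 0 \<Longrightarrow> x \<bullet> (M *v x) > 0"
  obtains B :: "real^'n^'n" where "transpose B ** M ** B = mat 1"
proof -
  have ex: "\<exists>v. \<forall>i<k. \<forall>j<k. v i \<bullet> (M *v v j) = (if i = j then 1 else 0)"
    if "k \<le> CARD('n)" for k
    using that
  proof (induction k)
    case (Suc k)
    then obtain v where v: "\<And>i j. i < k \<Longrightarrow> j < k \<Longrightarrow> v i \<bullet> (M *v v j) = (if i = j then 1 else 0)"
      by auto
    have "dim ((\<lambda>i. M *v v i) ` {..<k}) \<le> k"
      by (metis card_image_le card_lessThan dim_le_card' finite_imageI finite_lessThan le_trans)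
    then have "dim ((\<lambda>i. M *v v i) ` {..<k}) < DIM(real^'n)"
      using Suc.prems by simp
    then obtain x where x: "x \<noteq> 0" "\<And>y. y \<in> span ((\<lambda>i. M *v v i) ` {..<k}) \<Longrightarrow> orthogonal x y"
      using orthogonal_to_subspace_exists by blast
    have x0: "x \<bullet> (M *v v i) = 0" if "i < k" for i
      using x(2)[OF span_base, of "M *v v i"] that by (auto simp: orthogonal_def)
    define y where "y = (1 / sqrt (x \<bullet> (M *v x))) *\<^sub>R x"
    have y1: "y \<bullet> (M *v y) = 1"
      using pos[OF x(1)] by (simp add: y_def matrix_vector_mult_scaleR)
    have y0: "y \<bullet> (M *v v i) = 0" "v i \<bullet> (M *v y) = 0" if "i < k" for i
      using x0[OF that] symmetric_inner_commute[OF sym, of "v i" y] by (auto simp: y_def)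
    have "\<forall>i<Suc k. \<forall>j<Suc k. (v(k := y)) i \<bullet> (M *v (v(k := y)) j) = (if i = j then 1 else 0)"
      using v y1 y0 by (auto simp: less_Suc_eq)
    then show ?case by blast
  qed auto
  obtain v where v: "\<And>i j. i < CARD('n) \<Longrightarrow> j < CARD('n) \<Longrightarrow> v i \<bullet> (M *v v j) = (if i = j then 1 else 0)"
    using ex[of "CARD('n)"] by auto
  obtain h :: "'n \<Rightarrow> nat" where h: "bij_betw h UNIV {..<CARD('n)}"
    by (metis bij_betw_iff_card card_lessThan finite finite_lessThan)
  have h1: "h i < CARD('n)" "h i = h j \<longleftrightarrow> i = j" for i j
    using h by (auto simp: bij_betw_def inj_on_def)
  define B :: "real^'n^'n" where "B = (\<chi> i j. v (h j) $ i)"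
  have "(transpose B ** M ** B) $ i $ j = v (h i) \<bullet> (M *v v (h j))" for i j
    by (simp add: matrix_mul_assoc[symmetric])
       (simp add: B_def matrix_matrix_mult_def matrix_vector_mult_def transpose_def inner_vec_def)
  then have "transpose B ** M ** B = mat 1"
    by (simp add: vec_eq_iff v h1 mat_def)
  then show thesis by (rule that)
qed

lemma positive_definite_det_pos:
  fixes M :: "real^'n^'n"
  assumes "transpose M = M" "\<And>x. x \<noteq> 0 \<Longrightarrow> x \<bullet> (M *v x) > 0"
  shows "det M > 0"
proof -
  obtain B :: "real^'n^'n" where "transpose B ** M ** B = mat 1"
    using positive_definite_congruent_mat_1[OF assms] .
  then have "det B * det M * det B = 1"
    by (metis det_I det_mul det_transpose)
  then have "det M * (det B)\<^sup>2 = 1"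
    by (simp add: power2_eq_square mult_ac)
  then show ?thesis
    by (metis zero_less_one zero_less_mult_pos2 zero_le_power2 less_eq_real_def mult_zero_right zero_neq_one)
qed

text \<open>
  The substitution \<open>x = B *v u\<close> with \<open>transpose B ** M ** B = mat 1\<close> turns the integrand into the standard Gaussian,
  and \<open>(det B)\<^sup>2 * det M = 1\<close>.
\<close>

lemma nn_integral_gaussian_quadratic_form:
  fixes M :: "real^'n^'n"
  assumes sym: "transpose M = M" and pos: "\<And>x. x \<noteq> 0 \<Longrightarrow> x \<bullet> (M *v x) > 0" and a: "a > 0"
  shows "(\<integral>\<^sup>+x. ennreal (exp (- a * (x \<bullet> (M *v x)))) \<partial>lborel)
           = ennreal ((pi / a) powr (real CARD('n) / 2) / sqrt (det M))"
proof -
  obtain B :: "real^'n^'n" where B: "transpose B ** M ** B = mat 1"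
    using positive_definite_congruent_mat_1[OF sym pos] .
  then have "det B * det M * det B = 1"
    by (metis det_I det_mul det_transpose)
  then have d: "(det B)\<^sup>2 * det M = 1" "det B \<noteq> 0"
    by (auto simp: power2_eq_square mult_ac)
  have dM: "det M > 0"
    using positive_definite_det_pos[OF sym pos] .
  have "\<bar>det B\<bar> = 1 / sqrt (det M)"
  proof -
    have "(det B)\<^sup>2 = 1 / det M"
      using d dM by (simp add: field_simps)
    then have "sqrt ((det B)\<^sup>2) = sqrt (1 / det M)"
      by simp
    then show ?thesis
      by (simp add: real_sqrt_divide)
  qed
  moreover have "(B *v x) \<bullet> (M *v (B *v x)) = (norm x)\<^sup>2" for x
  proof -
    have "(B *v x) \<bullet> (M *v (B *v x)) = x \<bullet> ((transpose B ** M ** B) *v x)"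
      by (metis dot_lmul_matrix matrix_vector_mul_assoc transpose_matrix_vector transpose_transpose)
    then show ?thesis
      by (simp add: B power2_norm_eq_inner)
  qed
  moreover have "(\<integral>\<^sup>+x. ennreal (exp (- a * (x \<bullet> (M *v x)))) \<partial>lborel)
      = ennreal \<bar>det (matrix ((*v) B))\<bar> * (\<integral>\<^sup>+x. ennreal (exp (- a * ((B *v x) \<bullet> (M *v (B *v x))))) \<partial>lborel)"
    by (rule nn_integral_lborel_linear) (auto simp: d intro!: borel_measurable_continuous_onI continuous_intros
         linear_continuous_on_compose[OF _ matrix_vector_mul_linear])
  ultimately show ?thesis
    using dM nn_integral_gaussian[OF a, where 'a = "real^'n"] by (simp add: field_simps flip: ennreal_mult)
qed

lemma gaussian_quadratic_form:
  fixes M :: "real^'n^'n"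
  assumes sym: "transpose M = M" and pos: "\<And>x. x \<noteq> 0 \<Longrightarrow> x \<bullet> (M *v x) > 0" and a: "a > 0"
  shows "has_bochner_integral lborel (\<lambda>x. exp (- a * (x \<bullet> (M *v x)))) ((pi / a) powr (real CARD('n) / 2) / sqrt (det M))"
proof (rule has_bochner_integral_nn_integral)
  show "(\<lambda>x. exp (- a * (x \<bullet> (M *v x)))) \<in> borel_measurable lborel"
    by (auto intro!: borel_measurable_continuous_onI continuous_intros
         linear_continuous_on_compose[OF _ matrix_vector_mul_linear])
  show "0 \<le> (pi / a) powr (real CARD('n) / 2) / sqrt (det M)"
    using positive_definite_det_pos[OF sym pos] by simp
qed (use nn_integral_gaussian_quadratic_form[OF sym pos a] in auto)

lemma gaussian_norm:
  assumes a: "a > 0"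
  shows "has_bochner_integral lborel (\<lambda>x::'a::euclidean_space. exp (- a * (norm x)\<^sup>2)) ((pi / a) powr (real DIM('a) / 2))"
  by (rule has_bochner_integral_nn_integral) (use nn_integral_gaussian[OF a, where 'a = 'a] in auto)

section \<open>Taylor and growth estimates\<close>

lemma abs_exp_minus_linear_le:
  fixes y :: real
  assumes "\<bar>y\<bar> \<le> 1"
  shows "\<bar>exp y - (1 + y)\<bar> \<le> 2 * y\<^sup>2"
proof -
  obtain \<xi> where \<xi>: "\<bar>\<xi>\<bar> \<le> \<bar>y\<bar>" "exp y = (\<Sum>m<2. y ^ m / fact m) + exp \<xi> / fact 2 * y ^ 2"
    using Maclaurin_exp_le[of y 2] by auto
  have "exp \<xi> \<le> exp 1" using \<xi>(1) assms by simp
  then have e: "exp \<xi> / 2 \<le> 2" using exp_le by linarith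
  have "\<bar>exp y - (1 + y)\<bar> = exp \<xi> / 2 * y\<^sup>2"
    using \<xi>(2) by (simp add: eval_nat_numeral abs_mult)
  also have "\<dots> \<le> 2 * y\<^sup>2" using e by (intro mult_right_mono) auto
  finally show ?thesis .
qed

lemma abs_exp_minus_quadratic_le:
  fixes y :: real
  assumes "\<bar>y\<bar> \<le> 1"
  shows "\<bar>exp y - (1 + y + y\<^sup>2 / 2)\<bar> \<le> \<bar>y\<bar> ^ 3"
proof -
  obtain \<xi> where \<xi>: "\<bar>\<xi>\<bar> \<le> \<bar>y\<bar>" "exp y = (\<Sum>m<3. y ^ m / fact m) + exp \<xi> / fact 3 * y ^ 3"
    using Maclaurin_exp_le[of y 3] by auto
  have "exp \<xi> \<le> exp 1" using \<xi>(1) assms by simp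
  then have e: "exp \<xi> / 6 \<le> 1" using exp_le by linarith
  have "\<bar>exp y - (1 + y + y\<^sup>2 / 2)\<bar> = exp \<xi> / 6 * \<bar>y\<bar> ^ 3"
    using \<xi>(2) by (simp add: eval_nat_numeral abs_mult)
  also have "\<dots> \<le> 1 * \<bar>y\<bar> ^ 3" using e by (intro mult_right_mono) auto
  finally show ?thesis by simp
qed

lemma norm_cis_taylor2:
  fixes y :: real
  shows "cmod (cis y - (1 + \<i> * y - y\<^sup>2 / 2)) \<le> \<bar>y\<bar> ^ 3 / 6"
  using iexp_approx1[of y 2]
  by (simp add: cis_conv_exp numeral_2_eq_2 numeral_3_eq_3 fact_numeral power_mult_distrib power2_eq_square algebra_simps)

lemma abs_cos_taylor:
  fixes y :: real
  shows "\<bar>cos y - (1 - y\<^sup>2 / 2)\<bar> \<le> y ^ 4 / 24"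
proof -
  have "\<bar>Re (iexp y - (\<Sum>k\<le>3. (\<i> * y) ^ k / fact k))\<bar> \<le> \<bar>y\<bar> ^ Suc 3 / fact (Suc 3)"
    using iexp_approx1[of y 3] abs_Re_le_cmod order_trans by blast
  moreover have "Re (iexp y - (\<Sum>k\<le>3. (\<i> * y) ^ k / fact k)) = cos y - (1 - y\<^sup>2 / 2)"
    by (simp add: numeral_3_eq_3 power2_eq_square Re_exp)
  ultimately show ?thesis
    by (simp add: fact_numeral power_even_abs eval_nat_numeral)
qed

lemma norm_one_plus_power_diff_le:
  fixes h :: complex
  shows "cmod ((1 + h) ^ N - 1 - of_nat N * h) \<le> (real N * cmod h)\<^sup>2 * exp (real N * cmod h)"
proof (induction N)
  case (Suc N)
  have "(1 + h) ^ Suc N - 1 - of_nat (Suc N) * h = (1 + h) * ((1 + h) ^ N - 1 - of_nat N * h) + of_nat N * h\<^sup>2"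
    by (simp add: algebra_simps power2_eq_square)
  then have "cmod ((1 + h) ^ Suc N - 1 - of_nat (Suc N) * h)
      \<le> cmod (1 + h) * cmod ((1 + h) ^ N - 1 - of_nat N * h) + real N * (cmod h)\<^sup>2"
    by (metis norm_mult norm_of_nat norm_power norm_triangle_ineq)
  also have "\<dots> \<le> exp (cmod h) * ((real N * cmod h)\<^sup>2 * exp (real N * cmod h)) + real N * (cmod h)\<^sup>2 * exp (real (Suc N) * cmod h)"
  proof -
    have "cmod (1 + h) \<le> 1 + cmod h" by (metis norm_one norm_triangle_ineq)
    also have "\<dots> \<le> exp (cmod h)" by (rule exp_ge_add_one_self)
    finally have 1: "cmod (1 + h) \<le> exp (cmod h)" .
    have 2: "real N * (cmod h)\<^sup>2 \<le> real N * (cmod h)\<^sup>2 * exp (real (Suc N) * cmod h)"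
      using mult_left_mono[of 1 "exp (real (Suc N) * cmod h)" "real N * (cmod h)\<^sup>2"] by simp
    show ?thesis
      by (intro add_mono[OF mult_mono[OF 1 Suc.IH] 2]) auto
  qed
  also have "\<dots> = ((real N)\<^sup>2 + real N) * (cmod h)\<^sup>2 * exp (real (Suc N) * cmod h)"
    by (simp add: algebra_simps exp_add)
  also have "\<dots> \<le> (real (Suc N))\<^sup>2 * (cmod h)\<^sup>2 * exp (real (Suc N) * cmod h)"
    by (intro mult_right_mono) (auto simp: power2_eq_square algebra_simps)
  finally show ?case by (simp add: power_mult_distrib)
qed auto

text \<open>
  Write \<open>\<phi> = exp (- q / 2) * (1 + h)\<close>. The cubic term of \<open>\<phi>\<close> is imaginary, so \<open>h\<close> has size \<open>a\<^sup>3\<close> but its real part has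
  size \<open>a\<^sup>4\<close>. In \<open>(1 + h)\<^sup>N = 1 + N h + ...\<close> the first-order term therefore contributes only \<open>N a\<^sup>4\<close> to the real part,
  and the remainder is quadratic in \<open>N h\<close>. With \<open>a\<close> of order \<open>1 / sqrt N\<close> both errors are of order \<open>1/N\<close>.
\<close>

lemma Re_charfun_power_approx:
  fixes p Y :: "'i \<Rightarrow> real"
  assumes fin: "finite I" and p: "\<And>i. i \<in> I \<Longrightarrow> p i \<ge> 0" "(\<Sum>i\<in>I. p i) = 1"
    and mean: "(\<Sum>i\<in>I. p i * Y i) = 0" and Y: "\<And>i. i \<in> I \<Longrightarrow> \<bar>Y i\<bar> \<le> a" and a: "0 \<le> a" "a \<le> 1"
  defines "q \<equiv> (\<Sum>i\<in>I. p i * (Y i)\<^sup>2)"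
  shows "\<bar>Re ((\<Sum>i\<in>I. p i * cis (Y i)) ^ N) - exp (- (real N * q / 2))\<bar>
          \<le> exp (- (real N * q / 2)) * (real N * a ^ 4 + 4 * (real N)\<^sup>2 * a ^ 6 * exp (2 * real N * a ^ 3))"
proof -
  define \<phi> where "\<phi> = (\<Sum>i\<in>I. p i * cis (Y i))"
  define h where "h = \<phi> * exp (q / 2) - 1"
  have avg: "(\<Sum>i\<in>I. p i * f i) \<le> B" if "\<And>i. i \<in> I \<Longrightarrow> f i \<le> B" for f :: "'i \<Rightarrow> real" and B
  proof -
    have "(\<Sum>i\<in>I. p i * f i) \<le> (\<Sum>i\<in>I. p i * B)"
      using that p by (intro sum_mono mult_left_mono) auto
    then show ?thesis using p(2) by (simp flip: sum_distrib_right)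
  qed
  have q: "0 \<le> q" "q \<le> a\<^sup>2"
  proof -
    show "0 \<le> q" unfolding q_def using p by (auto intro!: sum_nonneg)
    show "q \<le> a\<^sup>2" unfolding q_def
      using Y by (intro avg) (metis abs_le_square_iff abs_of_nonneg a(1))
  qed
  have 1: "cmod (\<phi> - (1 - q / 2)) \<le> a ^ 3 / 6"
  proof -
    have "\<phi> - (1 - q / 2) = (\<Sum>i\<in>I. p i * (cis (Y i) - (1 + \<i> * Y i - (Y i)\<^sup>2 / 2)))"
    proof -
      have "(\<Sum>i\<in>I. p i * (1 + \<i> * Y i - (Y i)\<^sup>2 / 2)) = of_real (\<Sum>i\<in>I. p i) + \<i> * of_real (\<Sum>i\<in>I. p i * Y i) - of_real q / 2"
        by (simp add: q_def algebra_simps sum.distrib sum_subtractf sum_distrib_left sum_divide_distrib)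
      then show ?thesis
        using p(2) mean by (simp add: \<phi>_def right_diff_distrib sum_subtractf)
    qed
    also have "cmod \<dots> \<le> (\<Sum>i\<in>I. p i * (\<bar>Y i\<bar> ^ 3 / 6))"
    proof (rule sum_norm_le)
      show "cmod (p i * (cis (Y i) - (1 + \<i> * Y i - (Y i)\<^sup>2 / 2))) \<le> p i * (\<bar>Y i\<bar> ^ 3 / 6)" if "i \<in> I" for i
        unfolding norm_mult using p(1)[OF that] norm_cis_taylor2[of "Y i"]
        by (simp only: norm_of_real abs_of_nonneg) (rule mult_left_mono)
    qed
    also have "\<dots> \<le> a ^ 3 / 6"
      using Y by (intro avg) (auto intro!: power_mono)
    finally show ?thesis .
  qed
  have 2: "\<bar>Re \<phi> - (1 - q / 2)\<bar> \<le> a ^ 4 / 24"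
  proof -
    have "Re \<phi> - (1 - q / 2) = (\<Sum>i\<in>I. p i * (cos (Y i) - (1 - (Y i)\<^sup>2 / 2)))"
      using p(2) by (simp add: \<phi>_def q_def algebra_simps sum.distrib sum_subtractf sum_divide_distrib)
    also have "\<bar>\<dots>\<bar> \<le> (\<Sum>i\<in>I. p i * ((Y i) ^ 4 / 24))"
    proof (rule order_trans[OF sum_abs sum_mono])
      show "\<bar>p i * (cos (Y i) - (1 - (Y i)\<^sup>2 / 2))\<bar> \<le> p i * ((Y i) ^ 4 / 24)" if "i \<in> I" for i
        unfolding abs_mult using p(1)[OF that] abs_cos_taylor[of "Y i"]
        by (simp only: abs_of_nonneg) (rule mult_left_mono)
    qed
    also have "\<dots> \<le> a ^ 4 / 24"
    proof (rule avg)
      show "Y i ^ 4 / 24 \<le> a ^ 4 / 24" if "i \<in> I" for i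
        using power_mono[OF Y[OF that], of 4] by simp
    qed
    finally show ?thesis .
  qed
  have 3: "\<bar>exp (- (q / 2)) - (1 - q / 2)\<bar> \<le> a ^ 4 / 4"
  proof -
    have q1: "q \<le> 1" using q a by (metis order_trans power_le_one)
    then have "\<bar>exp (- (q / 2)) - (1 + - (q / 2) + (q / 2)\<^sup>2 / 2)\<bar> \<le> (q / 2) ^ 3"
      using abs_exp_minus_quadratic_le[of "- (q / 2)"] q by simp
    moreover have "(q / 2) ^ 3 \<le> (q / 2)\<^sup>2 / 2"
      using q q1 mult_left_mono[of "q / 2" "1 / 2" "(q / 2)\<^sup>2"] by (simp add: eval_nat_numeral)
    moreover have "0 \<le> (q / 2)\<^sup>2" by simp
    ultimately have "\<bar>exp (- (q / 2)) - (1 - q / 2)\<bar> \<le> (q / 2)\<^sup>2"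
      unfolding abs_le_iff by linarith
    also have "\<dots> = q\<^sup>2 / 4" by (simp add: power_divide)
    also have "\<dots> \<le> (a\<^sup>2)\<^sup>2 / 4"
      using q by (intro divide_right_mono power_mono) auto
    finally show ?thesis by simp
  qed
  have a43: "a ^ 4 \<le> a ^ 3"
    using a by (intro power_decreasing) auto
  have e2: "exp (q / 2) \<le> 2"
  proof -
    have "q / 2 \<le> 1 / 2" using q a by (metis divide_right_mono order_trans power_le_one zero_le_numeral)
    then have "exp (q / 2) \<le> exp (1 / 2)" by simp
    also have "\<dots> \<le> 2" using exp_bound_half[of "1/2::real"] by simp
    finally show ?thesis .
  qed
  have h_eq: "h = exp (q / 2) * (\<phi> - exp (- (q / 2)))"
    by (simp add: h_def algebra_simps exp_minus flip: of_real_mult)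
  have h: "cmod h \<le> 2 * a ^ 3"
  proof -
    have "cmod (\<phi> - exp (- (q / 2))) \<le> cmod (\<phi> - (1 - q / 2)) + \<bar>exp (- (q / 2)) - (1 - q / 2)\<bar>"
    proof -
      have "\<phi> - exp (- (q / 2)) = (\<phi> - (1 - q / 2)) - of_real (exp (- (q / 2)) - (1 - q / 2))"
        by simp
      then show ?thesis by (metis norm_triangle_ineq4 norm_of_real)
    qed
    also have "\<dots> \<le> a ^ 3"
      using 1 3 a43 zero_le_power[OF a(1), of 3] by linarith
    finally have "cmod h \<le> exp (q / 2) * a ^ 3"
      unfolding h_eq by (simp add: norm_mult)
    also have "\<dots> \<le> 2 * a ^ 3" using e2 a by (intro mult_right_mono) auto
    finally show ?thesis .
  qed
  have Reh: "\<bar>Re h\<bar> \<le> a ^ 4"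
  proof -
    have "\<bar>Re \<phi> - exp (- (q / 2))\<bar> \<le> a ^ 4 / 2"
      using 2 3 zero_le_power[OF a(1), of 4] unfolding abs_le_iff by linarith
    moreover have "Re h = exp (q / 2) * (Re \<phi> - exp (- (q / 2)))"
      unfolding h_eq by simp
    ultimately have "\<bar>Re h\<bar> \<le> exp (q / 2) * (a ^ 4 / 2)"
      by (simp add: abs_mult)
    also have "\<dots> \<le> 2 * (a ^ 4 / 2)" using e2 by (intro mult_right_mono) auto
    finally show ?thesis by simp
  qed
  have "\<phi> = exp (- (q / 2)) * (1 + h)"
    by (simp add: h_def exp_minus)
  then have "\<phi> ^ N = of_real (exp (- (real N * q / 2))) * (1 + h) ^ N"
    by (simp add: power_mult_distrib flip: of_real_power exp_of_nat_mult)
  then have "Re (\<phi> ^ N) - exp (- (real N * q / 2)) = exp (- (real N * q / 2)) * Re ((1 + h) ^ N - 1)"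
    by (simp add: algebra_simps)
  moreover have "\<bar>Re ((1 + h) ^ N - 1)\<bar> \<le> real N * a ^ 4 + 4 * (real N)\<^sup>2 * a ^ 6 * exp (2 * real N * a ^ 3)"
  proof -
    have "Re ((1 + h) ^ N - 1) = real N * Re h + Re ((1 + h) ^ N - 1 - of_nat N * h)"
      by simp
    then have "\<bar>Re ((1 + h) ^ N - 1)\<bar> \<le> real N * \<bar>Re h\<bar> + cmod ((1 + h) ^ N - 1 - of_nat N * h)"
      using abs_Re_le_cmod[of "(1 + h) ^ N - 1 - of_nat N * h"]
        abs_triangle_ineq[of "real N * Re h" "Re ((1 + h) ^ N - 1 - of_nat N * h)"]
      by (simp only: abs_mult abs_of_nat)
    also have "\<dots> \<le> real N * a ^ 4 + (real N * (2 * a ^ 3))\<^sup>2 * exp (real N * (2 * a ^ 3))"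
    proof (rule add_mono)
      show "real N * \<bar>Re h\<bar> \<le> real N * a ^ 4" using Reh by (rule mult_left_mono) auto
      have "real N * cmod h \<le> real N * (2 * a ^ 3)" using h by (rule mult_left_mono) auto
      then have "(real N * cmod h)\<^sup>2 * exp (real N * cmod h) \<le> (real N * (2 * a ^ 3))\<^sup>2 * exp (real N * (2 * a ^ 3))"
        by (intro mult_mono power_mono) (use h in auto)
      then show "cmod ((1 + h) ^ N - 1 - of_nat N * h) \<le> (real N * (2 * a ^ 3))\<^sup>2 * exp (real N * (2 * a ^ 3))"
        using norm_one_plus_power_diff_le[of h N] by linarith
    qed
    finally show ?thesis
      by (simp add: power_mult_distrib algebra_simps flip: power_mult)
  qed
  ultimately show ?thesis
    unfolding \<phi>_def by (simp add: abs_mult)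
qed

lemma power_le_exp:
  fixes z c :: real
  assumes "0 \<le> z" "c > 0" "m > 0"
  shows "z ^ m \<le> (real m / c) ^ m * exp (c * z)"
proof -
  have "z = (m / c) * (c * z / m)" using assms by (simp add: field_simps)
  also have "\<dots> \<le> (m / c) * exp (c * z / m)"
  proof (rule mult_left_mono)
    show "c * z / m \<le> exp (c * z / m)"
      using exp_ge_add_one_self[of "c * z / m"] by linarith
  qed (use assms in auto)
  finally have "z ^ m \<le> ((m / c) * exp (c * z / m)) ^ m"
    using assms by (intro power_mono) auto
  also have "\<dots> = (m / c) ^ m * exp (c * z)"
  proof -
    have "exp (c * z / m) ^ m = exp (c * z)"
      using assms by (simp flip: exp_of_nat_mult)
    then show ?thesis by (simp only: power_mult_distrib)
  qed
  finally show ?thesis .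
qed

lemma geometric_le_powr:
  fixes \<theta> :: real
  assumes "0 \<le> \<theta>" "\<theta> < 1"
  obtains C where "\<And>N. N \<ge> 1 \<Longrightarrow> \<theta> ^ N \<le> C * real N powr (- a)"
proof -
  \<comment> \<open>\<open>\<theta>\<close> may be 0; a positive base has a logarithm, which governs the decay\<close>
  define \<theta>' where "\<theta>' = max \<theta> (1 / 2)"
  have \<theta>': "0 < \<theta>'" "\<theta>' < 1" "\<theta> \<le> \<theta>'" using assms by (auto simp: \<theta>'_def)
  have lim: "(\<lambda>N. real N powr a * \<theta>' ^ N) \<longlonglongrightarrow> 0"
    using \<theta>' by real_asymp
  obtain C where C: "\<And>N. norm (real N powr a * \<theta>' ^ N) \<le> C"
    using convergent_imp_Bseq[OF convergentI[OF lim]] unfolding Bseq_def by blast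
  have "\<theta> ^ N \<le> C * real N powr (- a)" if N: "N \<ge> 1" for N
  proof -
    have "\<theta> ^ N \<le> \<theta>' ^ N" using \<theta>' assms by (intro power_mono) auto
    also have "\<dots> = (real N powr a * \<theta>' ^ N) * real N powr (- a)"
      using N by (simp add: powr_minus)
    also have "\<dots> \<le> C * real N powr (- a)"
      using C[of N] by (intro mult_right_mono) auto
    finally show ?thesis .
  qed
  then show thesis by (rule that)
qed

text \<open>
  Homogeneity reduces the bound to the unit sphere, where the form attains a positive minimum.
\<close>

lemma quadratic_form_lower_bound:
  fixes \<Psi> :: "'a::euclidean_space \<Rightarrow> real"
  assumes cont: "continuous_on (sphere 0 1) \<Psi>" and hom: "\<And>a x. \<Psi> (a *\<^sub>R x) = a\<^sup>2 * \<Psi> x"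
    and pos: "\<And>x. x \<noteq> 0 \<Longrightarrow> \<Psi> x > 0"
  obtains \<kappa> where "\<kappa> > 0" "\<And>x. \<kappa> * (norm x)\<^sup>2 \<le> \<Psi> x"
proof -
  have ne: "sphere (0::'a) 1 \<noteq> {}" by simp
  obtain x0 where x0: "x0 \<in> sphere 0 1" "\<forall>x\<in>sphere 0 1. \<Psi> x0 \<le> \<Psi> x"
    using continuous_attains_inf[OF compact_sphere ne cont] by (elim bexE)
  have "\<Psi> x0 * (norm x)\<^sup>2 \<le> \<Psi> x" for x
  proof (cases "x = 0")
    case True
    then show ?thesis using hom[of 0 x] by simp
  next
    case False
    have "\<Psi> x = (norm x)\<^sup>2 * \<Psi> ((1 / norm x) *\<^sub>R x)"
      using False by (simp add: hom power_divide)
    moreover have "\<Psi> x0 \<le> \<Psi> ((1 / norm x) *\<^sub>R x)"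
      using False by (intro bspec[OF x0(2)]) simp
    ultimately show ?thesis by (simp add: mult.commute[of "\<Psi> x0"] mult_left_mono)
  qed
  moreover have "\<Psi> x0 > 0" using x0(1) by (intro pos) auto
  ultimately show thesis using that by blast
qed

lemma differentiable_prod_real:
  fixes f :: "'i \<Rightarrow> 'a::real_normed_vector \<Rightarrow> real"
  assumes "finite I" "\<And>i. i \<in> I \<Longrightarrow> f i differentiable at x"
  shows "(\<lambda>t. \<Prod>i\<in>I. f i t) differentiable at x"
  using assms by (induction rule: finite_induct) (simp_all del: prod.infinite)

lemma differentiable_imp_local_lipschitz:
  fixes f :: "'a::real_normed_vector \<Rightarrow> real"
  assumes "f differentiable at x"
  obtains \<delta> C where "\<delta> > 0" "\<And>y. norm (y - x) < \<delta> \<Longrightarrow> \<bar>f y - f x\<bar> \<le> C * norm (y - x)"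
proof -
  obtain D where D: "(f has_derivative D) (at x)" using assms by (auto simp: differentiable_def)
  then have lin: "bounded_linear D"
    and "\<forall>e>0. \<exists>d>0. \<forall>y. norm (y - x) < d \<longrightarrow> norm (f y - f x - D (y - x)) \<le> e * norm (y - x)"
    unfolding has_derivative_at_alt by auto
  then obtain \<delta> where \<delta>: "\<delta> > 0" "\<And>y. norm (y - x) < \<delta> \<Longrightarrow> norm (f y - f x - D (y - x)) \<le> 1 * norm (y - x)"
    by (meson zero_less_one)
  obtain K where K: "\<And>h. norm (D h) \<le> norm h * K" using bounded_linear.bounded[OF lin] by blast
  have "\<bar>f y - f x\<bar> \<le> (1 + K) * norm (y - x)" if "norm (y - x) < \<delta>" for y
  proof -
    have "\<bar>f y - f x\<bar> \<le> norm (y - x) + norm (y - x) * K"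
      using \<delta>(2)[OF that] K[of "y - x"] unfolding real_norm_def by linarith
    then show ?thesis by (simp add: distrib_right mult.commute)
  qed
  then show thesis using \<delta>(1) that by blast
qed

section \<open>Periodic integrals and Fourier inversion\<close>

definition integer_vectors :: "(real^'n) set" where
  "integer_vectors = {u. \<forall>i. u $ i \<in> \<int>}"

definition unit_cube :: "(real^'n) set" where
  "unit_cube = {t. \<forall>i. 0 \<le> t $ i \<and> t $ i < 1}"

lemma unit_cube_borel [measurable]: "unit_cube \<in> sets borel"
proof -
  have "unit_cube = (\<Inter>i. {t::real^'n. 0 \<le> t $ i} \<inter> {t. t $ i < 1})"
    by (auto simp: unit_cube_def)
  also have "\<dots> \<in> sets borel"
    by (intro sets.countable_INT'' sets.Int borel_closed borel_open closed_Collect_le open_Collect_less continuous_intros) auto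
  finally show ?thesis .
qed

lemma unit_cube_subset_cbox: "unit_cube \<subseteq> cbox 0 1"
  by (auto simp: unit_cube_def mem_box_cart less_imp_le)

lemma bounded_unit_cube: "bounded unit_cube"
  using bounded_subset[OF bounded_cbox unit_cube_subset_cbox] .

lemma measure_unit_cube: "measure lborel (unit_cube :: (real^'n) set) = 1"
proof -
  have sub: "box 0 1 \<subseteq> (unit_cube :: (real^'n) set)"
    by (auto simp: unit_cube_def mem_box_cart less_imp_le)
  have one: "(1::real^'n) \<bullet> b = 1" if "b \<in> Basis" for b
    using that by (auto simp: Basis_vec_def inner_axis)
  have box1: "measure lborel (cbox 0 (1::real^'n)) = 1" "measure lborel (box 0 (1::real^'n)) = measure lborel (cbox 0 (1::real^'n))"
    using one by (simp_all add: measure_lborel_box_eq measure_lborel_cbox_eq)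
  have "measure lborel (box 0 (1::real^'n)) \<le> measure lborel (unit_cube :: (real^'n) set)"
    by (intro measure_mono_fmeasurable sub)
       (use emeasure_bounded_finite[OF bounded_unit_cube[where 'a = 'n]] in \<open>auto simp: fmeasurable_def\<close>)
  moreover have "measure lborel (unit_cube :: (real^'n) set) \<le> measure lborel (cbox 0 (1::real^'n))"
    by (intro measure_mono_fmeasurable unit_cube_subset_cbox) auto
  ultimately show ?thesis using box1 by simp
qed

lemma integer_translate_in_unit_cube:
  "{u \<in> integer_vectors. t + u \<in> unit_cube} = {\<chi> i. - of_int \<lfloor>t $ i\<rfloor>}"
proof (intro set_eqI iffI)
  fix u assume "u \<in> {u \<in> integer_vectors. t + u \<in> unit_cube}"
  then have u: "u $ i \<in> \<int>" "0 \<le> t $ i + u $ i" "t $ i + u $ i < 1" for i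
    by (auto simp: integer_vectors_def unit_cube_def)
  have "u $ i = - of_int \<lfloor>t $ i\<rfloor>" for i
  proof -
    obtain z where z: "u $ i = of_int z" using u(1)[of i] by (auto elim: Ints_cases)
    have "\<lfloor>t $ i\<rfloor> = - z"
      using u(2,3)[of i] unfolding z by linarith
    then show ?thesis by (simp add: z)
  qed
  then show "u \<in> {\<chi> i. - of_int \<lfloor>t $ i\<rfloor>}" by (auto simp: vec_eq_iff)
next
  fix u assume "u \<in> {\<chi> i. - real_of_int \<lfloor>t $ i\<rfloor>}"
  then show "u \<in> {u \<in> integer_vectors. t + u \<in> unit_cube}"
    by (auto simp: integer_vectors_def unit_cube_def) linarith+
qed

lemma integral_lborel_translate:
  fixes f :: "'a::euclidean_space \<Rightarrow> 'b::{banach,second_countable_topology}"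
  assumes [measurable]: "f \<in> borel_measurable borel"
  shows "(\<integral>t. f (u + t) \<partial>lborel) = (\<integral>t. f t \<partial>lborel)"
proof -
  have "(\<integral>t. f t \<partial>lborel) = (\<integral>t. f t \<partial>distr lborel borel ((+) u))"
    by (simp add: lborel_distr_plus)
  also have "\<dots> = (\<integral>t. f (u + t) \<partial>lborel)"
    by (rule integral_distr) auto
  finally show ?thesis ..
qed

lemma set_integrable_bounded:
  fixes F :: "'a::euclidean_space \<Rightarrow> 'b::{banach,second_countable_topology}"
  assumes "E \<in> sets borel" "bounded E" "F \<in> borel_measurable borel" "\<And>t. t \<in> E \<Longrightarrow> norm (F t) \<le> K"
  shows "set_integrable lborel E F"
  unfolding set_integrable_def
  by (rule integrableI_bounded_set_indicator[where B = K])
     (use assms emeasure_bounded_finite[of E] in auto)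

text \<open>
  Both sides are the sum over \<open>u \<in> H\<close> of the integrals of \<open>F\<close> over \<open>{t \<in> E2. t + u \<in> E1}\<close>: sort by \<open>t\<close> directly, or
  translate by \<open>u\<close> first. With \<open>m1 = m2 = 1\<close> it says that integrals over two fundamental domains agree; with \<open>E1\<close> a
  union of several small balls it collects equal peaks into one.
\<close>

lemma periodic_integral_unfold:
  fixes F :: "'a::euclidean_space \<Rightarrow> complex" and H E1 E2 :: "'a set"
  assumes neg: "\<And>u. u \<in> H \<Longrightarrow> - u \<in> H"
    and lf: "\<And>R. finite {u \<in> H. norm u \<le> R}"
    and E1[measurable]: "E1 \<in> sets borel" and b1: "bounded E1"
    and E2[measurable]: "E2 \<in> sets borel" and b2: "bounded E2"
    and F[measurable]: "F \<in> borel_measurable borel" and K: "\<And>t. norm (F t) \<le> K"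
    and per: "\<And>u t. u \<in> H \<Longrightarrow> F (t + u) = F t"
    and m1: "\<And>t. t \<in> E2 \<Longrightarrow> card {u \<in> H. t + u \<in> E1} = m1"
    and m2: "\<And>t. t \<in> E1 \<Longrightarrow> card {u \<in> H. t + u \<in> E2} = m2"
  shows "of_nat m1 * (LINT t:E2|lborel. F t) = of_nat m2 * (LINT t:E1|lborel. F t)"
proof -
  obtain R1 where R1: "\<And>t. t \<in> E1 \<Longrightarrow> norm t \<le> R1" using b1 by (auto simp: bounded_iff)
  obtain R2 where R2: "\<And>t. t \<in> E2 \<Longrightarrow> norm t \<le> R2" using b2 by (auto simp: bounded_iff)
  define U where "U = {u \<in> H. norm u \<le> R1 + R2}"
  have U: "finite U" unfolding U_def by (rule lf)
  have inU: "u \<in> U" if "u \<in> H" "t \<in> E1 \<and> t + u \<in> E2 \<or> t \<in> E2 \<and> t + u \<in> E1" for t u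
  proof -
    have "norm u \<le> norm (t + u) + norm t"
      using norm_triangle_ineq4[of "t + u" t] by simp
    also have "\<dots> \<le> R1 + R2"
      using that(2) R1[of t] R2[of t] R1[of "t + u"] R2[of "t + u"] by auto
    finally show ?thesis using that(1) by (simp add: U_def)
  qed
  have count: "(\<Sum>u\<in>U. indicator A t * indicator B (t + u) *\<^sub>R F t) = of_nat m * (indicator A t *\<^sub>R F t)"
    if "\<And>t. t \<in> A \<Longrightarrow> card {u \<in> H. t + u \<in> B} = m" "\<And>u t. u \<in> H \<Longrightarrow> t \<in> A \<Longrightarrow> t + u \<in> B \<Longrightarrow> u \<in> U" for A B t m
  proof (cases "t \<in> A")
    case True
    have "{u \<in> H. t + u \<in> B} = {u \<in> U. t + u \<in> B}"
      using that(2)[OF _ True] by (auto simp: U_def)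
    then have "card {u \<in> U. t + u \<in> B} = m" using that(1)[OF True] by simp
    then have "(\<Sum>u\<in>U. indicator B (t + u) :: complex) = of_nat m"
      using U by (simp add: indicator_def sum.If_cases Int_def)
    then show ?thesis using True by (simp add: scaleR_conv_of_real of_real_indicator flip: sum_distrib_right)
  qed simp
  have int: "integrable lborel (\<lambda>t. indicator A t * indicator B (t + u) *\<^sub>R F t)"
    if [measurable]: "A \<in> sets borel" "B \<in> sets borel" and "bounded A" for A B :: "'a set" and u
  proof -
    have "set_integrable lborel A (\<lambda>t. indicator B (t + u) *\<^sub>R F t)"
      by (rule set_integrable_bounded[where K = K])
         (use that K in \<open>auto simp: indicator_def intro: order_trans[OF norm_ge_zero K]\<close>)
    then show ?thesis
      by (simp add: set_integrable_def scaleR_conv_of_real of_real_indicator mult_ac)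
  qed
  have "of_nat m1 * (LINT t:E2|lborel. F t) = (\<integral>t. (\<Sum>u\<in>U. indicator E2 t * indicator E1 (t + u) *\<^sub>R F t) \<partial>lborel)"
    by (subst count[OF m1]) (use inU in \<open>auto simp: set_lebesgue_integral_def simp del: mult_scaleR_right\<close>)
  also have "\<dots> = (\<Sum>u\<in>U. \<integral>t. indicator E2 t * indicator E1 (t + u) *\<^sub>R F t \<partial>lborel)"
    by (rule Bochner_Integration.integral_sum) (intro int b2 E1 E2)
  also have "\<dots> = (\<Sum>u\<in>U. \<integral>t. indicator E1 t * indicator E2 (t + u) *\<^sub>R F t \<partial>lborel)"
  proof (rule sum.reindex_bij_witness[of _ uminus uminus])
    fix u assume u: "u \<in> U"
    then have "- u \<in> H" using neg by (simp add: U_def)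
    have "(\<integral>t. indicator E2 t * indicator E1 (t + u) *\<^sub>R F t \<partial>lborel)
        = (\<integral>t. indicator E2 (- u + t) * indicator E1 ((- u + t) + u) *\<^sub>R F (- u + t) \<partial>lborel)"
      by (rule integral_lborel_translate[symmetric]) measurable
    also have "\<dots> = (\<integral>t. indicator E1 t * indicator E2 (t + - u) *\<^sub>R F t \<partial>lborel)"
      using per[OF \<open>- u \<in> H\<close>] by (simp add: scaleR_conv_of_real of_real_indicator mult_ac)
    finally show "(\<integral>t. indicator E1 t * indicator E2 (t + - u) *\<^sub>R F t \<partial>lborel) = (\<integral>t. indicator E2 t * indicator E1 (t + u) *\<^sub>R F t \<partial>lborel)"
      by simp
  qed (use neg in \<open>auto simp: U_def\<close>)
  also have "\<dots> = (\<integral>t. (\<Sum>u\<in>U. indicator E1 t * indicator E2 (t + u) *\<^sub>R F t) \<partial>lborel)"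
    by (rule Bochner_Integration.integral_sum[symmetric]) (intro int b1 E1 E2)
  also have "\<dots> = of_nat m2 * (LINT t:E1|lborel. F t)"
    by (subst count[OF m2]) (use inU in \<open>auto simp: set_lebesgue_integral_def simp del: mult_scaleR_right\<close>)
  finally show ?thesis .
qed

lemma finite_integer_vectors_norm_le: "finite {u \<in> integer_vectors :: (real^'n) set. norm u \<le> R}"
proof -
  have "{u \<in> integer_vectors :: (real^'n) set. norm u \<le> R}
      \<subseteq> (\<lambda>f. \<chi> i. real_of_int (f i)) ` (UNIV \<rightarrow>\<^sub>E {-\<lceil>R\<rceil>..\<lceil>R\<rceil>})"
  proof
    fix u :: "real^'n" assume "u \<in> {u \<in> integer_vectors. norm u \<le> R}"
    then have u: "u $ i \<in> \<int>" "\<bar>u $ i\<bar> \<le> R" for i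
      using component_le_norm_cart[of u i] by (auto simp: integer_vectors_def)
    have eq: "u = (\<chi> i. real_of_int \<lfloor>u $ i\<rfloor>)"
      using u(1) by (auto simp: vec_eq_iff elim!: Ints_cases)
    have "(\<lambda>i. \<lfloor>u $ i\<rfloor>) \<in> UNIV \<rightarrow>\<^sub>E {-\<lceil>R\<rceil>..\<lceil>R\<rceil>}"
    proof (intro PiE_I)
      fix i
      show "\<lfloor>u $ i\<rfloor> \<in> {-\<lceil>R\<rceil>..\<lceil>R\<rceil>}" using u(2)[of i] by (auto simp: le_floor_iff abs_le_iff) linarith+
    qed auto
    then show "u \<in> (\<lambda>f. \<chi> i. real_of_int (f i)) ` (UNIV \<rightarrow>\<^sub>E {-\<lceil>R\<rceil>..\<lceil>R\<rceil>})"
      using eq by (simp add: image_iff) (metis (no_types))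
  qed
  then show ?thesis
    by (rule finite_subset) (auto intro!: finite_PiE)
qed

lemma inner_integer_vectors: "x \<in> integer_vectors \<Longrightarrow> y \<in> integer_vectors \<Longrightarrow> x \<bullet> y \<in> \<int>"
  by (auto simp: inner_vec_def integer_vectors_def)

lemma cis_2pi_add_integer: "z \<in> \<int> \<Longrightarrow> cis (2 * pi * (x + z)) = cis (2 * pi * x)"
  by (auto simp: distrib_left cis_mult[symmetric] elim!: Ints_cases)

text \<open>
  For \<open>h \<noteq> 0\<close> some translation changes the sign of the character but, by periodicity, not its integral.
\<close>

lemma integral_unit_cube_character:
  fixes h :: "real^'n"
  assumes h: "h \<in> integer_vectors"
  shows "(LINT t:unit_cube|lborel. cis (2 * pi * (h \<bullet> t))) = of_bool (h = 0)"
proof (cases "h = 0")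
  case True
  then show ?thesis
    using measure_unit_cube[where 'n = 'n]
      emeasure_bounded_finite[OF bounded_unit_cube]
    by (simp add: set_lebesgue_integral_def scaleR_conv_of_real integral_of_real)
next
  case False
  then obtain i where i: "h $ i \<noteq> 0" by (auto simp: vec_eq_iff)
  \<comment> \<open>the half-integer value makes the character change sign under the translation\<close>
  define v :: "real^'n" where "v = axis i (1 / (2 * h $ i))"
  have hv: "h \<bullet> v = 1 / 2" using i by (simp add: v_def inner_axis)
  let ?F = "\<lambda>t. cis (2 * pi * (h \<bullet> t))"
  let ?V = "(+) v ` unit_cube"
  have F[measurable]: "?F \<in> borel_measurable borel"
    by (intro borel_measurable_continuous_onI continuous_intros)
  have V_eq: "?V = {t. t - v \<in> unit_cube}"
    by (auto simp: image_iff) (metis add_diff_cancel_left' add.commute diff_add_cancel)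
  have V: "?V \<in> sets borel" unfolding V_eq by measurable
  have "of_nat 1 * (LINT t:?V|lborel. ?F t) = of_nat 1 * (LINT t:unit_cube|lborel. ?F t)"
  proof (rule periodic_integral_unfold[where H = integer_vectors and K = 1])
    show "?F (t + u) = ?F t" if "u \<in> integer_vectors" for u t
      using cis_2pi_add_integer[OF inner_integer_vectors[OF h that], of "h \<bullet> t"] by (simp add: inner_add_right)
    show "card {u \<in> integer_vectors. t + u \<in> unit_cube} = 1" for t :: "real^'n"
      by (simp add: integer_translate_in_unit_cube)
    show "card {u \<in> integer_vectors. t + u \<in> ?V} = 1" for t
      unfolding V_eq using integer_translate_in_unit_cube[of "t - v"] by (simp add: algebra_simps)
    show "bounded ?V" by (intro bounded_translation bounded_unit_cube)
  qed (use finite_integer_vectors_norm_le V in \<open>auto simp: integer_vectors_def bounded_unit_cube\<close>)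
  moreover have "(LINT t:?V|lborel. ?F t) = - (LINT t:unit_cube|lborel. ?F t)"
  proof -
    have "(LINT t:?V|lborel. ?F t) = (\<integral>t. indicator ?V (v + t) *\<^sub>R ?F (v + t) \<partial>lborel)"
      unfolding set_lebesgue_integral_def by (rule integral_lborel_translate[symmetric]) (use V in measurable)
    also have "\<dots> = (\<integral>t. - (indicator unit_cube t *\<^sub>R ?F t) \<partial>lborel)"
    proof (intro Bochner_Integration.integral_cong refl)
      fix t
      have "?F (v + t) = - ?F t"
        by (simp add: hv inner_add_right distrib_left cis_mult[symmetric])
      then show "indicator ?V (v + t) *\<^sub>R ?F (v + t) = - (indicator unit_cube t *\<^sub>R ?F t)"
        unfolding V_eq by (simp add: indicator_def)
    qed
    finally show ?thesis by (simp add: set_lebesgue_integral_def)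
  qed
  ultimately show ?thesis using False by simp
qed

lemma sum_power_eq_sum_paths:
  fixes f :: "'i \<Rightarrow> 'c::comm_semiring_1"
  assumes "finite I"
  shows "(\<Sum>i\<in>I. f i) ^ N = (\<Sum>p\<in>{1..N} \<rightarrow>\<^sub>E I. \<Prod>j=1..N. f (p j))"
  using prod_sum_PiE[of "{1..N}" "\<lambda>_. I" "\<lambda>_. f"] assms by simp

lemma cis_sum: "cis (sum f A) = (\<Prod>x\<in>A. cis (f x))"
  by (induction A rule: infinite_finite_induct) (auto simp: cis_mult[symmetric])

text \<open>
  The phase is centered at \<open>x\<close>, the mean position per step, so that the target \<open>N x\<close> needs no separate factor.
\<close>

lemma path_weight_fourier_inversion:
  fixes k :: "'i \<Rightarrow> real^'n" and w :: "'i \<Rightarrow> real"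
  assumes fin: "finite I" and k: "\<And>i. i \<in> I \<Longrightarrow> k i \<in> integer_vectors" and g: "real N *\<^sub>R x \<in> integer_vectors"
  shows "of_real (\<Sum>p \<in> {p \<in> {1..N} \<rightarrow>\<^sub>E I. (\<Sum>j=1..N. k (p j)) = real N *\<^sub>R x}. \<Prod>j=1..N. w (p j))
           = (LINT t:unit_cube|lborel. (\<Sum>i\<in>I. w i * cis (2 * pi * ((k i - x) \<bullet> t))) ^ N)"
proof -
  let ?P = "{1..N} \<rightarrow>\<^sub>E I"
  let ?h = "\<lambda>p. (\<Sum>j=1..N. k (p j)) - real N *\<^sub>R x"
  have finP: "finite ?P" using fin by (intro finite_PiE) auto
  have "(\<Sum>i\<in>I. w i * cis (2 * pi * ((k i - x) \<bullet> t))) ^ N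
      = (\<Sum>p\<in>?P. of_real (\<Prod>j=1..N. w (p j)) * cis (2 * pi * (?h p \<bullet> t)))" for t
  proof -
    have "2 * pi * (?h p \<bullet> t) = (\<Sum>j=1..N. 2 * pi * ((k (p j) - x) \<bullet> t))" for p
      by (simp add: inner_diff_left inner_sum_left sum_subtractf flip: sum_distrib_left)
    then have *: "cis (2 * pi * (?h p \<bullet> t)) = (\<Prod>j=1..N. cis (2 * pi * ((k (p j) - x) \<bullet> t)))" for p
      by (simp only: cis_sum)
    show ?thesis
      by (subst sum_power_eq_sum_paths[OF fin]) (simp only: * prod.distrib of_real_prod)
  qed
  then have "(LINT t:unit_cube|lborel. (\<Sum>i\<in>I. w i * cis (2 * pi * ((k i - x) \<bullet> t))) ^ N)
      = (LINT t:unit_cube|lborel. (\<Sum>p\<in>?P. of_real (\<Prod>j=1..N. w (p j)) * cis (2 * pi * (?h p \<bullet> t))))"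
    by simp
  also have "\<dots> = (\<Sum>p\<in>?P. LINT t:unit_cube|lborel. of_real (\<Prod>j=1..N. w (p j)) * cis (2 * pi * (?h p \<bullet> t)))"
  proof -
    have "set_integrable lborel unit_cube (\<lambda>t. of_real (\<Prod>j=1..N. w (p j)) * cis (2 * pi * (?h p \<bullet> t)))" for p
      by (rule set_integrable_bounded[where K = "\<bar>\<Prod>j=1..N. w (p j)\<bar>"])
         (auto simp: norm_mult bounded_unit_cube simp del: of_real_prod intro!: borel_measurable_continuous_onI continuous_intros)
    then show ?thesis
      unfolding set_lebesgue_integral_def set_integrable_def scaleR_sum_right
      by (intro Bochner_Integration.integral_sum) auto
  qed
  also have "\<dots> = (\<Sum>p\<in>?P. of_real (\<Prod>j=1..N. w (p j)) * of_bool (?h p = 0))"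
  proof (rule sum.cong[OF refl])
    fix p assume p: "p \<in> ?P"
    have "?h p \<in> integer_vectors"
      using g k p unfolding integer_vectors_def by (auto simp: PiE_def Pi_def)
    then show "(LINT t:unit_cube|lborel. of_real (\<Prod>j=1..N. w (p j)) * cis (2 * pi * (?h p \<bullet> t))) = of_real (\<Prod>j=1..N. w (p j)) * of_bool (?h p = 0)"
      by (simp add: integral_unit_cube_character del: of_real_prod)
  qed
  also have "\<dots> = of_real (\<Sum>p \<in> {p \<in> ?P. ?h p = 0}. \<Prod>j=1..N. w (p j))"
    using finP by (simp add: sum.If_cases of_bool_def if_distrib Int_def cong: if_cong)
  finally show ?thesis by simp
qed

section \<open>The local limit theorem for walks in the integer lattice\<close>

text \<open>
  Steps are indexed by \<open>I\<close>; the weights are left out of the locale because the estimates must be uniform in them.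
  The last assumption says that the differences of steps span the space.
\<close>

locale lattice_walk =
  fixes I :: "'i set" and k :: "'i \<Rightarrow> real^'n"
  assumes finite_steps: "finite I"
    and steps_integer: "\<And>i. i \<in> I \<Longrightarrow> k i \<in> integer_vectors"
    and steps_span: "\<And>t. (\<And>i j. i \<in> I \<Longrightarrow> j \<in> I \<Longrightarrow> (k i - k j) \<bullet> t = 0) \<Longrightarrow> t = 0"
begin

definition path_weight :: "('i \<Rightarrow> real) \<Rightarrow> nat \<Rightarrow> real^'n \<Rightarrow> real" where
  "path_weight w N g = (\<Sum>q \<in> {q \<in> {1..N} \<rightarrow>\<^sub>E I. (\<Sum>j=1..N. k (q j)) = g}. \<Prod>j=1..N. w (q j))"

definition mean :: "('i \<Rightarrow> real) \<Rightarrow> real^'n" where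
  "mean p = (\<Sum>i\<in>I. p i *\<^sub>R k i)"

text \<open>
  With step probabilities \<open>p\<close> this is the Gram matrix of the map \<open>A_c(S,x)\<close> at the point \<open>x\<close> of mean \<open>mean p\<close>.
\<close>

definition covariance :: "('i \<Rightarrow> real) \<Rightarrow> real^'n^'n" where
  "covariance p = (\<chi> a b. (\<Sum>i\<in>I. p i * (k i $ a * k i $ b)) - mean p $ a * mean p $ b)"

text \<open>
  In coordinates this is the lattice \<open>L(S)\<close>: the points at which the characteristic function of a step has modulus 1.
\<close>

definition periods :: "(real^'n) set" where
  "periods = {t. \<forall>i\<in>I. \<forall>j\<in>I. (k i - k j) \<bullet> t \<in> \<int>}"

text \<open>
  The index of the integer vectors in \<open>periods\<close>, which becomes the order of \<open>\<Pi>(S)\<close>.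
\<close>

definition period_index :: nat where
  "period_index = card (periods // {(x, y). x \<in> periods \<and> y \<in> periods \<and> x - y \<in> integer_vectors})"

lemma steps_nonempty: "I \<noteq> {}"
proof
  assume "I = {}"
  then have "(1::real^'n) = 0" by (intro steps_span) auto
  then show False by (simp add: vec_eq_iff)
qed

lemma steps_diff_integer: "i \<in> I \<Longrightarrow> j \<in> I \<Longrightarrow> k i - k j \<in> integer_vectors"
  using steps_integer[of i] steps_integer[of j] by (auto simp: integer_vectors_def)

lemma integer_vectors_periods: "integer_vectors \<subseteq> periods"
  using inner_integer_vectors steps_diff_integer by (auto simp: periods_def)

lemma periods_minus: "u \<in> periods \<Longrightarrow> - u \<in> periods"
  by (auto simp: periods_def)

lemma periods_diff: "u \<in> periods \<Longrightarrow> v \<in> periods \<Longrightarrow> u - v \<in> periods"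
  by (auto simp: periods_def inner_diff_right[of "k _ - k _"])

lemma periods_add: "u \<in> periods \<Longrightarrow> v \<in> periods \<Longrightarrow> u + v \<in> periods"
  using periods_diff[OF _ periods_minus] by force

lemma step_bound:
  obtains K where "K > 0" "\<And>i j t. i \<in> I \<Longrightarrow> j \<in> I \<Longrightarrow> \<bar>(k i - k j) \<bullet> t\<bar> \<le> K * norm t"
proof -
  define K where "K = 1 + (\<Sum>i\<in>I. \<Sum>j\<in>I. norm (k i - k j))"
  have "K > 0"
    unfolding K_def by (intro add_pos_nonneg sum_nonneg) auto
  moreover have "\<bar>(k i - k j) \<bullet> t\<bar> \<le> K * norm t" if "i \<in> I" "j \<in> I" for i j t
  proof -
    have "norm (k i - k j) \<le> (\<Sum>j\<in>I. norm (k i - k j))"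
      using that finite_steps by (intro member_le_sum) auto
    also have "\<dots> \<le> (\<Sum>i\<in>I. \<Sum>j\<in>I. norm (k i - k j))"
      using that finite_steps by (intro member_le_sum[of i I "\<lambda>i. \<Sum>j\<in>I. norm (k i - k j)"] sum_nonneg) auto
    finally have "norm (k i - k j) \<le> K" by (simp add: K_def)
    then show ?thesis
      using Cauchy_Schwarz_ineq2[of "k i - k j" t] mult_right_mono[of "norm (k i - k j)" K "norm t"] by simp
  qed
  ultimately show thesis by (rule that)
qed

lemma periods_zero_isolated:
  obtains r where "r > 0" "\<And>u. u \<in> periods \<Longrightarrow> norm u < r \<Longrightarrow> u = 0"
proof -
  obtain K where K: "K > 0" "\<And>i j t. i \<in> I \<Longrightarrow> j \<in> I \<Longrightarrow> \<bar>(k i - k j) \<bullet> t\<bar> \<le> K * norm t"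
    using step_bound by blast
  have "u = 0" if u: "u \<in> periods" "norm u < 1 / K" for u
  proof (rule steps_span)
    fix i j assume ij: "i \<in> I" "j \<in> I"
    have "\<bar>(k i - k j) \<bullet> u\<bar> \<le> K * norm u" using K(2) ij .
    also have "\<dots> < 1" using u(2) K(1) by (simp add: field_simps)
    finally show "(k i - k j) \<bullet> u = 0"
      using u(1) ij Ints_nonzero_abs_less1 unfolding periods_def by blast
  qed
  then show thesis using K(1) that[of "1 / K"] by simp
qed

lemma finite_periods_norm_le: "finite {u \<in> periods. norm u \<le> R}"
proof -
  obtain K where K: "K > 0" "\<And>i j t. i \<in> I \<Longrightarrow> j \<in> I \<Longrightarrow> \<bar>(k i - k j) \<bullet> t\<bar> \<le> K * norm t"
    using step_bound by blast
  let ?f = "\<lambda>u. \<lambda>(i, j)\<in>I \<times> I. (k i - k j) \<bullet> u"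
  have "?f ` {u \<in> periods. norm u \<le> R} \<subseteq> (I \<times> I) \<rightarrow>\<^sub>E {z \<in> \<int>. \<bar>z\<bar> \<le> K * R}"
  proof (intro subsetI, elim imageE, simp only: mem_Collect_eq, intro PiE_I)
    fix u x ij assume u: "u \<in> periods \<and> norm u \<le> R" and ij: "ij \<in> I \<times> I"
    have "K * norm u \<le> K * R" using u K(1) by auto
    then show "?f u ij \<in> {z \<in> \<int>. \<bar>z\<bar> \<le> K * R}"
      using u ij K(2)[of "fst ij" "snd ij" u] by (auto simp: periods_def)
  qed auto
  then have "finite (?f ` {u \<in> periods. norm u \<le> R})"
    by (rule finite_subset) (intro finite_PiE finite_cartesian_product finite_steps finite_abs_int_segment)
  moreover have "inj_on ?f {u \<in> periods. norm u \<le> R}"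
  proof (rule inj_onI)
    fix u v assume eq: "?f u = ?f v"
    have "u - v = 0"
    proof (rule steps_span)
      fix i j assume "i \<in> I" "j \<in> I"
      then show "(k i - k j) \<bullet> (u - v) = 0"
        using fun_cong[OF eq, of "(i, j)"] by (simp add: inner_diff_right[of "k _ - k _"])
    qed
    then show "u = v" by simp
  qed
  ultimately show ?thesis by (rule finite_imageD)
qed

text \<open>
  A translate of the unit cube contains exactly one representative of each class modulo the integer vectors.
\<close>

lemma card_periods_translate_in_unit_cube:
  "card {u \<in> periods. t + u \<in> unit_cube} = period_index"
proof -
  define r where "r = {(x, y). x \<in> periods \<and> y \<in> periods \<and> x - y \<in> integer_vectors}"
  define U where "U = {u \<in> periods. t + u \<in> unit_cube}"
  have r_iff: "(x, y) \<in> r \<longleftrightarrow> x \<in> periods \<and> y \<in> periods \<and> x - y \<in> integer_vectors" for x y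
    by (simp add: r_def)
  have int_diff: "x - y \<in> integer_vectors" if "x \<in> integer_vectors" "y \<in> integer_vectors" for x y :: "real^'n"
    using that by (auto simp: integer_vectors_def)
  have int_0: "(0::real^'n) \<in> integer_vectors" by (auto simp: integer_vectors_def)
  have equiv: "equiv periods r"
  proof (rule equivI)
    show "r \<subseteq> periods \<times> periods" by (auto simp: r_iff)
    show "refl_on periods r" by (auto simp: refl_on_def r_iff int_0)
    show "sym r"
    proof (rule symI)
      fix x y assume "(x, y) \<in> r"
      then show "(y, x) \<in> r"
        using int_diff[OF int_0, of "x - y"] by (simp add: r_iff)
    qed
    show "trans r"
    proof (rule transI)
      fix x y z assume xyz: "(x, y) \<in> r" "(y, z) \<in> r"
      then have "x - y \<in> integer_vectors" "y - z \<in> integer_vectors" by (simp_all add: r_iff)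
      then have "(x - y) - (0 - (y - z)) \<in> integer_vectors"
        using int_diff int_0 by blast
      then show "(x, z) \<in> r" using xyz by (simp add: r_iff)
    qed
  qed
  have unique: "u = v" if "u - v \<in> integer_vectors" "t + u \<in> unit_cube" "t + v \<in> unit_cube" for u v
  proof -
    have "u - v \<in> {w \<in> integer_vectors. (t + v) + w \<in> unit_cube}" "0 \<in> {w \<in> integer_vectors. (t + v) + w \<in> unit_cube}"
      using that int_0 by (auto simp: algebra_simps)
    then show "u = v" unfolding integer_translate_in_unit_cube by (metis eq_iff_diff_eq_0 singletonD)
  qed
  have "bij_betw (\<lambda>u. r `` {u}) U (periods // r)"
  proof (rule bij_betw_imageI)
    show "inj_on (\<lambda>u. r `` {u}) U"
    proof (rule inj_onI)
      fix u v assume "u \<in> U" "v \<in> U" "r `` {u} = r `` {v}"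
      moreover from this have "(u, v) \<in> r"
        using eq_equiv_class[OF _ equiv] by (simp add: U_def)
      ultimately show "u = v"
        using unique by (simp add: U_def r_iff)
    qed
    show "(\<lambda>u. r `` {u}) ` U = periods // r"
    proof (intro equalityI subsetI)
      fix X assume "X \<in> periods // r"
      then obtain x where x: "x \<in> periods" "X = r `` {x}" by (rule quotientE)
      have "\<exists>w. w \<in> {w \<in> integer_vectors. (t + x) + w \<in> unit_cube}"
        unfolding integer_translate_in_unit_cube by blast
      then obtain w where w: "w \<in> integer_vectors" "(t + x) + w \<in> unit_cube" by auto
      have xw: "x + w \<in> periods" using w x integer_vectors_periods periods_add by blast
      then have "(x + w, x) \<in> r" using w x by (simp add: r_iff)
      then have "X = r `` {x + w}"
        using equiv_class_eq[OF equiv] x(2) by simp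
      moreover have "x + w \<in> U" using w xw by (simp add: U_def add.assoc)
      ultimately show "X \<in> (\<lambda>u. r `` {u}) ` U" by blast
    next
      fix X assume "X \<in> (\<lambda>u. r `` {u}) ` U"
      then obtain u where "X = r `` {u}" "u \<in> periods" by (auto simp: U_def)
      then show "X \<in> periods // r" by (simp only: quotientI)
    qed
  qed
  then show ?thesis
    unfolding period_index_def U_def r_def by (rule bij_betw_same_card)
qed

text \<open>
  The deficit \<open>1 - |\<phi>|\<^sup>2\<close> of any step distribution with probabilities at least \<open>p\<close> is at least \<open>p\<^sup>2\<close> times this function,
  which does not depend on the distribution. That makes the exponential smallness away from the peaks uniform.
\<close>

definition oscillation :: "real^'n \<Rightarrow> real" where
  "oscillation t = (\<Sum>i\<in>I. \<Sum>j\<in>I. 1 - cos (2 * pi * ((k i - k j) \<bullet> t)))"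

lemma oscillation_pos: "t \<notin> periods \<Longrightarrow> oscillation t > 0"
proof -
  assume "t \<notin> periods"
  then obtain i j where ij: "i \<in> I" "j \<in> I" "(k i - k j) \<bullet> t \<notin> \<int>" by (auto simp: periods_def)
  let ?c = "\<lambda>i j. 1 - cos (2 * pi * ((k i - k j) \<bullet> t))"
  have "cos (2 * pi * ((k i - k j) \<bullet> t)) \<noteq> 1"
  proof
    assume "cos (2 * pi * ((k i - k j) \<bullet> t)) = 1"
    then obtain z where "2 * pi * ((k i - k j) \<bullet> t) = of_int z * 2 * pi"
      unfolding cos_one_2pi_int by auto
    then have "(k i - k j) \<bullet> t = of_int z" by simp
    then show False using ij by simp
  qed
  then have "0 < ?c i j" using cos_le_one[of "2 * pi * ((k i - k j) \<bullet> t)"] by linarith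
  also have "?c i j \<le> (\<Sum>j\<in>I. ?c i j)"
    using ij finite_steps by (intro member_le_sum) auto
  also have "\<dots> \<le> oscillation t"
    unfolding oscillation_def using ij finite_steps
    by (intro member_le_sum[of i I "\<lambda>i. \<Sum>j\<in>I. ?c i j"] sum_nonneg) auto
  finally show ?thesis .
qed

lemma oscillation_gap:
  assumes "r > 0"
  obtains \<eta> where "\<eta> > 0" "\<And>t. t \<in> unit_cube \<Longrightarrow> (\<And>u. u \<in> periods \<Longrightarrow> dist u t \<ge> r) \<Longrightarrow> oscillation t \<ge> \<eta>"
proof -
  let ?C = "cbox 0 1 - (\<Union>u\<in>periods. ball u r)"
  have C: "compact ?C" by (intro compact_diff compact_cbox open_UN ballI open_ball)
  show thesis
  proof (cases "?C = {}")
    case True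
    show thesis
    proof (rule that[of 1])
      fix t assume "t \<in> unit_cube" "\<And>u. u \<in> periods \<Longrightarrow> dist u t \<ge> r"
      then have "t \<in> ?C" using unit_cube_subset_cbox by (force simp: not_less)
      then show "oscillation t \<ge> 1" using True by blast
    qed simp
  next
    case False
    have cont: "continuous_on ?C oscillation"
      unfolding oscillation_def by (intro continuous_intros)
    obtain t0 where t0: "t0 \<in> ?C" "\<forall>t\<in>?C. oscillation t0 \<le> oscillation t"
      using continuous_attains_inf[OF C False cont] by (elim bexE)
    show thesis
    proof (rule that)
      have "t0 \<notin> periods" using t0(1) assms by (metis DiffE UN_I centre_in_ball)
      then show "oscillation t0 > 0" by (rule oscillation_pos)
      fix t assume "t \<in> unit_cube" "\<And>u. u \<in> periods \<Longrightarrow> dist u t \<ge> r"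
      then have "t \<in> ?C" using unit_cube_subset_cbox by (force simp: not_less)
      then show "oscillation t \<ge> oscillation t0" by (rule bspec[OF t0(2)])
    qed
  qed
qed

definition charfun :: "('i \<Rightarrow> real) \<Rightarrow> real^'n \<Rightarrow> complex" where
  "charfun p t = (\<Sum>i\<in>I. p i * cis (2 * pi * ((k i - mean p) \<bullet> t)))"

lemma norm_charfun_square:
  assumes p: "(\<Sum>i\<in>I. p i) = 1"
  shows "(cmod (charfun p t))\<^sup>2 = 1 - (\<Sum>i\<in>I. \<Sum>j\<in>I. p i * p j * (1 - cos (2 * pi * ((k i - k j) \<bullet> t))))"
proof -
  have "of_real ((cmod (charfun p t))\<^sup>2) = charfun p t * cnj (charfun p t)"
    by (rule complex_norm_square)
  also have "\<dots> = (\<Sum>i\<in>I. \<Sum>j\<in>I. of_real (p i * p j) * cis (2 * pi * ((k i - k j) \<bullet> t)))"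
  proof -
    have "cis (2 * pi * ((k i - mean p) \<bullet> t)) * cnj (cis (2 * pi * ((k j - mean p) \<bullet> t))) = cis (2 * pi * ((k i - k j) \<bullet> t))" for i j
      by (simp add: cis_cnj cis_mult inner_diff_left algebra_simps)
    then have eq: "of_real (p i * p j) * cis (2 * pi * ((k i - k j) \<bullet> t))
       = (p i * cis (2 * pi * ((k i - mean p) \<bullet> t))) * cnj (p j * cis (2 * pi * ((k j - mean p) \<bullet> t)))" for i j
      by (simp add: mult_ac)
    show ?thesis
      unfolding charfun_def cnj_sum sum_product by (intro sum.cong refl) (rule eq[symmetric])
  qed
  finally have "(cmod (charfun p t))\<^sup>2 = Re (\<Sum>i\<in>I. \<Sum>j\<in>I. of_real (p i * p j) * cis (2 * pi * ((k i - k j) \<bullet> t)))"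
    by (metis Re_complex_of_real)
  also have "\<dots> = (\<Sum>i\<in>I. \<Sum>j\<in>I. p i * p j * cos (2 * pi * ((k i - k j) \<bullet> t)))"
    by simp
  also have "\<dots> = (\<Sum>i\<in>I. \<Sum>j\<in>I. p i * p j) - (\<Sum>i\<in>I. \<Sum>j\<in>I. p i * p j * (1 - cos (2 * pi * ((k i - k j) \<bullet> t))))"
    by (simp add: sum_subtractf[symmetric] algebra_simps)
  also have "(\<Sum>i\<in>I. \<Sum>j\<in>I. p i * p j) = 1"
    using p by (simp add: sum_product[symmetric])
  finally show ?thesis .
qed

lemma norm_charfun_le:
  assumes p: "(\<Sum>i\<in>I. p i) = 1" "\<And>i. i \<in> I \<Longrightarrow> p i \<ge> p0" and p0: "p0 \<ge> 0"
  shows "(cmod (charfun p t))\<^sup>2 \<le> 1 - p0\<^sup>2 * oscillation t"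
proof -
  have "p0\<^sup>2 * oscillation t \<le> (\<Sum>i\<in>I. \<Sum>j\<in>I. p i * p j * (1 - cos (2 * pi * ((k i - k j) \<bullet> t))))"
    unfolding oscillation_def sum_distrib_left
  proof (intro sum_mono mult_right_mono)
    fix i j assume "i \<in> I" "j \<in> I"
    then have "p0 * p0 \<le> p i * p j"
      using p(2) p0 by (intro mult_mono) (auto intro: order_trans[OF p0])
    then show "p0\<^sup>2 \<le> p i * p j" by (simp add: power2_eq_square)
  qed auto
  then show ?thesis using norm_charfun_square[OF p(1)] by simp
qed

lemma covariance_form:
  assumes p: "(\<Sum>i\<in>I. p i) = 1"
  shows "t \<bullet> (covariance p *v t) = (\<Sum>i\<in>I. p i * ((k i - mean p) \<bullet> t)\<^sup>2)"
proof -
  have m: "mean p \<bullet> t = (\<Sum>i\<in>I. p i * (k i \<bullet> t))"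
    by (simp add: mean_def inner_sum_left)
  have sq: "(v \<bullet> t)\<^sup>2 = (\<Sum>a\<in>UNIV. \<Sum>b\<in>UNIV. t $ a * (v $ a * v $ b) * t $ b)" for v :: "real^'n"
    by (simp add: inner_vec_def power2_eq_square sum_product mult_ac)
  have "t \<bullet> (covariance p *v t) = (\<Sum>a\<in>UNIV. \<Sum>b\<in>UNIV. t $ a * ((\<Sum>i\<in>I. p i * (k i $ a * k i $ b)) - mean p $ a * mean p $ b) * t $ b)"
    by (simp add: inner_vec_def matrix_vector_mult_def covariance_def sum_distrib_left mult.assoc)
  also have "\<dots> = (\<Sum>a\<in>UNIV. \<Sum>b\<in>UNIV. \<Sum>i\<in>I. p i * (t $ a * (k i $ a * k i $ b) * t $ b)) - (mean p \<bullet> t)\<^sup>2"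
    unfolding sq by (simp add: sum_subtractf[symmetric] right_diff_distrib left_diff_distrib sum_distrib_left sum_distrib_right mult_ac)
  also have "(\<Sum>a\<in>UNIV. \<Sum>b\<in>UNIV. \<Sum>i\<in>I. p i * (t $ a * (k i $ a * k i $ b) * t $ b)) = (\<Sum>i\<in>I. p i * (k i \<bullet> t)\<^sup>2)"
    unfolding sq sum_distrib_left
    by (rule trans[OF _ sum.swap], rule sum.cong[OF refl], rule sum.swap)
  also have "(\<Sum>i\<in>I. p i * (k i \<bullet> t)\<^sup>2) - (mean p \<bullet> t)\<^sup>2 = (\<Sum>i\<in>I. p i * ((k i - mean p) \<bullet> t)\<^sup>2)"
  proof -
    have "p i * ((k i - mean p) \<bullet> t)\<^sup>2 = p i * (k i \<bullet> t)\<^sup>2 - 2 * (mean p \<bullet> t) * (p i * (k i \<bullet> t)) + (mean p \<bullet> t)\<^sup>2 * p i" for i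
      by (simp add: inner_diff_left power2_eq_square algebra_simps)
    then have "(\<Sum>i\<in>I. p i * ((k i - mean p) \<bullet> t)\<^sup>2)
       = (\<Sum>i\<in>I. p i * (k i \<bullet> t)\<^sup>2) - 2 * (mean p \<bullet> t) * (mean p \<bullet> t) + (mean p \<bullet> t)\<^sup>2 * 1"
      unfolding m p[symmetric] by (simp add: sum.distrib sum_subtractf sum_distrib_left)
    then show ?thesis by (simp add: power2_eq_square)
  qed
  finally show ?thesis .
qed

lemma transpose_covariance: "transpose (covariance p) = covariance p"
  by (simp add: transpose_def covariance_def vec_eq_iff mult.commute)

lemma variance_pairs:
  assumes p: "(\<Sum>i\<in>I. p i) = 1"
  shows "(\<Sum>i\<in>I. \<Sum>j\<in>I. p i * p j * ((k i - k j) \<bullet> t)\<^sup>2) = 2 * (\<Sum>i\<in>I. p i * ((k i - mean p) \<bullet> t)\<^sup>2)"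
proof -
  define z where "z i = (k i - mean p) \<bullet> t" for i
  have z0: "(\<Sum>i\<in>I. p i * z i) = 0"
  proof -
    have "(\<Sum>i\<in>I. p i * z i) = (\<Sum>i\<in>I. p i * (k i \<bullet> t)) - (\<Sum>i\<in>I. p i) * (mean p \<bullet> t)"
      by (simp add: z_def inner_diff_left right_diff_distrib sum_subtractf sum_distrib_right)
    then show ?thesis using p by (simp add: mean_def inner_sum_left)
  qed
  have "p i * p j * ((k i - k j) \<bullet> t)\<^sup>2 = p i * (p j * (z j)\<^sup>2) + (p i * (z i)\<^sup>2) * p j - 2 * ((p i * z i) * (p j * z j))" for i j
    by (simp add: z_def inner_diff_left power2_eq_square algebra_simps)
  then have "(\<Sum>i\<in>I. \<Sum>j\<in>I. p i * p j * ((k i - k j) \<bullet> t)\<^sup>2)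
     = (\<Sum>i\<in>I. \<Sum>j\<in>I. p i * (p j * (z j)\<^sup>2)) + (\<Sum>i\<in>I. \<Sum>j\<in>I. (p i * (z i)\<^sup>2) * p j)
       - (\<Sum>i\<in>I. \<Sum>j\<in>I. 2 * ((p i * z i) * (p j * z j)))"
    by (simp only: sum.distrib sum_subtractf)
  also have "\<dots> = (\<Sum>i\<in>I. p i) * (\<Sum>j\<in>I. p j * (z j)\<^sup>2) + (\<Sum>i\<in>I. p i * (z i)\<^sup>2) * (\<Sum>j\<in>I. p j)
       - 2 * ((\<Sum>i\<in>I. p i * z i) * (\<Sum>j\<in>I. p j * z j))"
    unfolding sum_product by (simp only: sum_distrib_left)
  finally show ?thesis using p z0 by (simp add: z_def)
qed

text \<open>
  The variance is half the \<open>p i * p j\<close>-weighted sum of the squared differences, and the unweighted sum is a positive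
  definite form by \<open>steps_span\<close>.
\<close>

lemma variance_lower_bound:
  assumes p0: "p0 > 0"
  obtains \<kappa> where "\<kappa> > 0"
    "\<And>p t. (\<Sum>i\<in>I. p i) = 1 \<Longrightarrow> (\<And>i. i \<in> I \<Longrightarrow> p i \<ge> p0) \<Longrightarrow> (\<Sum>i\<in>I. p i * ((k i - mean p) \<bullet> t)\<^sup>2) \<ge> \<kappa> * (norm t)\<^sup>2"
proof -
  define \<Psi> where "\<Psi> t = (\<Sum>i\<in>I. \<Sum>j\<in>I. ((k i - k j) \<bullet> t)\<^sup>2)" for t
  have nn: "(\<Sum>j\<in>I. ((k i - k j) \<bullet> t)\<^sup>2) \<ge> 0" for i t
    by (intro sum_nonneg) auto
  have "\<Psi> t > 0" if "t \<noteq> 0" for t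
  proof (rule ccontr)
    assume "\<not> \<Psi> t > 0"
    moreover have "\<Psi> t \<ge> 0" unfolding \<Psi>_def by (intro sum_nonneg nn)
    ultimately have "\<Psi> t = 0" by linarith
    then have "\<forall>i\<in>I. (\<Sum>j\<in>I. ((k i - k j) \<bullet> t)\<^sup>2) = 0"
      unfolding \<Psi>_def using finite_steps nn by (subst (asm) sum_nonneg_eq_0_iff) auto
    then have "\<forall>i\<in>I. \<forall>j\<in>I. ((k i - k j) \<bullet> t)\<^sup>2 = 0"
      using finite_steps by (subst (asm) sum_nonneg_eq_0_iff) auto
    then show False using that steps_span by simp
  qed
  moreover have "continuous_on (sphere 0 1) \<Psi>"
    unfolding \<Psi>_def by (intro continuous_intros)
  moreover have "\<Psi> (a *\<^sub>R t) = a\<^sup>2 * \<Psi> t" for a t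
    by (simp add: \<Psi>_def sum_distrib_left power_mult_distrib)
  ultimately obtain \<kappa> where \<kappa>: "\<kappa> > 0" "\<And>t. \<kappa> * (norm t)\<^sup>2 \<le> \<Psi> t"
    using quadratic_form_lower_bound[of \<Psi>] by blast
  show thesis
  proof (rule that[of "p0\<^sup>2 * \<kappa> / 2"])
    show "p0\<^sup>2 * \<kappa> / 2 > 0" using \<kappa>(1) p0 by simp
    fix p t assume p: "(\<Sum>i\<in>I. p i) = 1" "\<And>i. i \<in> I \<Longrightarrow> p i \<ge> p0"
    have "p0\<^sup>2 * (\<kappa> * (norm t)\<^sup>2) \<le> p0\<^sup>2 * \<Psi> t"
      using \<kappa>(2) by (intro mult_left_mono) auto
    also have "\<dots> \<le> (\<Sum>i\<in>I. \<Sum>j\<in>I. p i * p j * ((k i - k j) \<bullet> t)\<^sup>2)"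
      unfolding \<Psi>_def sum_distrib_left
    proof (intro sum_mono mult_right_mono)
      fix i j assume "i \<in> I" "j \<in> I"
      then have "p0 * p0 \<le> p i * p j"
        using p(2) p0 by (intro mult_mono) (auto intro: order_trans[OF less_imp_le[OF p0]])
      then show "p0\<^sup>2 \<le> p i * p j" by (simp add: power2_eq_square)
    qed auto
    finally show "(\<Sum>i\<in>I. p i * ((k i - mean p) \<bullet> t)\<^sup>2) \<ge> p0\<^sup>2 * \<kappa> / 2 * (norm t)\<^sup>2"
      unfolding variance_pairs[OF p(1)] by simp
  qed
qed

lemma continuous_charfun: "continuous_on A (charfun p)"
  unfolding charfun_def by (intro continuous_intros)

text \<open>
  A period changes \<open>\<phi>\<close> by a phase common to all steps. Its \<open>N\<close>-th power is trivial because the target is reached by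
  the path \<open>q\<close>.
\<close>

lemma charfun_power_periodic:
  assumes q: "q \<in> {1..N} \<rightarrow>\<^sub>E I" "(\<Sum>j=1..N. k (q j)) = real N *\<^sub>R mean p" and u: "u \<in> periods"
  shows "charfun p (t + u) ^ N = charfun p t ^ N"
proof -
  obtain i0 where i0: "i0 \<in> I" using steps_nonempty by blast
  define z where "z = (k i0 - mean p) \<bullet> u"
  have "cis (2 * pi * ((k i - mean p) \<bullet> (t + u))) = cis (2 * pi * z) * cis (2 * pi * ((k i - mean p) \<bullet> t))" if "i \<in> I" for i
  proof -
    have "(k i - k i0) \<bullet> u \<in> \<int>" using u that i0 by (auto simp: periods_def)
    moreover have "(k i - mean p) \<bullet> (t + u) = (z + (k i - mean p) \<bullet> t) + (k i - k i0) \<bullet> u"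
      by (simp add: z_def inner_diff_left inner_add_right)
    ultimately have "cis (2 * pi * ((k i - mean p) \<bullet> (t + u))) = cis (2 * pi * (z + (k i - mean p) \<bullet> t))"
      by (simp only: cis_2pi_add_integer)
    then show ?thesis by (simp add: distrib_left cis_mult)
  qed
  then have "charfun p (t + u) = cis (2 * pi * z) * charfun p t"
    unfolding charfun_def sum_distrib_left by (intro sum.cong refl) (simp add: mult_ac)
  moreover have "cis (2 * pi * z) ^ N = 1"
  proof -
    have "(\<Sum>j=1..N. (k i0 - k (q j)) \<bullet> u) \<in> \<int>"
      using u i0 q(1) by (intro Ints_sum) (auto simp: periods_def PiE_def Pi_def)
    moreover have "(\<Sum>j=1..N. (k i0 - k (q j)) \<bullet> u) = real N * z"
      using q(2) by (simp add: z_def inner_diff_left sum_subtractf flip: inner_sum_left) (simp add: algebra_simps)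
    ultimately have "cis (2 * pi * (0 + real N * z)) = cis (2 * pi * 0)"
      using cis_2pi_add_integer[of "real N * z" 0] by simp
    then have "cis (real N * (2 * pi * z)) = 1" by (simp add: mult_ac)
    then show ?thesis unfolding Complex.DeMoivre .
  qed
  ultimately show ?thesis by (simp add: power_mult_distrib)
qed

lemma centered_step_bound:
  assumes p: "(\<Sum>i\<in>I. p i) = 1" "\<And>i. i \<in> I \<Longrightarrow> p i \<ge> 0"
    and K: "\<And>i j. i \<in> I \<Longrightarrow> j \<in> I \<Longrightarrow> \<bar>(k i - k j) \<bullet> t\<bar> \<le> B" and i: "i \<in> I"
  shows "\<bar>(k i - mean p) \<bullet> t\<bar> \<le> B"
proof -
  have "(k i - mean p) \<bullet> t = (\<Sum>j\<in>I. p j) * (k i \<bullet> t) - (\<Sum>j\<in>I. p j * (k j \<bullet> t))"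
    by (simp add: p(1) mean_def inner_diff_left inner_sum_left)
  also have "\<dots> = (\<Sum>j\<in>I. p j * ((k i - k j) \<bullet> t))"
    by (simp add: inner_diff_left right_diff_distrib sum_subtractf sum_distrib_right)
  finally have "\<bar>(k i - mean p) \<bullet> t\<bar> \<le> (\<Sum>j\<in>I. p j * B)"
  proof (elim ssubst, intro order_trans[OF sum_abs sum_mono])
    fix j assume "j \<in> I"
    then show "\<bar>p j * ((k i - k j) \<bullet> t)\<bar> \<le> p j * B"
      using K[OF i] p(2) by (simp add: abs_mult mult_left_mono)
  qed
  then show ?thesis using p(1) by (simp flip: sum_distrib_right)
qed

text \<open>
  The bound holds for all \<open>t\<close>, not only near the origin, so that integrating it over the whole space gives the local
  error and the discarded Gaussian tail at once.
\<close>

lemma charfun_power_gaussian_approx: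
  assumes p0: "p0 > 0" and r1: "r1 > 0"
  obtains r c C where "0 < r" "r \<le> r1" "c > 0" "C \<ge> 0"
    "\<And>p N t. (\<Sum>i\<in>I. p i) = 1 \<Longrightarrow> (\<And>i. i \<in> I \<Longrightarrow> p i \<ge> p0) \<Longrightarrow> N \<ge> 1 \<Longrightarrow>
       \<bar>indicator (ball 0 r) t * Re (charfun p t ^ N) - exp (- (2 * pi\<^sup>2 * real N) * (t \<bullet> (covariance p *v t)))\<bar>
         \<le> C / real N * exp (- (c * real N) * (norm t)\<^sup>2)"
proof -
  obtain K0 where K0: "K0 > 0" "\<And>i j t. i \<in> I \<Longrightarrow> j \<in> I \<Longrightarrow> \<bar>(k i - k j) \<bullet> t\<bar> \<le> K0 * norm t"
    using step_bound by blast
  obtain \<kappa>0 where \<kappa>0: "\<kappa>0 > 0"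
    "\<And>p t. (\<Sum>i\<in>I. p i) = 1 \<Longrightarrow> (\<And>i. i \<in> I \<Longrightarrow> p i \<ge> p0) \<Longrightarrow> (\<Sum>i\<in>I. p i * ((k i - mean p) \<bullet> t)\<^sup>2) \<ge> \<kappa>0 * (norm t)\<^sup>2"
    using variance_lower_bound[OF p0] by blast
  define K where "K = 2 * pi * K0"
  define \<kappa> where "\<kappa> = 4 * pi\<^sup>2 * \<kappa>0"
  have K: "K > 0" and \<kappa>: "\<kappa> > 0" using K0 \<kappa>0 by (auto simp: K_def \<kappa>_def)
  \<comment> \<open>the three terms serve \<open>r \<le> r1\<close>, the validity range \<open>\<bar>Y i\<bar> \<le> 1\<close> and the absorption of the cubic term by the Gaussian\<close>
  define r where "r = min r1 (min (1 / K) (\<kappa> / (8 * K ^ 3)))"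
  define c where "c = \<kappa> / 8"
  define C1 where "C1 = K ^ 4 * (2 / c) ^ 2 + 4 * K ^ 6 * (3 / c) ^ 3"
  define C where "C = C1 + 4 / (\<kappa> * r\<^sup>2)"
  have r: "0 < r" "r \<le> r1" "K * r \<le> 1" "8 * K ^ 3 * r \<le> \<kappa>"
  proof -
    show "0 < r" "r \<le> r1" using r1 K \<kappa> by (auto simp: r_def)
    have "r \<le> 1 / K" "r \<le> \<kappa> / (8 * K ^ 3)" by (auto simp: r_def)
    then show "K * r \<le> 1" "8 * K ^ 3 * r \<le> \<kappa>" using K by (auto simp: field_simps)
  qed
  have c: "c > 0" using \<kappa> by (simp add: c_def)
  have C1: "C1 \<ge> 0" using K c by (simp add: C1_def)
  have CC: "C \<ge> C1" "C \<ge> 4 / (\<kappa> * r\<^sup>2)" using C1 \<kappa> r by (simp_all add: C_def)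
  show thesis
  proof (rule that[OF r(1,2) c])
    show "C \<ge> 0" using CC C1 by simp
    fix p :: "'i \<Rightarrow> real" and N :: nat and t :: "real^'n"
    assume p: "(\<Sum>i\<in>I. p i) = 1" "\<And>i. i \<in> I \<Longrightarrow> p i \<ge> p0" and N: "N \<ge> 1"
    define Y where "Y i = 2 * pi * ((k i - mean p) \<bullet> t)" for i
    define q where "q = (\<Sum>i\<in>I. p i * (Y i)\<^sup>2)"
    define z where "z = real N * (norm t)\<^sup>2"
    have z: "z \<ge> 0" by (simp add: z_def)
    have p_nn: "p i \<ge> 0" if "i \<in> I" for i using p(2)[OF that] p0 by simp
    have q_eq: "q = 4 * pi\<^sup>2 * (\<Sum>i\<in>I. p i * ((k i - mean p) \<bullet> t)\<^sup>2)"
      by (simp add: q_def Y_def sum_distrib_left power_mult_distrib mult_ac)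
    have gauss: "exp (- (2 * pi\<^sup>2 * real N) * (t \<bullet> (covariance p *v t))) = exp (- (real N * q / 2))"
      by (simp add: q_eq covariance_form[OF p(1)])
    have q_ge: "q \<ge> \<kappa> * (norm t)\<^sup>2"
      using mult_left_mono[OF \<kappa>0(2)[OF p, where t = t], of "4 * pi\<^sup>2"] by (simp add: q_eq \<kappa>_def mult_ac)
    then have Nq: "real N * q / 2 \<ge> \<kappa> * z / 2"
      using mult_left_mono[OF q_ge, of "real N"] by (simp add: z_def mult_ac)
    have target: "C / real N * exp (- (c * real N) * (norm t)\<^sup>2) = C / real N * exp (- (c * z))"
      by (simp add: z_def mult_ac)
    show "\<bar>indicator (ball 0 r) t * Re (charfun p t ^ N) - exp (- (2 * pi\<^sup>2 * real N) * (t \<bullet> (covariance p *v t)))\<bar>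
         \<le> C / real N * exp (- (c * real N) * (norm t)\<^sup>2)"
      unfolding gauss target
    proof (cases "norm t < r")
      case True
      define a where "a = K * norm t"
      have a: "0 \<le> a" "a \<le> 1"
      proof -
        have "K * norm t \<le> K * r" using True K by (intro mult_left_mono) auto
        also note r(3)
        finally show "a \<le> 1" by (simp add: a_def)
        show "0 \<le> a" using K by (simp add: a_def)
      qed
      have Ya: "\<bar>Y i\<bar> \<le> a" if "i \<in> I" for i
        using centered_step_bound[OF p(1) p_nn K0(2) that, of t]
        by (simp add: Y_def a_def K_def abs_mult)
      have Ymean: "(\<Sum>i\<in>I. p i * Y i) = 0"
      proof -
        have "(\<Sum>i\<in>I. p i * Y i) = 2 * pi * ((\<Sum>i\<in>I. p i * (k i \<bullet> t)) - (\<Sum>i\<in>I. p i) * (mean p \<bullet> t))"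
          by (simp add: Y_def inner_diff_left right_diff_distrib sum_subtractf sum_distrib_left sum_distrib_right mult_ac)
        then show ?thesis using p(1) by (simp add: mean_def inner_sum_left)
      qed
      have "\<bar>Re (charfun p t ^ N) - exp (- (real N * q / 2))\<bar>
          \<le> exp (- (real N * q / 2)) * (real N * a ^ 4 + 4 * (real N)\<^sup>2 * a ^ 6 * exp (2 * real N * a ^ 3))"
        using Re_charfun_power_approx[OF finite_steps p_nn p(1) Ymean Ya a, of N]
        by (simp add: charfun_def q_def Y_def)
      also have "\<dots> \<le> exp (- (\<kappa> * z / 2)) * ((real N * a ^ 4 + 4 * (real N)\<^sup>2 * a ^ 6) * exp (\<kappa> * z / 4))"
      proof (rule mult_mono)
        show "exp (- (real N * q / 2)) \<le> exp (- (\<kappa> * z / 2))" using Nq by simp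
        have "2 * real N * a ^ 3 = (2 * K ^ 3 * norm t) * z"
          by (simp add: a_def z_def power_mult_distrib power3_eq_cube power2_eq_square)
        also have "\<dots> \<le> (\<kappa> / 4) * z"
        proof (rule mult_right_mono)
          have "8 * K ^ 3 * norm t \<le> 8 * K ^ 3 * r" using True K by (intro mult_left_mono) auto
          then show "2 * K ^ 3 * norm t \<le> \<kappa> / 4" using r(4) by linarith
        qed (rule z)
        finally have e: "exp (2 * real N * a ^ 3) \<le> exp (\<kappa> * z / 4)" by simp
        have "1 \<le> exp (\<kappa> * z / 4)" using \<kappa> z by simp
        then have "real N * a ^ 4 * 1 \<le> real N * a ^ 4 * exp (\<kappa> * z / 4)"
          using a by (intro mult_left_mono) auto
        moreover have "4 * (real N)\<^sup>2 * a ^ 6 * exp (2 * real N * a ^ 3) \<le> 4 * (real N)\<^sup>2 * a ^ 6 * exp (\<kappa> * z / 4)"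
          using e a by (intro mult_left_mono) auto
        ultimately show "real N * a ^ 4 + 4 * (real N)\<^sup>2 * a ^ 6 * exp (2 * real N * a ^ 3) \<le> (real N * a ^ 4 + 4 * (real N)\<^sup>2 * a ^ 6) * exp (\<kappa> * z / 4)"
          by (simp add: distrib_right)
        show "0 \<le> real N * a ^ 4 + 4 * (real N)\<^sup>2 * a ^ 6 * exp (2 * real N * a ^ 3)" using a by simp
      qed simp
      also have "\<dots> = (K ^ 4 * z ^ 2 + 4 * K ^ 6 * z ^ 3) / N * exp (- (2 * c * z))"
      proof -
        have "real N * a ^ 4 + 4 * (real N)\<^sup>2 * a ^ 6 = (K ^ 4 * z ^ 2 + 4 * K ^ 6 * z ^ 3) / N"
          using N by (simp add: a_def z_def power_mult_distrib field_simps eval_nat_numeral)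
        moreover have "exp (- (\<kappa> * z / 2)) * exp (\<kappa> * z / 4) = exp (- (2 * c * z))"
          by (simp add: c_def flip: exp_add)
        ultimately show ?thesis by (simp add: mult_ac)
      qed
      also have "\<dots> \<le> (C1 * exp (c * z)) / N * exp (- (2 * c * z))"
      proof -
        have "z ^ 2 \<le> (2 / c) ^ 2 * exp (c * z)" "z ^ 3 \<le> (3 / c) ^ 3 * exp (c * z)"
          using power_le_exp[OF z c, of 2] power_le_exp[OF z c, of 3] by auto
        then have "K ^ 4 * z ^ 2 + 4 * K ^ 6 * z ^ 3 \<le> K ^ 4 * ((2 / c) ^ 2 * exp (c * z)) + 4 * K ^ 6 * ((3 / c) ^ 3 * exp (c * z))"
          using K by (intro add_mono mult_left_mono) auto
        also have "\<dots> = C1 * exp (c * z)" by (simp only: C1_def distrib_right mult.assoc)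
        finally show ?thesis by (intro mult_right_mono divide_right_mono) auto
      qed
      also have "\<dots> = C1 / N * exp (- (c * z))"
      proof -
        have "exp (c * z) * exp (- (2 * c * z)) = exp (- (c * z))" by (simp flip: exp_add)
        then show ?thesis by simp
      qed
      also have "\<dots> \<le> C / N * exp (- (c * z))"
        using CC by (intro mult_right_mono divide_right_mono) auto
      finally show "\<bar>indicator (ball 0 r) t * Re (charfun p t ^ N) - exp (- (real N * q / 2))\<bar> \<le> C / N * exp (- (c * z))"
        using True by simp
    next
      case False
      then have "r\<^sup>2 \<le> (norm t)\<^sup>2" using r by (intro power_mono) auto
      then have zr: "z \<ge> real N * r\<^sup>2" unfolding z_def by (rule mult_left_mono) auto
      have "exp (- (real N * q / 2)) \<le> exp (- (\<kappa> * z / 2))" using Nq by simp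
      also have "\<dots> = exp (- (\<kappa> * z / 4)) * exp (- (\<kappa> * z / 4))" by (simp flip: exp_add)
      also have "\<dots> \<le> (4 / (\<kappa> * r\<^sup>2) / N) * exp (- (c * z))"
      proof (rule mult_mono)
        have "\<kappa> * (real N * r\<^sup>2) / 4 \<le> \<kappa> * z / 4" using zr \<kappa> by simp
        also have "\<dots> \<le> exp (\<kappa> * z / 4)" using exp_ge_add_one_self[of "\<kappa> * z / 4"] by linarith
        finally show "exp (- (\<kappa> * z / 4)) \<le> 4 / (\<kappa> * r\<^sup>2) / N"
          using \<kappa> r(1) N by (simp add: exp_minus field_simps)
        show "exp (- (\<kappa> * z / 4)) \<le> exp (- (c * z))"
          using \<kappa> z by (simp add: c_def)
        show "0 \<le> 4 / (\<kappa> * r\<^sup>2) / N" using \<kappa> by simp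
      qed simp
      also have "\<dots> \<le> C / N * exp (- (c * z))"
        using CC by (intro mult_right_mono divide_right_mono) auto
      finally show "\<bar>indicator (ball 0 r) t * Re (charfun p t ^ N) - exp (- (real N * q / 2))\<bar> \<le> C / N * exp (- (c * z))"
        using False by simp
    qed
  qed
qed


lemma covariance_pos:
  assumes p: "(\<Sum>i\<in>I. p i) = 1" "\<And>i. i \<in> I \<Longrightarrow> p i \<ge> p0" and p0: "p0 > 0" and t: "t \<noteq> 0"
  shows "t \<bullet> (covariance p *v t) > 0"
proof -
  obtain \<kappa> where \<kappa>: "\<kappa> > 0"
    "\<And>p t. (\<Sum>i\<in>I. p i) = 1 \<Longrightarrow> (\<And>i. i \<in> I \<Longrightarrow> p i \<ge> p0) \<Longrightarrow> (\<Sum>i\<in>I. p i * ((k i - mean p) \<bullet> t)\<^sup>2) \<ge> \<kappa> * (norm t)\<^sup>2"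
    using variance_lower_bound[OF p0] by blast
  have "0 < \<kappa> * (norm t)\<^sup>2" using \<kappa>(1) t by simp
  also have "\<dots> \<le> t \<bullet> (covariance p *v t)"
    unfolding covariance_form[OF p(1)] by (rule \<kappa>(2)[OF p])
  finally show ?thesis .
qed

lemma norm_charfun_le_1:
  assumes p: "(\<Sum>i\<in>I. p i) = 1" "\<And>i. i \<in> I \<Longrightarrow> p i \<ge> 0"
  shows "cmod (charfun p t) \<le> 1"
proof -
  have "cmod (charfun p t) \<le> (\<Sum>i\<in>I. p i)"
    unfolding charfun_def by (rule sum_norm_le) (simp add: norm_mult p(2))
  then show ?thesis using p(1) by simp
qed

text \<open>
  The error is absolute, one factor \<open>1/N\<close> below the main term, and \<open>C\<close> depends on the distribution only through the
  lower bound \<open>p0\<close>.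
\<close>

theorem local_limit_theorem:
  assumes p0: "p0 > 0"
  obtains C where "\<And>p N. (\<Sum>i\<in>I. p i) = 1 \<Longrightarrow> (\<And>i. i \<in> I \<Longrightarrow> p i \<ge> p0) \<Longrightarrow> N \<ge> 1 \<Longrightarrow>
      (\<exists>q \<in> {1..N} \<rightarrow>\<^sub>E I. (\<Sum>j=1..N. k (q j)) = real N *\<^sub>R mean p) \<Longrightarrow>
      \<bar>path_weight p N (real N *\<^sub>R mean p)
        - real period_index * (2 * pi * real N) powr (- (real CARD('n) / 2)) / sqrt (det (covariance p))\<bar>
      \<le> C * real N powr (- (real CARD('n) / 2) - 1)"
proof -
  let ?n = "real CARD('n) / 2"
  obtain r0 where r0: "r0 > 0" "\<And>u. u \<in> periods \<Longrightarrow> norm u < r0 \<Longrightarrow> u = 0"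
    using periods_zero_isolated by blast
  \<comment> \<open>\<open>r \<le> r0 / 2\<close> makes the balls around distinct periods disjoint\<close>
  obtain r c C1 where r: "0 < r" "r \<le> r0 / 2" and c: "c > 0" and C1: "C1 \<ge> 0"
    and approx: "\<And>p N t. (\<Sum>i\<in>I. p i) = 1 \<Longrightarrow> (\<And>i. i \<in> I \<Longrightarrow> p i \<ge> p0) \<Longrightarrow> N \<ge> 1 \<Longrightarrow>
       \<bar>indicator (ball 0 r) t * Re (charfun p t ^ N) - exp (- (2 * pi\<^sup>2 * real N) * (t \<bullet> (covariance p *v t)))\<bar>
         \<le> C1 / real N * exp (- (c * real N) * (norm t)\<^sup>2)"
    using charfun_power_gaussian_approx[OF p0, of "r0 / 2"] r0(1) by (metis half_gt_zero)
  obtain \<eta> where \<eta>: "\<eta> > 0" "\<And>t. t \<in> unit_cube \<Longrightarrow> (\<And>u. u \<in> periods \<Longrightarrow> dist u t \<ge> r) \<Longrightarrow> oscillation t \<ge> \<eta>"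
    using oscillation_gap[OF r(1)] by blast
  \<comment> \<open>the truncation at 0 keeps \<open>\<theta>\<close> nonnegative even when the estimate below is vacuous\<close>
  define \<theta> where "\<theta> = sqrt (max 0 (1 - p0\<^sup>2 * \<eta>))"
  have \<theta>: "0 \<le> \<theta>" "\<theta> < 1" using p0 \<eta>(1) by (auto simp: \<theta>_def)
  obtain C2 where C2: "\<And>N. N \<ge> 1 \<Longrightarrow> \<theta> ^ N \<le> C2 * real N powr (- (?n + 1))"
    using geometric_le_powr[OF \<theta>] by blast
  define C where "C = real period_index * (C1 * (pi / c) powr ?n) + C2"
  define near where "near = unit_cube \<inter> (\<Union>u\<in>periods. ball u r)"
  define far where "far = unit_cube - (\<Union>u\<in>periods. ball u r)"
  have near_m [measurable]: "near \<in> sets borel"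
    unfolding near_def by (intro sets.Int unit_cube_borel borel_open open_UN ballI open_ball)
  have far_m [measurable]: "far \<in> sets borel"
    unfolding far_def by (intro sets.Diff unit_cube_borel borel_open open_UN ballI open_ball)
  have bdd: "bounded near" "bounded far"
    unfolding near_def far_def by (auto intro: bounded_subset[OF bounded_unit_cube])
  show thesis
  proof (rule that)
    fix p :: "'i \<Rightarrow> real" and N :: nat
    assume p: "(\<Sum>i\<in>I. p i) = 1" "\<And>i. i \<in> I \<Longrightarrow> p i \<ge> p0" and N: "N \<ge> 1"
      and "\<exists>q \<in> {1..N} \<rightarrow>\<^sub>E I. (\<Sum>j=1..N. k (q j)) = real N *\<^sub>R mean p"
    then obtain q where q: "q \<in> {1..N} \<rightarrow>\<^sub>E I" "(\<Sum>j=1..N. k (q j)) = real N *\<^sub>R mean p" by blast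
    define F where "F t = charfun p t ^ N" for t
    have p_nn: "p i \<ge> 0" if "i \<in> I" for i using p(2)[OF that] p0 by simp
    have F_m [measurable]: "F \<in> borel_measurable borel"
      unfolding F_def by (intro borel_measurable_continuous_onI continuous_intros continuous_charfun)
    have F1: "cmod (F t) \<le> 1" for t
      unfolding F_def norm_power using norm_charfun_le_1[OF p(1) p_nn] by (intro power_le_one) auto
    have F_int: "set_integrable lborel E F" if "E \<in> sets borel" "bounded E" for E
      using that F1 by (intro set_integrable_bounded[where K = 1]) auto
    have g: "real N *\<^sub>R mean p \<in> integer_vectors"
      using q steps_integer unfolding q(2)[symmetric] integer_vectors_def by (auto simp: PiE_def Pi_def)
    have "of_real (path_weight p N (real N *\<^sub>R mean p)) = (LINT t:unit_cube|lborel. F t)"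
      unfolding path_weight_def F_def charfun_def
      by (rule path_weight_fourier_inversion[OF finite_steps steps_integer g])
    also have "unit_cube = near \<union> far" by (auto simp: near_def far_def)
    also have "(LINT t:near \<union> far|lborel. F t) = (LINT t:near|lborel. F t) + (LINT t:far|lborel. F t)"
      by (rule set_integral_Un) (use F_int bdd near_m far_m in \<open>auto simp: near_def far_def\<close>)
    \<comment> \<open>all peaks in the unit cube are carried to the one at the origin\<close>
    also have "(LINT t:near|lborel. F t) = of_nat period_index * (LINT t:ball 0 r|lborel. F t)"
    proof -
      have "of_nat period_index * (LINT t:ball 0 r|lborel. F t) = of_nat 1 * (LINT t:near|lborel. F t)"
      proof (rule periodic_integral_unfold[where H = periods and K = 1])
        show "F (t + u) = F t" if "u \<in> periods" for u t
          unfolding F_def using charfun_power_periodic[OF q that] .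
        show "card {u \<in> periods. t + u \<in> near} = period_index" if t: "t \<in> ball 0 r" for t
        proof -
          have "t + u \<in> ball u r" for u
            using t by (simp add: dist_norm)
          then have "{u \<in> periods. t + u \<in> near} = {u \<in> periods. t + u \<in> unit_cube}"
            unfolding near_def by blast
          then show ?thesis by (simp add: card_periods_translate_in_unit_cube)
        qed
        show "card {u \<in> periods. t + u \<in> ball 0 r} = 1" if t: "t \<in> near" for t
        proof -
          obtain u where u: "u \<in> periods" "dist u t < r" using t by (auto simp: near_def)
          have "{v \<in> periods. t + v \<in> ball 0 r} = {- u}"
          proof (intro equalityI subsetI)
            fix v assume v: "v \<in> {v \<in> periods. t + v \<in> ball 0 r}"
            have "norm (v + u) \<le> norm (t + v) + norm (u - t)"
              using norm_triangle_ineq[of "t + v" "u - t"] by (simp add: algebra_simps)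
            also have "\<dots> < r0"
            proof -
              have "norm (t + v) < r" using v by simp
              moreover have "norm (u - t) < r" using u(2) by (simp add: dist_norm)
              ultimately show ?thesis using r(2) by linarith
            qed
            finally have "v + u = 0" using r0(2) v u periods_add by blast
            then show "v \<in> {- u}" by (simp add: add_eq_0_iff2)
          next
            fix v assume "v \<in> {- u}"
            moreover have "norm (t - u) < r" using u(2) by (simp add: dist_norm norm_minus_commute)
            ultimately show "v \<in> {v \<in> periods. t + v \<in> ball 0 r}"
              using periods_minus[OF u(1)] by simp
          qed
          then show ?thesis by simp
        qed
      qed (use periods_minus finite_periods_norm_le near_m F_m bdd F1 in auto)
      then show ?thesis by simp
    qed
    finally have "path_weight p N (real N *\<^sub>R mean p)
        = real period_index * Re (LINT t:ball 0 r|lborel. F t) + Re (LINT t:far|lborel. F t)"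
      by (auto dest: arg_cong[where f = Re])
    moreover have "\<bar>Re (LINT t:far|lborel. F t)\<bar> \<le> C2 * real N powr (- ?n - 1)"
    proof -
      have Ff: "cmod (F t) \<le> \<theta> ^ N" if t: "t \<in> far" for t
      proof -
        have "oscillation t \<ge> \<eta>"
          using t by (intro \<eta>(2)) (auto simp: far_def not_less)
        then have "p0\<^sup>2 * \<eta> \<le> p0\<^sup>2 * oscillation t" by (intro mult_left_mono) auto
        moreover have "(cmod (charfun p t))\<^sup>2 \<le> 1 - p0\<^sup>2 * oscillation t"
          using norm_charfun_le[OF p] p0 by simp
        ultimately have "(cmod (charfun p t))\<^sup>2 \<le> max 0 (1 - p0\<^sup>2 * \<eta>)" by simp
        then have "cmod (charfun p t) \<le> \<theta>"
          unfolding \<theta>_def by (rule real_le_rsqrt)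
        then show ?thesis unfolding F_def norm_power by (intro power_mono) auto
      qed
      have fin_unit: "emeasure lborel (unit_cube :: (real^'n) set) < \<infinity>"
        by (rule emeasure_bounded_finite[OF bounded_unit_cube])
      have "cmod (LINT t:far|lborel. F t) \<le> (\<integral>t. norm (indicator far t *\<^sub>R F t) \<partial>lborel)"
        unfolding set_lebesgue_integral_def by (rule integral_norm_bound)
      also have "\<dots> \<le> (\<integral>t. \<theta> ^ N * indicator (unit_cube :: (real^'n) set) t \<partial>lborel)"
      proof (rule integral_mono)
        show "integrable lborel (\<lambda>t. norm (indicator far t *\<^sub>R F t))"
          using F_int[OF far_m bdd(2)] unfolding set_integrable_def by (rule integrable_norm)
        show "integrable lborel (\<lambda>t. \<theta> ^ N * indicator (unit_cube :: (real^'n) set) t)"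
          using fin_unit by (intro integrable_mult_right) simp
        show "norm (indicator far t *\<^sub>R F t) \<le> \<theta> ^ N * indicator unit_cube t" for t
          using Ff[of t] \<theta>(1) by (auto simp: indicator_def far_def)
      qed
      also have "\<dots> = \<theta> ^ N"
        using measure_unit_cube[where 'n = 'n] fin_unit by simp
      also have "\<dots> \<le> C2 * real N powr (- (?n + 1))" by (rule C2[OF N])
      finally show ?thesis
        using abs_Re_le_cmod[of "LINT t:far|lborel. F t"] by simp
    qed
    moreover have "\<bar>Re (LINT t:ball 0 r|lborel. F t) - (2 * pi * real N) powr (- ?n) / sqrt (det (covariance p))\<bar>
        \<le> C1 * (pi / c) powr ?n * real N powr (- ?n - 1)"
    proof -
      let ?G = "\<lambda>t. exp (- (2 * pi\<^sup>2 * real N) * (t \<bullet> (covariance p *v t)))"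
      let ?H = "\<lambda>t::real^'n. exp (- (c * real N) * (norm t)\<^sup>2)"
      have G: "has_bochner_integral lborel ?G ((pi / (2 * pi\<^sup>2 * real N)) powr ?n / sqrt (det (covariance p)))"
        using N by (intro gaussian_quadratic_form transpose_covariance covariance_pos[OF p p0]) auto
      have H: "has_bochner_integral lborel ?H ((pi / (c * real N)) powr ?n)"
        using gaussian_norm[of "c * real N", where 'a = "real^'n"] c N by simp
      have F_int': "integrable lborel (\<lambda>t. indicator (ball 0 r) t *\<^sub>R F t)"
        using F_int[of "ball 0 r"] unfolding set_integrable_def by simp
      have R: "integrable lborel (\<lambda>t. indicator (ball 0 r) t * Re (F t))"
        using integrable_Re[OF F_int'] by simp
      have "Re (LINT t:ball 0 r|lborel. F t) = (\<integral>t. indicator (ball 0 r) t * Re (F t) \<partial>lborel)"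
        unfolding set_lebesgue_integral_def using integral_Re[OF F_int'] by simp
      then have "Re (LINT t:ball 0 r|lborel. F t) - (pi / (2 * pi\<^sup>2 * real N)) powr ?n / sqrt (det (covariance p))
          = (\<integral>t. indicator (ball 0 r) t * Re (F t) - ?G t \<partial>lborel)"
        using R G by (simp add: has_bochner_integral_iff)
      also have "\<bar>\<dots>\<bar> \<le> (\<integral>t. C1 / real N * ?H t \<partial>lborel)"
      proof -
        have "\<bar>\<integral>t. indicator (ball 0 r) t * Re (F t) - ?G t \<partial>lborel\<bar>
            \<le> (\<integral>t. \<bar>indicator (ball 0 r) t * Re (F t) - ?G t\<bar> \<partial>lborel)"
          by (rule integral_abs_bound)
        also have "\<dots> \<le> (\<integral>t. C1 / real N * ?H t \<partial>lborel)"
        proof (rule integral_mono)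
          show "integrable lborel (\<lambda>t. \<bar>indicator (ball 0 r) t * Re (F t) - ?G t\<bar>)"
            using R G by (intro integrable_abs Bochner_Integration.integrable_diff) (simp_all add: has_bochner_integral_iff)
          show "integrable lborel (\<lambda>t. C1 / real N * ?H t)"
            using H by (intro integrable_mult_right) (simp add: has_bochner_integral_iff)
          show "\<bar>indicator (ball 0 r) t * Re (F t) - ?G t\<bar> \<le> C1 / real N * ?H t" for t
            unfolding F_def by (rule approx[OF p N])
        qed
        finally show ?thesis .
      qed
      also have "\<dots> = C1 / real N * (pi / (c * real N)) powr ?n"
        using H by (simp add: has_bochner_integral_iff)
      also have "\<dots> = C1 * (pi / c) powr ?n * real N powr (- ?n - 1)"
      proof -
        have "(pi / (c * real N)) powr ?n = (pi / c) powr ?n / real N powr ?n"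
          using N c by (simp add: powr_divide[symmetric])
        moreover have "real N powr (- ?n - 1) = 1 / real N powr ?n / real N"
          using N by (simp only: powr_diff powr_minus_divide) simp
        ultimately show ?thesis by simp
      qed
      also have "(pi / (2 * pi\<^sup>2 * real N)) = inverse (2 * pi * real N)"
        using N by (simp add: power2_eq_square field_simps)
      also have "inverse (2 * pi * real N) powr ?n = (2 * pi * real N) powr (- ?n)"
        unfolding powr_minus by (rule inverse_powr)
      finally show ?thesis .
    qed
    ultimately show "\<bar>path_weight p N (real N *\<^sub>R mean p)
        - real period_index * (2 * pi * real N) powr (- ?n) / sqrt (det (covariance p))\<bar>
      \<le> C * real N powr (- ?n - 1)"
    proof -
      let ?A = "Re (LINT t:ball 0 r|lborel. F t)" and ?B = "Re (LINT t:far|lborel. F t)"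
      let ?D = "(2 * pi * real N) powr (- ?n) / sqrt (det (covariance p))" and ?E = "real N powr (- ?n - 1)"
      assume W: "path_weight p N (real N *\<^sub>R mean p) = real period_index * ?A + ?B"
        and B: "\<bar>?B\<bar> \<le> C2 * ?E" and A: "\<bar>?A - ?D\<bar> \<le> C1 * (pi / c) powr ?n * ?E"
      have "path_weight p N (real N *\<^sub>R mean p) - real period_index * ?D = real period_index * (?A - ?D) + ?B"
        by (simp add: W right_diff_distrib)
      then have "\<bar>path_weight p N (real N *\<^sub>R mean p) - real period_index * ?D\<bar> \<le> real period_index * \<bar>?A - ?D\<bar> + \<bar>?B\<bar>"
        using abs_triangle_ineq[of "real period_index * (?A - ?D)" ?B] by (simp add: abs_mult)
      also have "\<dots> \<le> real period_index * (C1 * (pi / c) powr ?n * ?E) + C2 * ?E"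
        using A B by (intro add_mono mult_left_mono) auto
      also have "\<dots> = C * ?E" by (simp add: C_def distrib_right mult.assoc)
      finally show ?thesis by simp
    qed
  qed
qed

end

section \<open>Exponential tilting near the barycenter\<close>

text \<open>
  The Riesz representative; it transports questions about the dual space to a Euclidean space.
\<close>

definition riesz :: "'a::euclidean_space dual \<Rightarrow> 'a" where
  "riesz \<beta> = (\<Sum>e\<in>Basis. blinfun_apply \<beta> e *\<^sub>R e)"

lemma inner_riesz: "riesz \<beta> \<bullet> x = blinfun_apply \<beta> x"
proof -
  have "blinfun_apply \<beta> x = blinfun_apply \<beta> (\<Sum>e\<in>Basis. (x \<bullet> e) *\<^sub>R e)"
    by (simp add: euclidean_representation)
  also have "\<dots> = riesz \<beta> \<bullet> x"
    by (simp add: riesz_def blinfun.bilinear_simps blinfun.sum_right inner_sum_left inner_commute[of x] mult.commute)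
  finally show ?thesis ..
qed

lemma bounded_linear_riesz: "bounded_linear riesz"
  unfolding riesz_def
  by (intro bounded_linear_sum bounded_linear_compose[OF bounded_linear_scaleR_left blinfun.bounded_linear_left])

lemma riesz_inject: "riesz \<alpha> = riesz \<beta> \<longleftrightarrow> \<alpha> = \<beta>"
  by (metis blinfun_eqI inner_riesz)

lemma linear_to_dual_bij:
  fixes A :: "'a::euclidean_space \<Rightarrow> 'a dual"
  assumes "linear A" and "\<And>x. A x = 0 \<Longrightarrow> x = 0"
  shows "bij A"
proof -
  have lin: "linear (riesz \<circ> A)"
    by (intro linear_compose assms(1) bounded_linear.linear[OF bounded_linear_riesz])
  have inj: "inj A" using assms linear_injective_0 by blast
  then have "inj (riesz \<circ> A)" by (auto simp: inj_on_def riesz_inject)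
  then have "surj (riesz \<circ> A)" by (rule linear_injective_imp_surjective[OF lin]) simp
  then have "\<exists>x. A x = \<beta>" for \<beta>
    by (metis comp_apply riesz_inject surjD)
  then show ?thesis using inj by (auto simp: bij_def surj_def) metis
qed

text \<open>
  The tilted distributions \<open>gibbs_weight c S \<tau>\<close> form the exponential family generated by the weights \<open>c\<close>; the spanning
  assumption makes its parameter identifiable.
\<close>

locale exponential_family =
  fixes S :: "'a::euclidean_space dual set" and c :: "'a dual \<Rightarrow> real"
  assumes finite_S: "finite S" and S_nonempty: "S \<noteq> {}" and span_S: "span (diff_set S) = UNIV"
    and c_pos: "\<And>\<beta>. \<beta> \<in> S \<Longrightarrow> c \<beta> > 0"
begin

abbreviation "m \<equiv> barycenter c S"
abbreviation "A \<equiv> A_map c S m"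

definition partition_sum :: "'a \<Rightarrow> real" where
  "partition_sum \<tau> = (\<Sum>\<beta>\<in>S. c \<beta> * exp (blinfun_apply \<beta> \<tau>))"

text \<open>
  A vector annihilated by \<open>diff_set S\<close> is annihilated by its span, in particular by the functional \<open>inner x\<close>.
\<close>

lemma separation:
  assumes "\<And>\<beta> \<beta>'. \<beta> \<in> S \<Longrightarrow> \<beta>' \<in> S \<Longrightarrow> blinfun_apply (\<beta> - \<beta>') x = 0"
  shows "x = 0"
proof -
  have sub: "subspace {\<beta>. blinfun_apply \<beta> x = 0}"
    by (auto simp: subspace_def blinfun.bilinear_simps)
  have "diff_set S \<subseteq> {\<beta>. blinfun_apply \<beta> x = 0}"
    using assms by (auto simp: diff_set_def)
  then have "span (diff_set S) \<subseteq> {\<beta>. blinfun_apply \<beta> x = 0}"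
    using sub by (rule span_minimal)
  moreover have "blinfun_inner_right x \<in> span (diff_set S)"
    by (simp add: span_S)
  ultimately have "blinfun_apply (blinfun_inner_right x) x = 0"
    by blast
  then show "x = 0" by simp
qed

lemma partition_sum_pos: "partition_sum \<tau> > 0"
  unfolding partition_sum_def using finite_S S_nonempty c_pos by (intro sum_pos) auto

lemma total_weight_eq: "total_weight c S = partition_sum 0"
  by (simp add: total_weight_def partition_sum_def)

lemma total_weight_pos: "total_weight c S > 0"
  unfolding total_weight_eq by (rule partition_sum_pos)

lemma gibbs_eq: "gibbs_weight c S \<tau> \<beta> = c \<beta> * exp (blinfun_apply \<beta> \<tau>) / partition_sum \<tau>"
  by (simp add: gibbs_weight_def partition_sum_def)

lemma gibbs_pos: "\<beta> \<in> S \<Longrightarrow> gibbs_weight c S \<tau> \<beta> > 0"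
  using partition_sum_pos c_pos by (simp add: gibbs_eq)

lemma sum_gibbs: "(\<Sum>\<beta>\<in>S. gibbs_weight c S \<tau> \<beta>) = 1"
  using partition_sum_pos[of \<tau>] by (simp add: gibbs_eq flip: sum_divide_distrib) (simp add: partition_sum_def)

lemma moment_map_0: "moment_map c S 0 = m"
  by (simp add: moment_map_def gibbs_eq barycenter_def total_weight_eq scaleR_sum_right)

lemma gibbs_shift:
  "gibbs_weight c S \<tau> \<beta> = gibbs_weight c S \<sigma> \<beta> * exp (blinfun_apply \<beta> (\<tau> - \<sigma>)) / (\<Sum>\<beta>'\<in>S. gibbs_weight c S \<sigma> \<beta>' * exp (blinfun_apply \<beta>' (\<tau> - \<sigma>)))"
proof -
  have e: "c \<beta> * exp (blinfun_apply \<beta> \<tau>) = c \<beta> * exp (blinfun_apply \<beta> \<sigma>) * exp (blinfun_apply \<beta> (\<tau> - \<sigma>))" for \<beta>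
    by (simp add: blinfun.bilinear_simps flip: exp_add)
  have "(\<Sum>\<beta>'\<in>S. gibbs_weight c S \<sigma> \<beta>' * exp (blinfun_apply \<beta>' (\<tau> - \<sigma>))) = partition_sum \<tau> / partition_sum \<sigma>"
    by (simp add: gibbs_eq partition_sum_def[of \<tau>] e sum_divide_distrib)
  then show ?thesis
    using partition_sum_pos[of \<sigma>] partition_sum_pos[of \<tau>] by (simp add: gibbs_eq e)
qed

text \<open>
  With \<open>h = \<tau> - \<sigma>\<close> and \<open>Y \<beta> = \<langle>\<beta>, h\<rangle> - ln R\<close>, where \<open>R\<close> normalises, the pairing of the difference of the two moments with \<open>h\<close> is
  the mean of \<open>(exp Y - 1) * Y\<close>, whose terms are nonnegative and vanish only for \<open>Y = 0\<close>. Then \<open>\<langle>\<beta>, h\<rangle>\<close> is constant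
  on \<open>S\<close>, so \<open>h = 0\<close> by \<open>separation\<close>.
\<close>

lemma moment_map_inj: "inj (moment_map c S)"
proof (rule injI)
  fix \<tau> \<sigma> assume eq: "moment_map c S \<tau> = moment_map c S \<sigma>"
  define h where "h = \<tau> - \<sigma>"
  define p where "p = gibbs_weight c S \<sigma>"
  define R where "R = (\<Sum>\<beta>\<in>S. p \<beta> * exp (blinfun_apply \<beta> h))"
  have p: "p \<beta> > 0" if "\<beta> \<in> S" for \<beta> using gibbs_pos[OF that] by (simp add: p_def)
  have R: "R > 0" unfolding R_def using finite_S S_nonempty p by (intro sum_pos) auto
  have shift: "gibbs_weight c S \<tau> \<beta> = p \<beta> * exp (blinfun_apply \<beta> h - ln R)" for \<beta>
    unfolding gibbs_shift[of \<tau> \<beta> \<sigma>] p_def[symmetric] h_def[symmetric] R_def[symmetric]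
    using R by (simp add: exp_diff)
  have mono: "(exp u - 1) * u \<ge> 0" "(exp u - 1) * u = 0 \<longleftrightarrow> u = 0" for u :: real
    by (auto simp: zero_le_mult_iff)
  have nn: "p \<beta> * ((exp (blinfun_apply \<beta> h - ln R) - 1) * (blinfun_apply \<beta> h - ln R)) \<ge> 0" if "\<beta> \<in> S" for \<beta>
    using p[OF that] mono(1) by (simp only: less_imp_le mult_nonneg_nonneg)
  have "(\<Sum>\<beta>\<in>S. p \<beta> * ((exp (blinfun_apply \<beta> h - ln R) - 1) * (blinfun_apply \<beta> h - ln R)))
      = (\<Sum>\<beta>\<in>S. (gibbs_weight c S \<tau> \<beta> - p \<beta>) * blinfun_apply \<beta> h) - ln R * (\<Sum>\<beta>\<in>S. gibbs_weight c S \<tau> \<beta> - p \<beta>)"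
    unfolding sum_distrib_left sum_subtractf[symmetric]
    by (intro sum.cong refl) (simp add: shift algebra_simps)
  also have "(\<Sum>\<beta>\<in>S. gibbs_weight c S \<tau> \<beta> - p \<beta>) = 0"
    by (simp add: sum_subtractf p_def sum_gibbs)
  also have "(\<Sum>\<beta>\<in>S. (gibbs_weight c S \<tau> \<beta> - p \<beta>) * blinfun_apply \<beta> h) = blinfun_apply (moment_map c S \<tau> - moment_map c S \<sigma>) h"
    by (simp add: moment_map_def p_def blinfun.bilinear_simps blinfun.sum_left left_diff_distrib sum_subtractf)
  finally have "(\<Sum>\<beta>\<in>S. p \<beta> * ((exp (blinfun_apply \<beta> h - ln R) - 1) * (blinfun_apply \<beta> h - ln R))) = 0"
    by (simp add: eq)
  then have "\<forall>\<beta>\<in>S. p \<beta> * ((exp (blinfun_apply \<beta> h - ln R) - 1) * (blinfun_apply \<beta> h - ln R)) = 0"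
    using finite_S nn by (subst (asm) sum_nonneg_eq_0_iff)
  then have "blinfun_apply \<beta> h = ln R" if "\<beta> \<in> S" for \<beta>
    using that p[OF that] mono(2)[of "blinfun_apply \<beta> h - ln R"] by fastforce
  then have "h = 0" by (intro separation) (simp add: blinfun.bilinear_simps)
  then show "\<tau> = \<sigma>" by (simp add: h_def)
qed

lemma moment_map_inv_eq: "moment_map c S \<tau> = x \<Longrightarrow> moment_map_inv c S x = \<tau>"
  unfolding moment_map_inv_def using moment_map_inj by (auto intro: inv_f_f)

lemma exp_delta:
  assumes "moment_map c S \<tau> = x"
  shows "exp (delta_c c S x) = partition_sum \<tau> * exp (- blinfun_apply x \<tau>)"
    and "delta_c c S x = ln (partition_sum \<tau> * exp (- blinfun_apply x \<tau>))"
proof -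
  have "(\<Sum>\<beta>\<in>S. c \<beta> * exp (blinfun_apply (\<beta> - x) \<tau>)) = partition_sum \<tau> * exp (- blinfun_apply x \<tau>)"
    by (simp add: partition_sum_def sum_distrib_right blinfun.bilinear_simps exp_diff exp_minus divide_inverse mult.assoc)
  then show "delta_c c S x = ln (partition_sum \<tau> * exp (- blinfun_apply x \<tau>))"
    by (simp add: delta_c_def moment_map_inv_eq[OF assms])
  then show "exp (delta_c c S x) = partition_sum \<tau> * exp (- blinfun_apply x \<tau>)"
    using partition_sum_pos[of \<tau>] by simp
qed

definition base_weight :: "'a dual \<Rightarrow> real" where "base_weight = gibbs_weight c S 0"

lemma base_weight: "\<beta> \<in> S \<Longrightarrow> base_weight \<beta> > 0" "(\<Sum>\<beta>\<in>S. base_weight \<beta>) = 1"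
  using gibbs_pos sum_gibbs by (auto simp: base_weight_def)

lemma m_eq: "m = (\<Sum>\<beta>\<in>S. base_weight \<beta> *\<^sub>R \<beta>)"
  by (simp add: moment_map_0[symmetric] moment_map_def base_weight_def)

lemma sum_base_weight_centered: "(\<Sum>\<beta>\<in>S. base_weight \<beta> * blinfun_apply (\<beta> - m) \<tau>) = 0"
proof -
  have "(\<Sum>\<beta>\<in>S. base_weight \<beta> * blinfun_apply (\<beta> - m) \<tau>) = (\<Sum>\<beta>\<in>S. base_weight \<beta> * blinfun_apply \<beta> \<tau>) - (\<Sum>\<beta>\<in>S. base_weight \<beta>) * blinfun_apply m \<tau>"
    by (simp add: blinfun.bilinear_simps right_diff_distrib sum_subtractf sum_distrib_right)
  then show ?thesis by (simp add: base_weight m_eq blinfun.sum_left blinfun.bilinear_simps)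
qed

lemma A_eq: "A y = (\<Sum>\<beta>\<in>S. (base_weight \<beta> * blinfun_apply (\<beta> - m) y) *\<^sub>R (\<beta> - m))"
proof -
  have "(\<Sum>\<beta>\<in>S. (base_weight \<beta> * blinfun_apply (\<beta> - m) y) *\<^sub>R (\<beta> - m))
      = (\<Sum>\<beta>\<in>S. (base_weight \<beta> * blinfun_apply (\<beta> - m) y) *\<^sub>R \<beta>)"
    using sum_base_weight_centered[of y] by (simp add: scaleR_diff_right sum_subtractf flip: scaleR_sum_left)
  also have "\<dots> = (\<Sum>\<beta>\<in>S. base_weight \<beta> *\<^sub>R tensor_square \<beta> y) - blinfun_apply m y *\<^sub>R (\<Sum>\<beta>\<in>S. base_weight \<beta> *\<^sub>R \<beta>)"
    by (simp add: tensor_square_def blinfun.bilinear_simps right_diff_distrib scaleR_diff_left sum_subtractf scaleR_sum_right mult.commute)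
  also have "\<dots> = A y"
    unfolding A_map_def moment_map_inv_eq[OF moment_map_0] base_weight_def[symmetric]
    by (simp add: tensor_square_def flip: m_eq)
  finally show ?thesis ..
qed

lemma A_apply: "blinfun_apply (A y) z = (\<Sum>\<beta>\<in>S. base_weight \<beta> * blinfun_apply (\<beta> - m) y * blinfun_apply (\<beta> - m) z)"
  by (simp add: A_eq blinfun.sum_left blinfun.bilinear_simps)

lemma linear_A: "linear A"
  by (rule linearI) (simp_all add: A_eq blinfun.bilinear_simps algebra_simps sum.distrib sum_subtractf scaleR_sum_right)

lemma A_lower_bound:
  obtains \<kappa> where "\<kappa> > 0" "\<And>y. blinfun_apply (A y) y \<ge> \<kappa> * (norm y)\<^sup>2"
proof -
  define \<Psi> where "\<Psi> y = blinfun_apply (A y) y" for y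
  have \<Psi>_eq: "\<Psi> y = (\<Sum>\<beta>\<in>S. base_weight \<beta> * (blinfun_apply (\<beta> - m) y)\<^sup>2)" for y
    by (simp add: \<Psi>_def A_apply power2_eq_square mult.assoc)
  have nn: "base_weight \<beta> * (blinfun_apply (\<beta> - m) y)\<^sup>2 \<ge> 0" if "\<beta> \<in> S" for \<beta> y
    using base_weight(1)[OF that] by simp
  have "\<Psi> y > 0" if "y \<noteq> 0" for y
  proof (rule ccontr)
    assume "\<not> \<Psi> y > 0"
    moreover have "\<Psi> y \<ge> 0" unfolding \<Psi>_eq by (intro sum_nonneg nn)
    ultimately have "\<Psi> y = 0" by linarith
    then have "\<forall>\<beta>\<in>S. base_weight \<beta> * (blinfun_apply (\<beta> - m) y)\<^sup>2 = 0"
      unfolding \<Psi>_eq using finite_S nn by (subst (asm) sum_nonneg_eq_0_iff) auto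
    then have "blinfun_apply \<beta> y = blinfun_apply m y" if "\<beta> \<in> S" for \<beta>
      using that base_weight(1)[OF that] by (auto simp: blinfun.bilinear_simps)
    then have "y = 0" by (intro separation) (simp add: blinfun.bilinear_simps)
    then show False using that by simp
  qed
  moreover have "continuous_on (sphere 0 1) \<Psi>"
    unfolding \<Psi>_eq by (intro continuous_intros)
  moreover have "\<Psi> (a *\<^sub>R y) = a\<^sup>2 * \<Psi> y" for a y
    by (simp add: \<Psi>_def linear_scale[OF linear_A] blinfun.bilinear_simps power2_eq_square)
  ultimately show thesis
    using quadratic_form_lower_bound[of \<Psi>] that unfolding \<Psi>_def by blast
qed

lemma norm_A_lower_bound:
  assumes "\<kappa> > 0" "\<And>y. blinfun_apply (A y) y \<ge> \<kappa> * (norm y)\<^sup>2"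
  shows "norm (A y) \<ge> \<kappa> * norm y"
proof (cases "y = 0")
  case False
  have "\<kappa> * norm y * norm y \<le> norm (A y) * norm y"
    using assms(2)[of y] norm_blinfun[of "A y" y] by (simp add: power2_eq_square mult.assoc)
  then show ?thesis using False by (simp add: mult_le_cancel_right)
qed simp

lemma bij_A: "bij A"
proof -
  obtain \<kappa> where \<kappa>: "\<kappa> > 0" "\<And>y. blinfun_apply (A y) y \<ge> \<kappa> * (norm y)\<^sup>2"
    using A_lower_bound by blast
  show ?thesis
  proof (rule linear_to_dual_bij[OF linear_A])
    fix y assume "A y = 0"
    then have "\<kappa> * norm y \<le> 0" using norm_A_lower_bound[OF \<kappa>, of y] by simp
    then show "y = 0" using \<kappa>(1) by (simp add: mult_le_0_iff)
  qed
qed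

lemma centered_bound:
  obtains B where "B \<ge> 1" "\<And>\<beta>. \<beta> \<in> S \<Longrightarrow> norm (\<beta> - m) \<le> B"
proof -
  have "norm (\<beta> - m) \<le> 1 + (\<Sum>\<beta>\<in>S. norm (\<beta> - m))" if "\<beta> \<in> S" for \<beta>
    using member_le_sum[of \<beta> S "\<lambda>\<beta>. norm (\<beta> - m)"] that finite_S by simp
  moreover have "1 + (\<Sum>\<beta>\<in>S. norm (\<beta> - m)) \<ge> 1" by (simp add: sum_nonneg)
  ultimately show thesis using that by blast
qed


definition centered_mgf :: "'a \<Rightarrow> real" where
  "centered_mgf \<tau> = (\<Sum>\<beta>\<in>S. base_weight \<beta> * exp (blinfun_apply (\<beta> - m) \<tau>))"

lemma centered_mgf_eq: "centered_mgf \<tau> = partition_sum \<tau> * exp (- blinfun_apply m \<tau>) / total_weight c S"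
  by (simp add: centered_mgf_def base_weight_def gibbs_eq partition_sum_def[of \<tau>] total_weight_eq sum_distrib_left sum_distrib_right
       sum_divide_distrib blinfun.bilinear_simps exp_diff exp_minus divide_inverse mult_ac)

text \<open>
  Jensen's inequality in the form \<open>exp z \<ge> 1 + z\<close>.
\<close>

lemma centered_mgf_ge_1: "centered_mgf \<tau> \<ge> 1"
proof -
  have "1 = (\<Sum>\<beta>\<in>S. base_weight \<beta> * (1 + blinfun_apply (\<beta> - m) \<tau>))"
    using sum_base_weight_centered[of \<tau>] by (simp add: distrib_left sum.distrib base_weight)
  also have "\<dots> \<le> centered_mgf \<tau>"
    unfolding centered_mgf_def using base_weight(1) by (intro sum_mono mult_left_mono exp_ge_add_one_self) (auto simp: less_imp_le)
  finally show ?thesis .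
qed

lemma gibbs_centered: "gibbs_weight c S \<tau> \<beta> = base_weight \<beta> * exp (blinfun_apply (\<beta> - m) \<tau>) / centered_mgf \<tau>"
  using total_weight_pos
  by (simp add: centered_mgf_eq gibbs_eq[of \<tau>] base_weight_def gibbs_eq[of 0] total_weight_eq blinfun.bilinear_simps exp_diff exp_minus field_simps)

lemma moment_map_centered:
  "moment_map c S \<tau> - m = (1 / centered_mgf \<tau>) *\<^sub>R (\<Sum>\<beta>\<in>S. (base_weight \<beta> * exp (blinfun_apply (\<beta> - m) \<tau>)) *\<^sub>R (\<beta> - m))"
proof -
  have "(\<Sum>\<beta>\<in>S. gibbs_weight c S \<tau> \<beta> *\<^sub>R (\<beta> - m)) = moment_map c S \<tau> - m"
    using sum_gibbs[of \<tau>] by (simp add: moment_map_def scaleR_diff_right sum_subtractf flip: scaleR_sum_left)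
  then show ?thesis
    by (simp add: gibbs_centered scaleR_sum_right divide_inverse mult_ac)
qed

lemma sum_base_weight_le:
  assumes "\<And>\<beta>. \<beta> \<in> S \<Longrightarrow> f \<beta> \<le> M"
  shows "(\<Sum>\<beta>\<in>S. base_weight \<beta> * f \<beta>) \<le> M"
proof -
  have "(\<Sum>\<beta>\<in>S. base_weight \<beta> * f \<beta>) \<le> (\<Sum>\<beta>\<in>S. base_weight \<beta> * M)"
    using assms base_weight(1) by (intro sum_mono mult_left_mono) (auto simp: less_imp_le)
  then show ?thesis by (simp add: base_weight(2) flip: sum_distrib_right)
qed

text \<open>
  Expand \<open>exp\<close> in \<open>centered_mgf\<close> and in the numerator of \<open>moment_map_centered\<close>. The first nonconstant term of the former
  and the constant term of the latter vanish because the steps are centered, and the next ones give \<open>A\<close>.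
\<close>

lemma local_expansion:
  obtains r C where "r > 0" "C > 0"
    "\<And>\<tau>. norm \<tau> \<le> r \<Longrightarrow> norm (moment_map c S \<tau> - m - A \<tau>) \<le> C * (norm \<tau>)\<^sup>2"
    "\<And>\<tau>. norm \<tau> \<le> r \<Longrightarrow> \<bar>ln (centered_mgf \<tau>) - blinfun_apply (A \<tau>) \<tau> / 2\<bar> \<le> C * norm \<tau> ^ 3"
    "\<And>\<tau>. norm (A \<tau>) \<le> C * norm \<tau>"
proof -
  obtain B where B: "B \<ge> 1" "\<And>\<beta>. \<beta> \<in> S \<Longrightarrow> norm (\<beta> - m) \<le> B"
    using centered_bound by blast
  have Y: "\<bar>blinfun_apply (\<beta> - m) \<tau>\<bar> \<le> B * norm \<tau>" if "\<beta> \<in> S" for \<beta> \<tau>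
    using norm_blinfun[of "\<beta> - m" \<tau>] mult_right_mono[OF B(2)[OF that], of "norm \<tau>"] by simp
  have A_le: "norm (A \<tau>) \<le> B\<^sup>2 * norm \<tau>" for \<tau>
  proof -
    have "norm (A \<tau>) \<le> (\<Sum>\<beta>\<in>S. base_weight \<beta> * (B * norm \<tau> * B))"
      unfolding A_eq
    proof (rule sum_norm_le)
      fix \<beta> assume \<beta>: "\<beta> \<in> S"
      have "norm ((base_weight \<beta> * blinfun_apply (\<beta> - m) \<tau>) *\<^sub>R (\<beta> - m)) = base_weight \<beta> * (\<bar>blinfun_apply (\<beta> - m) \<tau>\<bar> * norm (\<beta> - m))"
        using base_weight(1)[OF \<beta>] by (simp add: abs_mult mult.assoc)
      also have "\<dots> \<le> base_weight \<beta> * (B * norm \<tau> * B)"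
        using base_weight(1)[OF \<beta>] Y[OF \<beta>] B \<beta> by (intro mult_left_mono mult_mono) auto
      finally show "norm ((base_weight \<beta> * blinfun_apply (\<beta> - m) \<tau>) *\<^sub>R (\<beta> - m)) \<le> base_weight \<beta> * (B * norm \<tau> * B)" .
    qed
    also have "\<dots> \<le> B * norm \<tau> * B" by (rule sum_base_weight_le) simp
    finally show ?thesis by (simp add: power2_eq_square mult_ac)
  qed
  define r where "r = 1 / (2 * B)"
  define C where "C = 4 * B ^ 3"
  show thesis
  proof (rule that[of r C])
    show "r > 0" "C > 0" using B(1) by (auto simp: r_def C_def)
    show "norm (A \<tau>) \<le> C * norm \<tau>" for \<tau>
    proof -
      have "B\<^sup>2 \<le> B ^ 3" using B(1) by (intro power_increasing) auto
      also have "\<dots> \<le> C" using B(1) by (simp add: C_def)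
      finally show ?thesis using A_le[of \<tau>] mult_right_mono[of "B\<^sup>2" C "norm \<tau>"] by simp
    qed
    fix \<tau> :: 'a assume \<tau>: "norm \<tau> \<le> r"
    define b where "b = B * norm \<tau>"
    have b: "0 \<le> b" "b \<le> 1 / 2" using \<tau> B(1) by (auto simp: b_def r_def field_simps)
    let ?Y = "\<lambda>\<beta>. blinfun_apply (\<beta> - m) \<tau>"
    have Yb: "\<bar>?Y \<beta>\<bar> \<le> b" if "\<beta> \<in> S" for \<beta> using Y[OF that] by (simp add: b_def)
    have Y1: "\<bar>?Y \<beta>\<bar> \<le> 1" if "\<beta> \<in> S" for \<beta> using Yb[OF that] b by simp
    have Y2: "(?Y \<beta>)\<^sup>2 \<le> b\<^sup>2" if "\<beta> \<in> S" for \<beta>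
      using power_mono[OF Yb[OF that], of 2] by simp
    define Z where "Z = centered_mgf \<tau>"
    have Z1: "Z \<ge> 1" unfolding Z_def by (rule centered_mgf_ge_1)
    have Z_le: "Z - 1 \<le> 2 * b\<^sup>2"
    proof -
      have "Z - 1 = (\<Sum>\<beta>\<in>S. base_weight \<beta> * (exp (?Y \<beta>) - (1 + ?Y \<beta>)))"
        using sum_base_weight_centered[of \<tau>] base_weight(2) by (simp add: Z_def centered_mgf_def right_diff_distrib distrib_left sum_subtractf sum.distrib)
      also have "\<dots> \<le> 2 * b\<^sup>2"
      proof (rule sum_base_weight_le)
        fix \<beta> assume "\<beta> \<in> S"
        then show "exp (?Y \<beta>) - (1 + ?Y \<beta>) \<le> 2 * b\<^sup>2"
          using abs_exp_minus_linear_le[OF Y1] Y2[of \<beta>] by fastforce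
      qed
      finally show ?thesis .
    qed
    have Z_quad: "\<bar>Z - 1 - blinfun_apply (A \<tau>) \<tau> / 2\<bar> \<le> b ^ 3"
    proof -
      have "Z - 1 - blinfun_apply (A \<tau>) \<tau> / 2 = (\<Sum>\<beta>\<in>S. base_weight \<beta> * (exp (?Y \<beta>) - (1 + ?Y \<beta> + (?Y \<beta>)\<^sup>2 / 2)))"
        using sum_base_weight_centered[of \<tau>] base_weight(2)
        by (simp add: Z_def centered_mgf_def A_apply right_diff_distrib distrib_left sum_subtractf sum.distrib sum_divide_distrib power2_eq_square mult.assoc)
      also have "\<bar>\<dots>\<bar> \<le> (\<Sum>\<beta>\<in>S. base_weight \<beta> * \<bar>?Y \<beta>\<bar> ^ 3)"
      proof (rule order_trans[OF sum_abs sum_mono])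
        fix \<beta> assume \<beta>: "\<beta> \<in> S"
        then show "\<bar>base_weight \<beta> * (exp (?Y \<beta>) - (1 + ?Y \<beta> + (?Y \<beta>)\<^sup>2 / 2))\<bar> \<le> base_weight \<beta> * \<bar>?Y \<beta>\<bar> ^ 3"
          unfolding abs_mult using base_weight(1)[OF \<beta>] abs_exp_minus_quadratic_le[OF Y1[OF \<beta>]] by (intro mult_mono) auto
      qed
      also have "\<dots> \<le> b ^ 3" using Yb by (intro sum_base_weight_le power_mono) auto
      finally show ?thesis .
    qed
    define num where "num = (\<Sum>\<beta>\<in>S. (base_weight \<beta> * exp (?Y \<beta>)) *\<^sub>R (\<beta> - m))"
    have num: "norm (num - A \<tau>) \<le> 2 * b\<^sup>2 * B"
    proof -
      have "(\<Sum>\<beta>\<in>S. base_weight \<beta> *\<^sub>R (\<beta> - m)) = 0"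
        using base_weight(2) by (simp add: scaleR_diff_right sum_subtractf flip: scaleR_sum_left m_eq)
      then have "num - A \<tau> = (\<Sum>\<beta>\<in>S. (base_weight \<beta> * (exp (?Y \<beta>) - (1 + ?Y \<beta>))) *\<^sub>R (\<beta> - m))"
        by (simp add: num_def A_eq right_diff_distrib distrib_left scaleR_diff_left scaleR_add_left sum_subtractf sum.distrib)
      also have "norm \<dots> \<le> (\<Sum>\<beta>\<in>S. base_weight \<beta> * (2 * b\<^sup>2 * B))"
      proof (rule sum_norm_le)
        fix \<beta> assume \<beta>: "\<beta> \<in> S"
        have "norm ((base_weight \<beta> * (exp (?Y \<beta>) - (1 + ?Y \<beta>))) *\<^sub>R (\<beta> - m)) = base_weight \<beta> * (\<bar>exp (?Y \<beta>) - (1 + ?Y \<beta>)\<bar> * norm (\<beta> - m))"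
          using base_weight(1)[OF \<beta>] by (simp add: abs_mult mult.assoc)
        also have "\<dots> \<le> base_weight \<beta> * (2 * b\<^sup>2 * B)"
          using base_weight(1)[OF \<beta>] abs_exp_minus_linear_le[OF Y1[OF \<beta>]] Y2[OF \<beta>] B(2)[OF \<beta>]
          by (intro mult_left_mono mult_mono) auto
        finally show "norm ((base_weight \<beta> * (exp (?Y \<beta>) - (1 + ?Y \<beta>))) *\<^sub>R (\<beta> - m)) \<le> base_weight \<beta> * (2 * b\<^sup>2 * B)" .
      qed
      also have "\<dots> \<le> 2 * b\<^sup>2 * B" by (rule sum_base_weight_le) simp
      finally show ?thesis .
    qed
    have "moment_map c S \<tau> - m - A \<tau> = (1 / Z) *\<^sub>R (num - A \<tau>) - ((Z - 1) / Z) *\<^sub>R A \<tau>"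
    proof -
      have "(Z - 1) / Z = 1 - 1 / Z" using Z1 by (simp add: field_simps)
      then show ?thesis
        unfolding moment_map_centered num_def[symmetric] Z_def[symmetric]
        by (simp add: scaleR_diff_right scaleR_diff_left)
    qed
    then have "norm (moment_map c S \<tau> - m - A \<tau>) \<le> 1 / Z * norm (num - A \<tau>) + (Z - 1) / Z * norm (A \<tau>)"
      using Z1 norm_triangle_ineq4[of "(1 / Z) *\<^sub>R (num - A \<tau>)" "((Z - 1) / Z) *\<^sub>R A \<tau>"] by simp
    also have "\<dots> \<le> 1 * (2 * b\<^sup>2 * B) + (2 * b\<^sup>2) * (B * b)"
    proof (intro add_mono mult_mono)
      show "norm (A \<tau>) \<le> B * b" using A_le[of \<tau>] by (simp add: b_def power2_eq_square mult_ac)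
      have "(Z - 1) / Z \<le> (Z - 1) / 1" using Z1 by (intro divide_left_mono) auto
      then show "(Z - 1) / Z \<le> 2 * b\<^sup>2" using Z_le by simp
    qed (use Z1 num in auto)
    also have "\<dots> \<le> 4 * (b\<^sup>2 * B)"
    proof -
      have "(b\<^sup>2 * B) * b \<le> (b\<^sup>2 * B) * 1" using b B(1) by (intro mult_left_mono) auto
      then show ?thesis by (simp add: mult_ac)
    qed
    also have "\<dots> = C * (norm \<tau>)\<^sup>2"
      by (simp add: C_def b_def power_mult_distrib power2_eq_square power3_eq_cube)
    finally show "norm (moment_map c S \<tau> - m - A \<tau>) \<le> C * (norm \<tau>)\<^sup>2" .
    have b2: "b\<^sup>2 \<le> (1 / 2)\<^sup>2" using b by (intro power_mono) auto
    then have "\<bar>ln (1 + (Z - 1)) - (Z - 1)\<bar> \<le> (Z - 1)\<^sup>2"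
      using Z1 Z_le by (intro abs_ln_one_plus_x_minus_x_bound_nonneg) (auto simp: power2_eq_square)
    also have "\<dots> \<le> (2 * b\<^sup>2)\<^sup>2" using Z1 Z_le by (intro power_mono) auto
    also have "\<dots> = 4 * b ^ 3 * b" by (simp add: eval_nat_numeral)
    also have "\<dots> \<le> 4 * b ^ 3 * (1 / 2)" using b by (intro mult_left_mono) auto
    finally have "\<bar>ln Z - blinfun_apply (A \<tau>) \<tau> / 2\<bar> \<le> 3 * b ^ 3"
      using Z_quad by simp
    also have "\<dots> \<le> 4 * b ^ 3" using b by simp
    also have "\<dots> = C * norm \<tau> ^ 3" by (simp add: C_def b_def power_mult_distrib)
    finally show "\<bar>ln (centered_mgf \<tau>) - blinfun_apply (A \<tau>) \<tau> / 2\<bar> \<le> C * norm \<tau> ^ 3"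
      by (simp add: Z_def)
  qed
qed


lemma moment_map_has_derivative: "(moment_map c S has_derivative A) (at 0)"
  unfolding has_derivative_iff_norm
proof
  show "bounded_linear A" using linear_A linear_conv_bounded_linear by blast
  obtain r C where r: "r > 0" "C > 0"
    and E: "\<And>\<tau>. norm \<tau> \<le> r \<Longrightarrow> norm (moment_map c S \<tau> - m - A \<tau>) \<le> C * (norm \<tau>)\<^sup>2"
    using local_expansion by metis
  have "((\<lambda>y. norm (moment_map c S y - moment_map c S 0 - A (y - 0)) / norm (y - 0)) \<longlongrightarrow> 0) (at 0)"
  proof (rule Lim_null_comparison)
    have "\<forall>\<^sub>F y in at 0. norm (y::'a) \<le> r"
      using r(1) unfolding eventually_at by (intro exI[of _ r]) auto
    then show "\<forall>\<^sub>F y in at 0. norm (norm (moment_map c S y - moment_map c S 0 - A (y - 0)) / norm (y - 0)) \<le> C * norm y"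
    proof eventually_elim
      case (elim y)
      show ?case
      proof (cases "y = 0")
        case False
        then show ?thesis using E[OF elim] by (simp add: moment_map_0 divide_le_eq power2_eq_square mult.assoc)
      qed simp
    qed
    show "((\<lambda>y. C * norm y) \<longlongrightarrow> 0) (at (0::'a))"
      by (rule tendsto_eq_intros | simp)+
  qed
  then show "((\<lambda>y. norm (moment_map c S y - moment_map c S 0 - A (y - 0)) / norm (y - 0)) \<longlongrightarrow> 0) (at 0 within UNIV)"
    by simp
qed

lemma continuous_moment_map: "continuous_on U (moment_map c S)"
proof -
  have "(\<Sum>\<beta>'\<in>S. c \<beta>' * exp (blinfun_apply \<beta>' \<tau>)) \<noteq> 0" for \<tau>
    using partition_sum_pos[of \<tau>] by (simp add: partition_sum_def)
  then show ?thesis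
    unfolding moment_map_def gibbs_weight_def by (intro continuous_intros) auto
qed

text \<open>
  The derivative \<open>A\<close> at \<open>0\<close> is invertible, so by Sussmann's open mapping theorem the image of a ball around \<open>0\<close> is a
  neighbourhood of \<open>m\<close>.
\<close>

lemma moment_map_surj_near_0:
  assumes "R > 0"
  obtains \<rho> where "\<rho> > 0" "\<And>y. norm y < \<rho> \<Longrightarrow> \<exists>\<tau>. norm \<tau> < R \<and> moment_map c S \<tau> = m + y"
proof -
  let ?f = "riesz \<circ> moment_map c S"
  have linRA: "linear (riesz \<circ> A)"
    by (intro linear_compose linear_A bounded_linear.linear[OF bounded_linear_riesz])
  have "inj (riesz \<circ> A)"
    using bij_A by (auto simp: inj_on_def riesz_inject bij_def)
  then obtain g where g: "linear g" "\<And>x. (riesz \<circ> A) (g x) = x"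
    using linear_injective_isomorphism[OF linRA] by metis
  have "?f 0 \<in> interior (?f ` ball 0 R)"
  proof (rule sussmann_open_mapping)
    show "open (UNIV :: 'a set)" "(0::'a) \<in> UNIV" "ball (0::'a) R \<subseteq> UNIV" "(0::'a) \<in> interior (ball 0 R)"
      using assms by (auto simp: interior_open)
    show "continuous_on UNIV ?f"
      by (intro continuous_on_compose continuous_moment_map linear_continuous_on bounded_linear_riesz)
    show "(?f has_derivative riesz \<circ> A) (at 0)"
      using bounded_linear.has_derivative[OF bounded_linear_riesz moment_map_has_derivative] by (simp add: o_def)
    show "bounded_linear g" using g(1) linear_conv_bounded_linear by blast
    show "(riesz \<circ> A) \<circ> g = id" using g(2) by (auto simp: fun_eq_iff)
  qed
  then obtain e where e: "e > 0" "ball (riesz m) e \<subseteq> ?f ` ball 0 R"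
    unfolding mem_interior by (auto simp: moment_map_0)
  obtain K where K: "K > 0" "\<And>y. norm (riesz y :: 'a) \<le> norm y * K"
    using bounded_linear.pos_bounded[OF bounded_linear_riesz[where 'a = 'a]] by blast
  show thesis
  proof (rule that[of "e / K"])
    show "e / K > 0" using e K by simp
    fix y :: "'a dual" assume y: "norm y < e / K"
    have "norm (riesz y :: 'a) \<le> norm y * K" by (rule K(2))
    also have "\<dots> < e" using y K(1) by (simp add: field_simps)
    finally have "riesz (m + y) \<in> ball (riesz m) e"
      using linear_add[OF bounded_linear.linear[OF bounded_linear_riesz], of m y] by (simp add: dist_norm)
    then obtain \<tau> where "\<tau> \<in> ball 0 R" "riesz (m + y) = riesz (moment_map c S \<tau>)"
      using e(2) by auto
    then show "\<exists>\<tau>. norm \<tau> < R \<and> moment_map c S \<tau> = m + y"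
      by (auto simp: riesz_inject)
  qed
qed

text \<open>
  If \<open>m + y\<close> is the moment at \<open>\<tau>\<close>, then \<open>delta_c\<close> is \<open>ln V + ln (centered_mgf \<tau>) - \<langle>y, \<tau>\<rangle>\<close>. Up to cubic order this is the
  quadratic polynomial \<open>\<langle>A \<tau>, \<tau>\<rangle>/2 - \<langle>y, \<tau>\<rangle>\<close>, whose critical point is \<open>w = A\<^sup>-\<^sup>1 y\<close>. As \<open>\<tau> - w = O(|y|\<^sup>2)\<close>, evaluating at
  \<open>\<tau>\<close> instead of \<open>w\<close> changes it only by \<open>O(|y|\<^sup>4)\<close>.
\<close>

lemma delta_expansion:
  assumes "R > 0"
  obtains \<rho> C where "\<rho> > 0" "C > 0"
    "\<And>y. norm y < \<rho> \<Longrightarrow> \<exists>\<tau>. moment_map c S \<tau> = m + y \<and> norm \<tau> < R \<and> norm \<tau> \<le> C * norm y \<and>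
        \<bar>delta_c c S (m + y) - ln (total_weight c S) + blinfun_apply y (inv A y) / 2\<bar> \<le> C * norm y ^ 3"
proof -
  obtain r C where r: "r > 0" "C > 0"
    and E1: "\<And>\<tau>. norm \<tau> \<le> r \<Longrightarrow> norm (moment_map c S \<tau> - m - A \<tau>) \<le> C * (norm \<tau>)\<^sup>2"
    and E2: "\<And>\<tau>. norm \<tau> \<le> r \<Longrightarrow> \<bar>ln (centered_mgf \<tau>) - blinfun_apply (A \<tau>) \<tau> / 2\<bar> \<le> C * norm \<tau> ^ 3"
    and E3: "\<And>\<tau>. norm (A \<tau>) \<le> C * norm \<tau>"
    using local_expansion by metis
  obtain \<kappa> where \<kappa>: "\<kappa> > 0" "\<And>y. blinfun_apply (A y) y \<ge> \<kappa> * (norm y)\<^sup>2"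
    using A_lower_bound by blast
  note A_ge = norm_A_lower_bound[OF \<kappa>]
  \<comment> \<open>on this ball the quadratic error is at most half of the linear growth of \<open>A\<close>\<close>
  define R' where "R' = min R (min r (\<kappa> / (2 * C)))"
  have R': "R' > 0" "R' \<le> R" "R' \<le> r" "2 * C * R' \<le> \<kappa>"
  proof -
    show "R' > 0" "R' \<le> R" "R' \<le> r" using assms r \<kappa>(1) by (auto simp: R'_def)
    have "R' \<le> \<kappa> / (2 * C)" by (simp add: R'_def)
    then show "2 * C * R' \<le> \<kappa>" using r(2) by (simp add: field_simps)
  qed
  obtain \<rho> where \<rho>: "\<rho> > 0" "\<And>y. norm y < \<rho> \<Longrightarrow> \<exists>\<tau>. norm \<tau> < R' \<and> moment_map c S \<tau> = m + y"
    using moment_map_surj_near_0[OF R'(1)] by blast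
  define C1 where "C1 = 2 / \<kappa>"
  define C2 where "C2 = C / \<kappa> * C1\<^sup>2"
  define C3 where "C3 = C * C1 ^ 3 + C * C2\<^sup>2"
  have C123: "C1 > 0" "C2 > 0" "C3 > 0" using r \<kappa> by (auto simp: C1_def C2_def C3_def intro!: add_pos_pos)
  show thesis
  proof (rule that[of "min 1 \<rho>" "max C1 C3"])
    show "min 1 \<rho> > 0" "max C1 C3 > 0" using \<rho>(1) C123 by auto
    fix y :: "'a dual" assume y: "norm y < min 1 \<rho>"
    then obtain \<tau> where \<tau>: "norm \<tau> < R'" "moment_map c S \<tau> = m + y" using \<rho>(2) by auto
    have \<tau>r: "norm \<tau> \<le> r" using \<tau>(1) R'(3) by simp
    have quad: "norm (y - A \<tau>) \<le> C * (norm \<tau>)\<^sup>2" using E1[OF \<tau>r] \<tau>(2) by simp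
    have \<tau>_le: "norm \<tau> \<le> C1 * norm y"
    proof -
      have "C * (norm \<tau>)\<^sup>2 \<le> \<kappa> / 2 * norm \<tau>"
      proof -
        have "C * norm \<tau> \<le> C * R'" using \<tau>(1) r(2) by (intro mult_left_mono) auto
        then have "C * norm \<tau> \<le> \<kappa> / 2" using R'(4) by linarith
        then have "C * norm \<tau> * norm \<tau> \<le> \<kappa> / 2 * norm \<tau>" by (rule mult_right_mono) simp
        then show ?thesis by (simp add: power2_eq_square mult.assoc)
      qed
      moreover have "norm (A \<tau>) \<le> norm y + norm (y - A \<tau>)"
        using norm_triangle_ineq4[of y "y - A \<tau>"] by simp
      ultimately have "\<kappa> / 2 * norm \<tau> \<le> norm y"
        using A_ge[of \<tau>] quad by simp
      then show ?thesis using \<kappa>(1) by (simp add: C1_def field_simps)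
    qed
    define w where "w = inv A y"
    have Aw: "A w = y" unfolding w_def using bij_A by (simp add: bij_is_surj surj_f_inv_f)
    define h where "h = \<tau> - w"
    have Ah: "A h = A \<tau> - y" unfolding h_def using linear_diff[OF linear_A] Aw by simp
    have h_le: "norm h \<le> C2 * (norm y)\<^sup>2"
    proof -
      have "\<kappa> * norm h \<le> C * (norm \<tau>)\<^sup>2"
        using A_ge[of h] quad by (simp add: Ah norm_minus_commute)
      also have "\<dots> \<le> C * (C1 * norm y)\<^sup>2"
        using \<tau>_le r(2) by (intro mult_left_mono power_mono) auto
      finally show ?thesis using \<kappa>(1) by (simp add: C2_def field_simps power_mult_distrib)
    qed
    have sym: "blinfun_apply (A u) v = blinfun_apply (A v) u" for u v
      by (simp add: A_apply mult_ac)
    have quad_eq: "blinfun_apply (A \<tau>) \<tau> / 2 - blinfun_apply y \<tau> = blinfun_apply (A h) h / 2 - blinfun_apply y w / 2"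
    proof -
      have t: "\<tau> = w + h" by (simp add: h_def)
      have "blinfun_apply (A \<tau>) \<tau> = blinfun_apply (A w) w + 2 * blinfun_apply (A w) h + blinfun_apply (A h) h"
        unfolding t using sym[of h w] by (simp add: linear_add[OF linear_A] blinfun.bilinear_simps)
      moreover have "X / 2 - (P + Q) = R / 2 - P / 2" if "X = P + 2 * Q + R" for X P Q R :: real
        using that by (simp add: field_simps)
      ultimately have "blinfun_apply (A \<tau>) \<tau> / 2 - (blinfun_apply (A w) w + blinfun_apply (A w) h)
          = blinfun_apply (A h) h / 2 - blinfun_apply (A w) w / 2"
        by blast
      moreover have "blinfun_apply y \<tau> = blinfun_apply (A w) w + blinfun_apply (A w) h"
        unfolding Aw by (simp only: t blinfun.add_right)
      ultimately show ?thesis by (simp only: Aw)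
    qed
    have "delta_c c S (m + y) = ln (total_weight c S) + ln (centered_mgf \<tau>) - blinfun_apply y \<tau>"
    proof -
      have "partition_sum \<tau> * exp (- blinfun_apply (m + y) \<tau>) = total_weight c S * centered_mgf \<tau> * exp (- blinfun_apply y \<tau>)"
        using total_weight_pos by (simp add: centered_mgf_eq blinfun.bilinear_simps exp_add exp_diff exp_minus field_simps)
      then show ?thesis
        unfolding exp_delta(2)[OF \<tau>(2)] using total_weight_pos centered_mgf_ge_1[of \<tau>]
        by (simp add: ln_mult)
    qed
    then have "\<bar>delta_c c S (m + y) - ln (total_weight c S) + blinfun_apply y (inv A y) / 2\<bar>
        = \<bar>(ln (centered_mgf \<tau>) - blinfun_apply (A \<tau>) \<tau> / 2) + blinfun_apply (A h) h / 2\<bar>"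
      using quad_eq by (simp add: w_def)
    also have "\<dots> \<le> C * norm \<tau> ^ 3 + \<bar>blinfun_apply (A h) h\<bar> / 2"
      using E2[OF \<tau>r] by linarith
    also have "\<dots> \<le> C * (C1 * norm y) ^ 3 + C * C2\<^sup>2 * norm y ^ 3"
    proof (rule add_mono)
      show "C * norm \<tau> ^ 3 \<le> C * (C1 * norm y) ^ 3"
        using \<tau>_le r(2) by (intro mult_left_mono power_mono) auto
      have "\<bar>blinfun_apply (A h) h\<bar> \<le> norm (A h) * norm h" using norm_blinfun[of "A h" h] by simp
      also have "\<dots> \<le> C * norm h * norm h" using E3[of h] by (intro mult_right_mono) auto
      also have "\<dots> = C * (norm h)\<^sup>2" by (simp add: power2_eq_square)
      also have "\<dots> \<le> C * (C2 * (norm y)\<^sup>2)\<^sup>2"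
        using h_le r(2) by (intro mult_left_mono power_mono) auto
      also have "\<dots> = C * C2\<^sup>2 * norm y ^ 4" by (simp add: power_mult_distrib flip: power_mult)
      also have "\<dots> \<le> C * C2\<^sup>2 * norm y ^ 3"
        using y r(2) by (intro mult_left_mono power_decreasing) auto
      finally show "\<bar>blinfun_apply (A h) h\<bar> / 2 \<le> C * C2\<^sup>2 * norm y ^ 3" by simp
    qed
    also have "\<dots> = C3 * norm y ^ 3" by (simp add: C3_def power_mult_distrib algebra_simps)
    also have "\<dots> \<le> max C1 C3 * norm y ^ 3" by (intro mult_right_mono) auto
    finally have fin: "\<bar>delta_c c S (m + y) - ln (total_weight c S) + blinfun_apply y (inv A y) / 2\<bar> \<le> max C1 C3 * norm y ^ 3" .
    have "C1 * norm y \<le> max C1 C3 * norm y" by (intro mult_right_mono) auto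
    then show "\<exists>\<tau>. moment_map c S \<tau> = m + y \<and> norm \<tau> < R \<and> norm \<tau> \<le> max C1 C3 * norm y \<and>
        \<bar>delta_c c S (m + y) - ln (total_weight c S) + blinfun_apply y (inv A y) / 2\<bar> \<le> max C1 C3 * norm y ^ 3"
      using \<tau> \<tau>_le R'(2) fin by (intro exI[of _ \<tau>]) auto
  qed
qed

text \<open>
  Supplies the uniform lower bound on the step probabilities that \<open>local_limit_theorem\<close> asks for.
\<close>

lemma gibbs_lower_bound:
  obtains R q where "R > 0" "q > 0" "\<And>\<tau> \<beta>. norm \<tau> < R \<Longrightarrow> \<beta> \<in> S \<Longrightarrow> gibbs_weight c S \<tau> \<beta> \<ge> q"
proof -
  have cont: "continuous (at 0) (\<lambda>\<tau>. gibbs_weight c S \<tau> \<beta>)" for \<beta>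
    using partition_sum_pos[of 0] unfolding gibbs_eq partition_sum_def by (intro continuous_intros) auto
  define q where "q = Min (base_weight ` S) / 2"
  have q: "q > 0" using finite_S S_nonempty base_weight(1) by (auto simp: q_def)
  have lt: "q < base_weight \<beta>" if "\<beta> \<in> S" for \<beta>
  proof -
    have "Min (base_weight ` S) \<le> base_weight \<beta>" using finite_S that by auto
    then show ?thesis using q by (simp add: q_def)
  qed
  have "\<forall>\<^sub>F \<tau> in nhds 0. \<forall>\<beta>\<in>S. gibbs_weight c S \<tau> \<beta> > q"
    using finite_S
  proof (intro eventually_ball_finite ballI)
    fix \<beta> assume \<beta>: "\<beta> \<in> S"
    have "((\<lambda>\<tau>. gibbs_weight c S \<tau> \<beta>) \<longlongrightarrow> base_weight \<beta>) (nhds 0)"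
      using cont[of \<beta>] tendsto_at_iff_tendsto_nhds[of "\<lambda>\<tau>. gibbs_weight c S \<tau> \<beta>" 0]
      by (simp add: base_weight_def continuous_at)
    then show "\<forall>\<^sub>F \<tau> in nhds 0. gibbs_weight c S \<tau> \<beta> > q"
      using lt[OF \<beta>] by (rule order_tendstoD)
  qed
  then obtain R where "R > 0" "\<And>\<tau>. dist \<tau> 0 < R \<Longrightarrow> \<forall>\<beta>\<in>S. gibbs_weight c S \<tau> \<beta> > q"
    unfolding eventually_nhds_metric by blast
  then show thesis using q that[of R q] by (auto intro: less_imp_le)
qed

end

section \<open>Lattice paths in coordinates\<close>

lemma group_closure_sum_mem:
  assumes "\<And>i. i \<in> I \<Longrightarrow> f i \<in> group_closure X"
  shows "sum f I \<in> group_closure X"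
  using assms by (induction I rule: infinite_finite_induct) (auto intro: group_closure_add)

lemma group_closure_of_int_scaleR:
  fixes x :: "'a::real_vector"
  assumes "x \<in> group_closure X"
  shows "of_int z *\<^sub>R x \<in> group_closure X"
proof -
  have nat: "of_nat n *\<^sub>R x \<in> group_closure X" for n
    by (induction n) (auto simp: scaleR_left_distrib intro: group_closure_add assms)
  show ?thesis
  proof (cases z)
    case (neg n)
    have "of_int z *\<^sub>R x = - (of_nat (Suc n) *\<^sub>R x)"
      unfolding neg scaleR_minus_left[symmetric] by simp
    then show ?thesis using nat[of "Suc n"] by (simp only: group_closure_minus_iff)
  qed (use nat in auto)
qed

text \<open>
  The map \<open>coord\<close> identifies the dual space with coordinate vectors and \<open>L\<^sup>*\<close> with integer vectors, so that \<open>S\<close>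
  becomes the step set of a \<open>lattice_walk\<close>; \<open>combination\<close> is the adjoint identification of the space itself.
\<close>

locale lattice_paths = exponential_family S c
  for S :: "'a::euclidean_space dual set" and c :: "'a dual \<Rightarrow> real" +
  fixes b :: "'n::finite \<Rightarrow> 'a" and L :: "'a set"
  assumes basis: "lattice_basis b L" and S_dual: "S \<subseteq> dual_lattice L"
begin

definition coord :: "'a dual \<Rightarrow> real^'n" where
  "coord \<beta> = (\<chi> i. blinfun_apply \<beta> (b i))"

definition combination :: "real^'n \<Rightarrow> 'a" where
  "combination t = (\<Sum>i\<in>UNIV. t $ i *\<^sub>R b i)"

lemma inner_coord: "coord \<beta> \<bullet> t = blinfun_apply \<beta> (combination t)"
  by (simp add: coord_def combination_def inner_vec_def blinfun.sum_right blinfun.bilinear_simps mult.commute)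

lemma coord_linear: "linear coord"
  by (rule linearI) (auto simp: coord_def vec_eq_iff blinfun.bilinear_simps)

lemma linear_combination_map: "linear combination"
  by (rule linearI) (auto simp: combination_def scaleR_left_distrib sum.distrib scaleR_sum_right)

lemma basis_facts: "inj b" "independent (range b)" "span (range b) = UNIV" "L = group_closure (range b)"
  using basis by (auto simp: lattice_basis_def)

lemma DIM_eq_CARD: "DIM('a) = CARD('n)"
proof -
  have "dim (UNIV :: 'a set) = card (range b)"
    using basis_facts(2,3) by (metis dim_span_eq_card_independent)
  then show ?thesis using basis_facts(1) by (simp add: card_image)
qed

lemma combination_axis: "combination (axis i 1) = b i"
proof -
  have "combination (axis i 1) = (\<Sum>j\<in>UNIV. if j = i then b j else 0)"
    unfolding combination_def by (intro sum.cong) (auto simp: axis_def)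
  then show ?thesis by simp
qed

lemma surj_combination: "surj combination"
proof -
  have "subspace (range combination)"
    using linear_combination_map subspace_UNIV linear_subspace_image by blast
  moreover have "range b \<subseteq> range combination"
    using combination_axis by (metis image_subsetI rangeI)
  ultimately have "span (range b) \<subseteq> range combination"
    using span_minimal by blast
  then show ?thesis using basis_facts(3) by auto
qed

lemma inj_combination: "inj combination"
proof (rule linear_surjective_imp_injective[OF linear_combination_map surj_combination])
  show "dim (UNIV :: 'a set) = dim (UNIV :: (real^'n) set)"
    by (simp add: DIM_eq_CARD)
qed

lemma coord_inject: "coord \<alpha> = coord \<beta> \<longleftrightarrow> \<alpha> = \<beta>"
proof
  assume eq: "coord \<alpha> = coord \<beta>"
  show "\<alpha> = \<beta>"
  proof (rule blinfun_eqI)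
    fix x
    obtain t where "x = combination t" using surj_combination by (metis surjD)
    then show "blinfun_apply \<alpha> x = blinfun_apply \<beta> x"
      using eq inner_coord by metis
  qed
qed simp

lemma coord_integer:
  assumes "\<beta> \<in> dual_lattice L"
  shows "coord \<beta> \<in> integer_vectors"
proof -
  have "b i \<in> L" for i unfolding basis_facts(4) by (auto intro: group_closure.base)
  then show ?thesis using assms by (auto simp: coord_def integer_vectors_def dual_lattice_def)
qed

sublocale lattice_walk S coord
proof
  show "finite S" by (rule finite_S)
  show "coord \<beta> \<in> integer_vectors" if "\<beta> \<in> S" for \<beta>
    using that S_dual coord_integer by blast
  show "t = 0" if "\<And>\<beta> \<beta>'. \<beta> \<in> S \<Longrightarrow> \<beta>' \<in> S \<Longrightarrow> (coord \<beta> - coord \<beta>') \<bullet> t = 0" for t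
  proof -
    have "combination t = 0"
    proof (rule separation)
      fix \<beta> \<beta>' assume "\<beta> \<in> S" "\<beta>' \<in> S"
      then show "blinfun_apply (\<beta> - \<beta>') (combination t) = 0"
        using that[of \<beta> \<beta>'] by (simp only: inner_coord inner_diff_left blinfun.diff_left)
    qed
    then have "combination t = combination 0"
      by (simp only: linear_0[OF linear_combination_map])
    then show "t = 0" using inj_combination by (simp only: inj_eq)
  qed
qed

lemma L_eq: "L = combination ` integer_vectors"
proof (intro equalityI subsetI)
  fix x assume "x \<in> L"
  then have "x \<in> group_closure (range b)" by (simp add: basis_facts(4))
  then show "x \<in> combination ` integer_vectors"
  proof induction
    case (base x)
    have "axis i 1 \<in> integer_vectors" for i :: 'n by (auto simp: integer_vectors_def axis_def)
    moreover have "(0::real^'n) \<in> integer_vectors" by (auto simp: integer_vectors_def)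
    ultimately have "b i \<in> combination ` integer_vectors" "0 \<in> combination ` integer_vectors" for i
      by (metis combination_axis imageI, metis linear_0[OF linear_combination_map] imageI)
    then show ?case using base by blast
  next
    case (diff x y)
    then obtain u v where "u \<in> integer_vectors" "v \<in> integer_vectors" "x = combination u" "y = combination v" by blast
    then have "x - y = combination (u - v)" "u - v \<in> integer_vectors"
      by (auto simp: linear_diff[OF linear_combination_map] integer_vectors_def)
    then show ?case by blast
  qed
next
  fix x assume "x \<in> combination ` integer_vectors"
  then obtain u where u: "u \<in> integer_vectors" "x = combination u" by blast
  have "u $ i *\<^sub>R b i \<in> group_closure (range b)" for i
  proof -
    obtain z where "u $ i = of_int z" using u(1) by (auto simp: integer_vectors_def elim: Ints_cases)
    then show ?thesis by (auto intro: group_closure_of_int_scaleR group_closure.base)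
  qed
  then show "x \<in> L" unfolding u(2) basis_facts(4) combination_def by (rule group_closure_sum_mem)
qed

lemma lattice_of_eq: "lattice_of S = combination ` periods"
proof -
  have 1: "x \<in> lattice_of S \<longleftrightarrow> (\<forall>\<beta>\<in>diff_set S. blinfun_apply \<beta> x \<in> \<int>)" for x
  proof
    assume x: "\<forall>\<beta>\<in>diff_set S. blinfun_apply \<beta> x \<in> \<int>"
    have "blinfun_apply \<beta> x \<in> \<int>" if "\<beta> \<in> group_closure (diff_set S)" for \<beta>
      using that by induction (use x in \<open>auto simp: blinfun.bilinear_simps\<close>)
    then show "x \<in> lattice_of S" by (auto simp: lattice_of_def predual_lattice_def)
  qed (auto simp: lattice_of_def predual_lattice_def intro: group_closure.base)
  have 2: "combination t \<in> lattice_of S \<longleftrightarrow> t \<in> periods" for t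
  proof -
    have "(coord \<alpha> - coord \<beta>) \<bullet> t = blinfun_apply (\<alpha> - \<beta>) (combination t)" for \<alpha> \<beta>
      by (simp add: inner_coord inner_diff_left blinfun.diff_left)
    then show ?thesis
      unfolding 1 periods_def diff_set_def by (simp only: mem_Collect_eq) blast
  qed
  show ?thesis
  proof (intro equalityI subsetI)
    fix x assume x: "x \<in> lattice_of S"
    obtain t where "x = combination t" using surj_combination by (metis surjD)
    then show "x \<in> combination ` periods" using x 2 by blast
  qed (use 2 in blast)
qed

lemma card_Pi_group: "card (Pi_group L S) = period_index"
proof -
  define r where "r = {(x, y). x \<in> periods \<and> y \<in> periods \<and> x - y \<in> integer_vectors}"
  define r' where "r' = {(x, y). x \<in> lattice_of S \<and> y \<in> lattice_of S \<and> x - y \<in> L}"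
  have cls: "r' `` {combination u} = combination ` (r `` {u})" if "u \<in> periods" for u
  proof -
    have "combination u - combination v \<in> L \<longleftrightarrow> u - v \<in> integer_vectors" for v
    proof -
      have "combination u - combination v = combination (u - v)"
        by (simp only: linear_diff[OF linear_combination_map])
      then show ?thesis by (simp only: L_eq inj_image_mem_iff[OF inj_combination])
    qed
    then show ?thesis
      unfolding r_def r'_def lattice_of_eq using that by (simp add: Image_def) blast
  qed
  have quotient_image: "X // R = (\<lambda>x. R `` {x}) ` X" for X :: "'z set" and R
    by (simp only: quotient_def UNION_singleton_eq_range)
  have "Pi_group L S = (\<lambda>x. r' `` {x}) ` lattice_of S"
    unfolding Pi_group_def r'_def[symmetric] by (rule quotient_image)
  also have "\<dots> = (\<lambda>u. combination ` (r `` {u})) ` periods"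
    unfolding lattice_of_eq image_image using cls by (intro image_cong) auto
  also have "\<dots> = (`) combination ` (periods // r)"
    unfolding quotient_image image_image ..
  finally have "Pi_group L S = (`) combination ` (periods // r)" .
  moreover have "inj_on ((`) combination) (periods // r)"
    using inj_combination by (simp add: inj_on_def inj_image_eq_iff)
  ultimately show ?thesis
    by (simp add: card_image period_index_def r_def)
qed

lemma period_index_pos: "period_index > 0"
proof -
  have "0 \<in> {u \<in> periods. 0 + u \<in> unit_cube}" by (auto simp: periods_def unit_cube_def)
  moreover have "finite {u \<in> periods. 0 + u \<in> unit_cube}"
  proof -
    obtain R where "\<And>u. u \<in> unit_cube \<Longrightarrow> norm (u :: real^'n) \<le> R"
      using bounded_unit_cube by (auto simp: bounded_iff)
    then show ?thesis
      by (intro finite_subset[OF _ finite_periods_norm_le[of R]]) auto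
  qed
  ultimately have "card {u \<in> periods. 0 + u \<in> unit_cube} > 0"
    unfolding card_gt_0_iff by blast
  then show ?thesis by (simp only: card_periods_translate_in_unit_cube)
qed

lemma mean_gibbs: "mean (gibbs_weight c S \<tau>) = coord (moment_map c S \<tau>)"
  unfolding mean_def moment_map_def
  by (simp add: linear_sum[OF coord_linear] linear_scale[OF coord_linear])

lemma dual_det_eq: "dual_det b A = det (covariance base_weight)"
proof -
  have "blinfun_apply (A (b j)) (b i) = covariance base_weight $ i $ j" for i j
  proof -
    have "mean base_weight = coord m" unfolding base_weight_def mean_gibbs moment_map_0 ..
    then show ?thesis
      unfolding A_map_def moment_map_inv_eq[OF moment_map_0] base_weight_def[symmetric] covariance_def
      by (simp add: tensor_square_def blinfun.bilinear_simps blinfun.sum_left coord_def mult_ac)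
  qed
  then show ?thesis by (simp add: dual_det_def vec_eq_iff[symmetric] vec_lambda_eta)
qed

lemma weighted_paths_eq: "weighted_paths w S N \<gamma> = path_weight w N (coord \<gamma>)"
proof -
  have "(\<Sum>j=1..N. coord (q j)) = coord \<gamma> \<longleftrightarrow> (\<Sum>j=1..N. q j) = \<gamma>" for q
    by (simp add: linear_sum[OF coord_linear, symmetric] coord_inject)
  then show ?thesis by (simp add: weighted_paths_def path_weight_def)
qed

text \<open>
  All paths counted have the same endpoint, so the product of the tilting factors along a path is the same for all.
\<close>

lemma weighted_paths_tilt:
  "weighted_paths c S N \<gamma> = partition_sum \<tau> ^ N * exp (- blinfun_apply \<gamma> \<tau>) * weighted_paths (gibbs_weight c S \<tau>) S N \<gamma>"
  unfolding weighted_paths_def sum_distrib_left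
proof (rule sum.cong[OF refl])
  fix q assume "q \<in> {p \<in> {1..N} \<rightarrow>\<^sub>E S. (\<Sum>i=1..N. p i) = \<gamma>}"
  then have \<gamma>: "(\<Sum>i=1..N. q i) = \<gamma>" by simp
  have "(\<Prod>i=1..N. gibbs_weight c S \<tau> (q i)) = (\<Prod>i=1..N. c (q i)) * exp (blinfun_apply \<gamma> \<tau>) / partition_sum \<tau> ^ N"
    by (simp add: gibbs_eq prod_dividef prod.distrib exp_sum[symmetric] \<gamma>[symmetric] blinfun.sum_left)
  then show "(\<Prod>i=1..N. c (q i)) = partition_sum \<tau> ^ N * exp (- blinfun_apply \<gamma> \<tau>) * (\<Prod>i=1..N. gibbs_weight c S \<tau> (q i))"
    using partition_sum_pos[of \<tau>] by (simp add: exp_minus)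
qed

lemma gibbs_differentiable: "(\<lambda>\<tau>. gibbs_weight c S \<tau> \<beta>) differentiable at x"
proof -
  have numerator: "(\<lambda>\<tau>. c \<beta> * exp (blinfun_apply \<beta> \<tau>)) differentiable at x" for \<beta>
  proof -
    have "((\<lambda>\<tau>. c \<beta> * exp (blinfun_apply \<beta> \<tau>)) has_derivative (\<lambda>h. c \<beta> * (exp (blinfun_apply \<beta> x) * blinfun_apply \<beta> h))) (at x)"
      by (auto intro!: derivative_eq_intros bounded_linear_imp_has_derivative[OF blinfun.bounded_linear_right] simp: mult_ac)
    then show ?thesis by (auto simp: differentiable_def)
  qed
  show ?thesis
    using partition_sum_pos[of x] unfolding gibbs_eq partition_sum_def
    by (intro differentiable_divide differentiable_sum ballI numerator finite_S) auto
qed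

lemma dual_det_pos: "dual_det b A > 0"
proof -
  obtain q where "q > 0" "\<And>\<beta>. \<beta> \<in> S \<Longrightarrow> base_weight \<beta> \<ge> q"
    using gibbs_lower_bound unfolding base_weight_def by (metis norm_zero)
  then show ?thesis
    unfolding dual_det_eq using base_weight(2)
    by (intro positive_definite_det_pos transpose_covariance covariance_pos)
qed

text \<open>
  Bounds the error made by evaluating the determinant at \<open>0\<close> instead of at the tilt \<open>\<tau>\<close>.
\<close>

lemma det_covariance_lipschitz:
  obtains \<delta> C where "\<delta> > 0"
    "\<And>\<tau>. norm \<tau> < \<delta> \<Longrightarrow> \<bar>1 / sqrt (det (covariance (gibbs_weight c S \<tau>))) - 1 / sqrt (det (covariance base_weight))\<bar> \<le> C * norm \<tau>"
proof -
  let ?D = "\<lambda>\<tau>. det (covariance (gibbs_weight c S \<tau>))"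
  have mean: "(\<lambda>\<tau>. mean (gibbs_weight c S \<tau>) $ i) differentiable at 0" for i
    unfolding mean_def sum_component vector_scaleR_component real_scaleR_def
    by (intro differentiable_sum ballI differentiable_mult gibbs_differentiable) (use finite_S in auto)
  have entry: "(\<lambda>\<tau>. covariance (gibbs_weight c S \<tau>) $ i $ j) differentiable at 0" for i j
    unfolding covariance_def vec_lambda_beta
    by (intro differentiable_diff differentiable_sum ballI differentiable_mult gibbs_differentiable mean) (use finite_S in auto)
  have D: "?D differentiable at 0"
    unfolding det_def
    by (intro differentiable_sum ballI differentiable_mult differentiable_prod_real entry) (auto simp: finite_permutations intro: finite_permutations)
  have pos: "?D 0 > 0"
    using dual_det_pos by (simp add: dual_det_eq base_weight_def)
  have "(\<lambda>x. 1 / sqrt x) differentiable at (?D 0)"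
  proof -
    have "((\<lambda>x. 1 / sqrt x) has_field_derivative (- (inverse (sqrt (?D 0)) / 2) / (sqrt (?D 0) * sqrt (?D 0)))) (at (?D 0))"
      using pos by (auto intro!: derivative_eq_intros)
    then show ?thesis by (auto simp: differentiable_def has_field_derivative_def)
  qed
  then have "(\<lambda>\<tau>. 1 / sqrt (?D \<tau>)) differentiable at 0"
    using differentiable_chain_at[OF D] by (simp add: o_def)
  then show thesis
  proof (rule differentiable_imp_local_lipschitz)
    fix \<delta> C :: real
    assume "\<delta> > 0" "\<And>\<tau>. norm (\<tau> - 0) < \<delta> \<Longrightarrow> \<bar>1 / sqrt (?D \<tau>) - 1 / sqrt (?D 0)\<bar> \<le> C * norm (\<tau> - 0)"
    then show thesis using that[of \<delta> C] by (simp add: base_weight_def)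
  qed
qed

definition main_term :: "nat \<Rightarrow> 'a dual \<Rightarrow> real" where
  "main_term N \<gamma> = (2 * pi * real N) powr (- (real DIM('a) / 2))
     * (real (card (Pi_group L S)) * exp (real N * delta_c c S ((1 / real N) *\<^sub>R \<gamma>))
        / sqrt (dual_det b A))"

text \<open>
  Combines tilting, the local limit theorem for the tilted walk and the local analysis of the tilt; the two errors
  \<open>|\<gamma>/N - m|\<close> and \<open>1/N\<close> come from the determinant and from the local limit theorem.
\<close>

lemma weighted_paths_uniform_asymptotics:
  obtains \<rho> C where "\<rho> > 0" "C \<ge> 0"
    "\<And>N \<gamma>. N \<ge> 1 \<Longrightarrow> norm ((1 / real N) *\<^sub>R \<gamma> - m) < \<rho> \<Longrightarrow> weighted_paths c S N \<gamma> \<noteq> 0 \<Longrightarrow>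
       \<exists>e. \<bar>e\<bar> \<le> C * (norm ((1 / real N) *\<^sub>R \<gamma> - m) + 1 / real N) \<and>
         weighted_paths c S N \<gamma> = main_term N \<gamma> * (1 + e)"
    "\<And>y. norm y < \<rho> \<Longrightarrow>
       \<bar>delta_c c S (m + y) - ln (total_weight c S) + blinfun_apply y (inv A y) / 2\<bar> \<le> C * norm y ^ 3"
proof -
  let ?h = "real CARD('n) / 2"
  obtain R0 q where R0: "R0 > 0" and q: "q > 0" "\<And>\<tau> \<beta>. norm \<tau> < R0 \<Longrightarrow> \<beta> \<in> S \<Longrightarrow> gibbs_weight c S \<tau> \<beta> \<ge> q"
    using gibbs_lower_bound by metis
  obtain \<delta>0 C0 where \<delta>0: "\<delta>0 > 0"
    and lip: "\<And>\<tau>. norm \<tau> < \<delta>0 \<Longrightarrow> \<bar>1 / sqrt (det (covariance (gibbs_weight c S \<tau>))) - 1 / sqrt (det (covariance base_weight))\<bar> \<le> C0 * norm \<tau>"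
    using det_covariance_lipschitz by metis
  obtain C1 where lclt: "\<And>p N. (\<Sum>\<beta>\<in>S. p \<beta>) = 1 \<Longrightarrow> (\<And>\<beta>. \<beta> \<in> S \<Longrightarrow> p \<beta> \<ge> q) \<Longrightarrow> N \<ge> 1 \<Longrightarrow>
      (\<exists>r \<in> {1..N} \<rightarrow>\<^sub>E S. (\<Sum>j=1..N. coord (r j)) = real N *\<^sub>R mean p) \<Longrightarrow>
      \<bar>path_weight p N (real N *\<^sub>R mean p) - real period_index * (2 * pi * real N) powr (- ?h) / sqrt (det (covariance p))\<bar>
      \<le> C1 * real N powr (- ?h - 1)"
    using local_limit_theorem[OF q(1)] by metis
  obtain \<rho> C2 where \<rho>: "\<rho> > 0" "C2 > 0"
    and inv: "\<And>y. norm y < \<rho> \<Longrightarrow> \<exists>\<tau>. moment_map c S \<tau> = m + y \<and> norm \<tau> < min R0 \<delta>0 \<and> norm \<tau> \<le> C2 * norm y \<and>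
        \<bar>delta_c c S (m + y) - ln (total_weight c S) + blinfun_apply y (inv A y) / 2\<bar> \<le> C2 * norm y ^ 3"
    using delta_expansion[of "min R0 \<delta>0"] R0 \<delta>0 by (metis min_less_iff_conj)
  define P where "P = real period_index"
  define D0 where "D0 = 1 / sqrt (dual_det b A)"
  have P: "P > 0" using period_index_pos by (simp add: P_def)
  have D0: "D0 > 0" using dual_det_pos by (simp add: D0_def)
  define K1 where "K1 = \<bar>C1\<bar> * (2 * pi) powr ?h / (P * D0)"
  define K2 where "K2 = \<bar>C0\<bar> * C2 / D0"
  define C where "C = max C2 (max K1 K2)"
  have C: "C \<ge> C2" "C \<ge> K1" "C \<ge> K2" by (auto simp: C_def)
  show thesis
  proof (rule that[OF \<rho>(1)])
    show "C \<ge> 0" using C(1) \<rho>(2) by simp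
    show "\<bar>delta_c c S (m + y) - ln (total_weight c S) + blinfun_apply y (inv A y) / 2\<bar> \<le> C * norm y ^ 3"
      if y: "norm y < \<rho>" for y
    proof -
      have "C2 * norm y ^ 3 \<le> C * norm y ^ 3" using C(1) by (intro mult_right_mono) auto
      then show ?thesis using inv[OF y] by fastforce
    qed
    fix N :: nat and \<gamma> :: "'a dual"
    assume N: "N \<ge> 1" and near: "norm ((1 / real N) *\<^sub>R \<gamma> - m) < \<rho>" and nz: "weighted_paths c S N \<gamma> \<noteq> 0"
    define y where "y = (1 / real N) *\<^sub>R \<gamma> - m"
    obtain \<tau> where \<tau>: "moment_map c S \<tau> = m + y" "norm \<tau> < R0" "norm \<tau> < \<delta>0" "norm \<tau> \<le> C2 * norm y"
      using inv[of y] near by (auto simp: y_def)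
    have \<mu>: "moment_map c S \<tau> = (1 / real N) *\<^sub>R \<gamma>" using \<tau>(1) by (simp add: y_def)
    define p where "p = gibbs_weight c S \<tau>"
    have g: "real N *\<^sub>R mean p = coord \<gamma>"
      using N unfolding p_def mean_gibbs \<mu> linear_scale[OF coord_linear] by simp
    have "\<exists>r \<in> {1..N} \<rightarrow>\<^sub>E S. (\<Sum>j=1..N. coord (r j)) = real N *\<^sub>R mean p"
    proof (rule ccontr)
      assume none: "\<not> ?thesis"
      have "(\<Sum>j=1..N. r j) \<noteq> \<gamma>" if "r \<in> {1..N} \<rightarrow>\<^sub>E S" for r
        using none that unfolding g linear_sum[OF coord_linear, symmetric] by blast
      then have "{r \<in> {1..N} \<rightarrow>\<^sub>E S. (\<Sum>j=1..N. r j) = \<gamma>} = {}" by blast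
      then show False using nz unfolding weighted_paths_def by (simp only: sum.empty)
    qed
    then have est: "\<bar>path_weight p N (coord \<gamma>) - P * (2 * pi * real N) powr (- ?h) / sqrt (det (covariance p))\<bar> \<le> C1 * real N powr (- ?h - 1)"
      unfolding g[symmetric] P_def using q(2)[OF \<tau>(2)] sum_gibbs N by (intro lclt) (auto simp: p_def)
    define T where "T = (2 * pi * real N) powr (- ?h)"
    have T: "T > 0" using N by (simp add: T_def)
    define D where "D = 1 / sqrt (det (covariance p))"
    define e where "e = path_weight p N (coord \<gamma>) / (P * T * D0) - 1"
    have "exp (real N * delta_c c S ((1 / real N) *\<^sub>R \<gamma>)) = partition_sum \<tau> ^ N * exp (- blinfun_apply \<gamma> \<tau>)"
    proof -
      have "exp (real N * delta_c c S ((1 / real N) *\<^sub>R \<gamma>)) = (partition_sum \<tau> * exp (- blinfun_apply ((1 / real N) *\<^sub>R \<gamma>) \<tau>)) ^ N"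
        unfolding exp_of_nat_mult exp_delta(1)[OF \<mu>] ..
      also have "\<dots> = partition_sum \<tau> ^ N * exp (real N * (- blinfun_apply ((1 / real N) *\<^sub>R \<gamma>) \<tau>))"
        unfolding power_mult_distrib exp_of_nat_mult ..
      also have "real N * (- blinfun_apply ((1 / real N) *\<^sub>R \<gamma>) \<tau>) = - blinfun_apply \<gamma> \<tau>"
        using N by (simp add: blinfun.scaleR_left)
      finally show ?thesis .
    qed
    then have W: "weighted_paths c S N \<gamma> = exp (real N * delta_c c S ((1 / real N) *\<^sub>R \<gamma>)) * path_weight p N (coord \<gamma>)"
      unfolding weighted_paths_tilt[of N \<gamma> \<tau>] p_def weighted_paths_eq[of "gibbs_weight c S \<tau>"] by simp
    have "path_weight p N (coord \<gamma>) = P * T * D0 * (1 + e)"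
      using P T D0 by (simp add: e_def)
    then have eq: "weighted_paths c S N \<gamma> = main_term N \<gamma> * (1 + e)"
      unfolding W by (simp add: main_term_def T_def D0_def P_def card_Pi_group DIM_eq_CARD)
    have "e = (path_weight p N (coord \<gamma>) - P * T * D) / (P * T * D0) + (D - D0) / D0"
      using P T D0 by (simp add: e_def field_simps)
    then have "\<bar>e\<bar> \<le> \<bar>path_weight p N (coord \<gamma>) - P * T * D\<bar> / (P * T * D0) + \<bar>D - D0\<bar> / D0"
      using P T D0 abs_triangle_ineq[of "(path_weight p N (coord \<gamma>) - P * T * D) / (P * T * D0)" "(D - D0) / D0"]
      by (simp add: abs_mult)
    also have "\<dots> \<le> (\<bar>C1\<bar> * real N powr (- ?h - 1)) / (P * T * D0) + (\<bar>C0\<bar> * (C2 * norm y)) / D0"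
    proof (intro add_mono divide_right_mono)
      have "\<bar>path_weight p N (coord \<gamma>) - P * T * D\<bar> \<le> C1 * real N powr (- ?h - 1)"
        using est by (simp add: T_def D_def)
      also have "\<dots> \<le> \<bar>C1\<bar> * real N powr (- ?h - 1)" by (intro mult_right_mono) auto
      finally show "\<bar>path_weight p N (coord \<gamma>) - P * T * D\<bar> \<le> \<bar>C1\<bar> * real N powr (- ?h - 1)" .
      have "\<bar>D - D0\<bar> \<le> C0 * norm \<tau>"
        using lip[OF \<tau>(3)] by (simp add: D_def D0_def p_def dual_det_eq)
      also have "\<dots> \<le> \<bar>C0\<bar> * norm \<tau>" by (intro mult_right_mono) auto
      also have "\<dots> \<le> \<bar>C0\<bar> * (C2 * norm y)" using \<tau>(4) by (intro mult_left_mono) auto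
      finally show "\<bar>D - D0\<bar> \<le> \<bar>C0\<bar> * (C2 * norm y)" .
    qed (use P T D0 in auto)
    also have "(\<bar>C1\<bar> * real N powr (- ?h - 1)) / (P * T * D0) = K1 * (1 / real N)"
    proof -
      have "T = (2 * pi) powr (- ?h) * real N powr (- ?h)"
        using N by (simp add: T_def powr_mult)
      moreover have "real N powr (- ?h - 1) = real N powr (- ?h) / real N"
        using N by (simp add: powr_diff)
      moreover have "(2 * pi) powr (- ?h) = 1 / (2 * pi) powr ?h" by (simp add: powr_minus_divide)
      ultimately show ?thesis using N P D0 by (simp add: K1_def)
    qed
    also have "(\<bar>C0\<bar> * (C2 * norm y)) / D0 = K2 * norm y" by (simp add: K2_def)
    also have "K1 * (1 / real N) + K2 * norm y \<le> C * (1 / real N) + C * norm y"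
      using C by (intro add_mono mult_right_mono) auto
    finally have "\<bar>e\<bar> \<le> C * (norm y + 1 / real N)" by (simp add: distrib_left add.commute)
    then show "\<exists>e. \<bar>e\<bar> \<le> C * (norm ((1 / real N) *\<^sub>R \<gamma> - m) + 1 / real N) \<and>
         weighted_paths c S N \<gamma> = main_term N \<gamma> * (1 + e)"
      using eq y_def by blast
  qed
qed

end

section \<open>Asymptotics of the number of lattice paths\<close>

theorem theorem9:
  fixes b :: "'n::finite \<Rightarrow> 'a::euclidean_space"
    and L :: "'a set"
    and S :: "'a dual set"
    and c :: "'a dual \<Rightarrow> real"
    and s :: real
    and \<gamma> :: "nat \<Rightarrow> 'a dual"
    and d :: "nat \<Rightarrow> 'a dual"
    and A :: "'a \<Rightarrow> 'a dual"
  assumes L: "lattice_basis b L"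
    and S: "finite S" "card S \<ge> 2" "S \<subseteq> dual_lattice L" "span (diff_set S) = UNIV"
    and c: "\<And>\<beta>. \<beta> \<in> S \<Longrightarrow> c \<beta> > 0"
    and A: "A = A_map c S (barycenter c S)"
    and s: "0 \<le> s" "s < 1"
    and \<gamma>: "\<forall>\<^sub>F N in sequentially. \<gamma> N \<in> (\<lambda>x. real N *\<^sub>R x) ` (convex hull S) \<inter> dual_lattice L"
    and nz: "\<forall>\<^sub>F N in sequentially. weighted_paths c S N (\<gamma> N) \<noteq> 0"
    and \<gamma>_eq: "\<And>N. \<gamma> N = real N *\<^sub>R barycenter c S + d N"
    and d: "(\<lambda>N. norm (d N)) \<in> O(\<lambda>N. real N powr s)"
  shows
    "(\<exists>\<epsilon>. \<epsilon> \<in> O(\<lambda>N. real N powr (- (1 - s))) \<and>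
        (\<forall>\<^sub>F N in sequentially.
           weighted_paths c S N (\<gamma> N) =
             (2 * pi * real N) powr (- (real DIM('a) / 2))
             * (real (card (Pi_group L S)) * exp (real N * delta_c c S ((1 / real N) *\<^sub>R \<gamma> N))
                / sqrt (dual_det b A))
             * (1 + \<epsilon> N))) \<and>
     (s \<le> 2 / 3 \<longrightarrow> (\<lambda>N. norm (d N)) \<in> o(\<lambda>N. real N powr s) \<longrightarrow>
      (\<exists>\<epsilon>. (s \<le> 1 / 2 \<longrightarrow> \<epsilon> \<in> O(\<lambda>N. real N powr (- (1 - s)))) \<and>
        (1 / 2 < s \<longrightarrow> \<epsilon> \<in> o(\<lambda>N. real N powr (3 * s - 2))) \<and>
        (\<forall>\<^sub>F N in sequentially.
           weighted_paths c S N (\<gamma> N) =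
             (2 * pi * real N) powr (- (real DIM('a) / 2))
             * (real (card (Pi_group L S)) * total_weight c S ^ N
                * exp (- (blinfun_apply (d N) (inv A (d N)) / (2 * real N)))
                / sqrt (dual_det b A))
             * (1 + \<epsilon> N))))"
proof -
  have "S \<noteq> {}" using S(2) by auto
  then interpret lattice_paths S c b L
    using L S c by unfold_locales auto
  let ?m = "barycenter c S"
  obtain \<rho> C where \<rho>: "\<rho> > 0" and C: "C \<ge> 0"
    and main_est: "\<And>N \<gamma>. N \<ge> 1 \<Longrightarrow> norm ((1 / real N) *\<^sub>R \<gamma> - ?m) < \<rho> \<Longrightarrow> weighted_paths c S N \<gamma> \<noteq> 0 \<Longrightarrow>
       \<exists>e. \<bar>e\<bar> \<le> C * (norm ((1 / real N) *\<^sub>R \<gamma> - ?m) + 1 / real N) \<and>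
         weighted_paths c S N \<gamma> = main_term N \<gamma> * (1 + e)"
    and delta_est: "\<And>y. norm y < \<rho> \<Longrightarrow>
       \<bar>delta_c c S (?m + y) - ln (total_weight c S) + blinfun_apply y (inv A y) / 2\<bar> \<le> C * norm y ^ 3"
    unfolding A using weighted_paths_uniform_asymptotics by metis
  define y where "y N = (1 / real N) *\<^sub>R d N" for N
  have y_eq: "(1 / real N) *\<^sub>R \<gamma> N = ?m + y N" if "N \<ge> 1" for N
    using that by (simp add: \<gamma>_eq y_def scaleR_add_right)
  have norm_y: "norm (y N) = norm (d N) / real N" for N
    by (simp add: y_def)
  obtain c0 where c0: "c0 > 0" and d_le: "\<forall>\<^sub>F N in sequentially. norm (norm (d N)) \<le> c0 * norm (real N powr s)"
    using landau_o.bigE[OF d] by blast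
  have ev1: "\<forall>\<^sub>F N::nat in sequentially. N \<ge> 1" by (rule eventually_ge_at_top)
  have y_le: "\<forall>\<^sub>F N in sequentially. norm (y N) \<le> c0 * real N powr (s - 1)"
    using d_le ev1
  proof eventually_elim
    case (elim N)
    then have "norm (d N) / real N \<le> c0 * real N powr s / real N" by (intro divide_right_mono) auto
    then show ?case using elim(2) by (simp add: norm_y powr_diff)
  qed
  have "((\<lambda>N. c0 * real N powr (s - 1)) \<longlongrightarrow> c0 * 0) sequentially"
    using s(2) by (intro tendsto_mult tendsto_const tendsto_neg_powr filterlim_real_sequentially) auto
  then have "\<forall>\<^sub>F N in sequentially. c0 * real N powr (s - 1) < \<rho>"
    using \<rho> by (intro order_tendstoD(2)[of _ 0]) auto
  with y_le have y_small: "\<forall>\<^sub>F N in sequentially. norm (y N) < \<rho>"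
    by eventually_elim simp
  define G where "G N = main_term N (\<gamma> N)" for N
  define \<epsilon> where "\<epsilon> N = weighted_paths c S N (\<gamma> N) / G N - 1" for N
  have \<epsilon>: "\<forall>\<^sub>F N in sequentially. \<bar>\<epsilon> N\<bar> \<le> C * (norm (y N) + 1 / real N) \<and> weighted_paths c S N (\<gamma> N) = G N * (1 + \<epsilon> N)"
    using y_small nz ev1
  proof eventually_elim
    case (elim N)
    then obtain e where e: "\<bar>e\<bar> \<le> C * (norm (y N) + 1 / real N)" "weighted_paths c S N (\<gamma> N) = G N * (1 + e)"
      using main_est[of N "\<gamma> N"] by (auto simp: y_eq G_def)
    then have "G N \<noteq> 0" using elim(2) by auto
    then have "\<epsilon> N = e" using e(2) by (simp add: \<epsilon>_def)
    then show ?case using e by simp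
  qed
  have \<epsilon>_O: "\<epsilon> \<in> O(\<lambda>N. real N powr (- (1 - s)))"
  proof (rule landau_o.bigI)
    show "C * (c0 + 1) + 1 > 0" using C c0 by (simp add: add_nonneg_pos)
    show "\<forall>\<^sub>F N in sequentially. norm (\<epsilon> N) \<le> (C * (c0 + 1) + 1) * norm (real N powr (- (1 - s)))"
      using \<epsilon> y_le ev1
    proof eventually_elim
      case (elim N)
      have "1 / real N = real N powr (- 1)" using elim(3) by (simp add: powr_minus_divide)
      also have "\<dots> \<le> real N powr (s - 1)" using elim(3) s(1) by (intro powr_mono) auto
      finally have "norm (y N) + 1 / real N \<le> (c0 + 1) * real N powr (s - 1)"
        using elim(2) by (simp add: distrib_right)
      then have "C * (norm (y N) + 1 / real N) \<le> C * ((c0 + 1) * real N powr (s - 1))"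
        using C by (rule mult_left_mono)
      also have "\<dots> \<le> (C * (c0 + 1) + 1) * real N powr (s - 1)"
        by (simp add: distrib_right mult.assoc)
      finally show ?case using elim(1) by simp
    qed
  qed
  \<comment> \<open>the error exponent of the Gaussian approximation of \<open>exp (N * delta_c)\<close>\<close>
  define R where "R N = real N * (delta_c c S ((1 / real N) *\<^sub>R \<gamma> N) - ln (total_weight c S))
      + blinfun_apply (d N) (inv A (d N)) / (2 * real N)" for N
  have R_le: "\<forall>\<^sub>F N in sequentially. \<bar>R N\<bar> \<le> C * (norm (d N) ^ 3 / (real N)\<^sup>2)"
    using y_small ev1
  proof eventually_elim
    case (elim N)
    have "inv A (y N) = (1 / real N) *\<^sub>R inv A (d N)"
    proof -
      have "A ((1 / real N) *\<^sub>R inv A (d N)) = y N"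
        unfolding A using linear_scale[OF linear_A] bij_A by (simp add: y_def bij_is_surj surj_f_inv_f)
      then show ?thesis
        unfolding A using bij_A by (metis bij_inv_eq_iff)
    qed
    then have "real N * (blinfun_apply (y N) (inv A (y N)) / 2) = blinfun_apply (d N) (inv A (d N)) / (2 * real N)"
      using elim(2) by (simp add: y_def blinfun.bilinear_simps)
    then have "R N = real N * (delta_c c S (?m + y N) - ln (total_weight c S) + blinfun_apply (y N) (inv A (y N)) / 2)"
      using elim(2) by (simp add: R_def y_eq distrib_left)
    then have "\<bar>R N\<bar> = real N * \<bar>delta_c c S (?m + y N) - ln (total_weight c S) + blinfun_apply (y N) (inv A (y N)) / 2\<bar>"
      by (simp add: abs_mult)
    also have "\<dots> \<le> real N * (C * norm (y N) ^ 3)"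
      using delta_est[OF elim(1)] by (intro mult_left_mono) auto
    also have "\<dots> = C * (norm (d N) ^ 3 / (real N)\<^sup>2)"
      using elim(2) by (simp add: norm_y power_divide eval_nat_numeral)
    finally show ?case .
  qed
  define \<epsilon>' where "\<epsilon>' N = (1 + \<epsilon> N) * exp (R N) - 1" for N
  have second: "\<forall>\<^sub>F N in sequentially.
           weighted_paths c S N (\<gamma> N) =
             (2 * pi * real N) powr (- (real DIM('a) / 2))
             * (real (card (Pi_group L S)) * total_weight c S ^ N
                * exp (- (blinfun_apply (d N) (inv A (d N)) / (2 * real N)))
                / sqrt (dual_det b A))
             * (1 + \<epsilon>' N)"
    using \<epsilon>
  proof eventually_elim
    case (elim N)
    have "real N * delta_c c S ((1 / real N) *\<^sub>R \<gamma> N)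
        = real N * ln (total_weight c S) + (- (blinfun_apply (d N) (inv A (d N)) / (2 * real N))) + R N"
      by (simp add: R_def right_diff_distrib)
    then have "exp (real N * delta_c c S ((1 / real N) *\<^sub>R \<gamma> N))
        = total_weight c S ^ N * exp (- (blinfun_apply (d N) (inv A (d N)) / (2 * real N))) * exp (R N)"
      using total_weight_pos by (simp only: exp_add exp_of_nat_mult exp_ln)
    then show ?case using elim by (simp add: G_def main_term_def A \<epsilon>'_def mult_ac)
  qed
  have "\<exists>\<epsilon>. (s \<le> 1 / 2 \<longrightarrow> \<epsilon> \<in> O(\<lambda>N. real N powr (- (1 - s)))) \<and>
        (1 / 2 < s \<longrightarrow> \<epsilon> \<in> o(\<lambda>N. real N powr (3 * s - 2))) \<and>
        (\<forall>\<^sub>F N in sequentially.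
           weighted_paths c S N (\<gamma> N) =
             (2 * pi * real N) powr (- (real DIM('a) / 2))
             * (real (card (Pi_group L S)) * total_weight c S ^ N
                * exp (- (blinfun_apply (d N) (inv A (d N)) / (2 * real N)))
                / sqrt (dual_det b A))
             * (1 + \<epsilon> N))"
    if s23: "s \<le> 2 / 3" and d_o: "(\<lambda>N. norm (d N)) \<in> o(\<lambda>N. real N powr s)"
  proof (intro exI[of _ \<epsilon>'] conjI impI second)
    have R_o: "R \<in> o(\<lambda>N. real N powr (3 * s - 2))"
    proof -
      have "R \<in> O(\<lambda>N. norm (d N) ^ 3 / (real N)\<^sup>2)"
        by (rule bigoI[of _ C]) (use R_le in \<open>auto elim: eventually_mono\<close>)
      also have "(\<lambda>N. norm (d N) ^ 3 / (real N)\<^sup>2) \<in> o(\<lambda>N. (real N powr s) ^ 3 / (real N)\<^sup>2)"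
        by (intro landau_o.small.divide_right landau_o.small_power d_o eventually_mono[OF ev1]) auto
      also have "(\<lambda>N. (real N powr s) ^ 3 / (real N)\<^sup>2) \<in> \<Theta>(\<lambda>N. real N powr (3 * s - 2))"
      proof (intro bigthetaI_cong eventually_mono[OF ev1])
        fix N :: nat assume N: "N \<ge> 1"
        then have "(real N powr s) ^ 3 = real N powr (3 * s)"
          by (simp add: powr_powr mult.commute flip: powr_realpow)
        then show "(real N powr s) ^ 3 / (real N)\<^sup>2 = real N powr (3 * s - 2)"
          using N by (simp add: powr_diff)
      qed
      finally show ?thesis .
    qed
    have R_le2: "\<forall>\<^sub>F N in sequentially. \<bar>R N\<bar> \<le> real N powr (3 * s - 2)"
      using landau_o.smallD[OF R_o, of 1] by simp
    \<comment> \<open>here \<open>s \<le> 2/3\<close> enters: the error exponent stays bounded\<close>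
    have R1: "\<forall>\<^sub>F N in sequentially. \<bar>R N\<bar> \<le> 1"
      using R_le2 ev1
    proof eventually_elim
      case (elim N)
      have "real N powr (3 * s - 2) \<le> real N powr 0" using elim(2) s23 by (intro powr_mono) auto
      then show ?case using elim by simp
    qed
    have bound: "\<epsilon>' \<in> O(\<lambda>N. \<bar>\<epsilon> N\<bar> + \<bar>R N\<bar>)"
    proof (rule bigoI)
      show "\<forall>\<^sub>F N in sequentially. norm (\<epsilon>' N) \<le> 3 * norm (\<bar>\<epsilon> N\<bar> + \<bar>R N\<bar>)"
        using R1
      proof eventually_elim
        case (elim N)
        have "(R N)\<^sup>2 \<le> \<bar>R N\<bar>"
        proof -
          have "\<bar>R N\<bar> * \<bar>R N\<bar> \<le> \<bar>R N\<bar> * 1" using elim by (intro mult_left_mono) auto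
          then show ?thesis by (simp add: power2_eq_square)
        qed
        then have e1: "\<bar>exp (R N) - 1\<bar> \<le> 3 * \<bar>R N\<bar>"
          using abs_exp_minus_linear_le[OF elim] by linarith
        have "exp (R N) \<le> exp 1" using elim by simp
        then have "exp (R N) \<le> 3" using exp_le by linarith
        then have e2: "\<bar>\<epsilon> N\<bar> * exp (R N) \<le> \<bar>\<epsilon> N\<bar> * 3" by (intro mult_left_mono) auto
        have "\<epsilon>' N = \<epsilon> N * exp (R N) + (exp (R N) - 1)" by (simp add: \<epsilon>'_def distrib_right)
        then have "\<bar>\<epsilon>' N\<bar> \<le> \<bar>\<epsilon> N\<bar> * exp (R N) + \<bar>exp (R N) - 1\<bar>"
          using abs_triangle_ineq[of "\<epsilon> N * exp (R N)" "exp (R N) - 1"] by (simp add: abs_mult)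
        then show ?case using e1 e2 by simp
      qed
    qed
    show "\<epsilon>' \<in> O(\<lambda>N. real N powr (- (1 - s)))" if "s \<le> 1 / 2"
    proof -
      have "(\<lambda>N. real N powr (3 * s - 2)) \<in> O(\<lambda>N. real N powr (- (1 - s)))"
        using that by (subst powr_bigo_iff[OF filterlim_real_sequentially]) auto
      then have "R \<in> O(\<lambda>N. real N powr (- (1 - s)))"
        using R_o by (meson landau_o.big_trans landau_o.small_imp_big)
      then have "(\<lambda>N. \<bar>\<epsilon> N\<bar> + \<bar>R N\<bar>) \<in> O(\<lambda>N. real N powr (- (1 - s)))"
        using \<epsilon>_O by (intro sum_in_bigo) auto
      then show ?thesis using bound by (rule landau_o.big_trans[rotated])
    qed
    show "\<epsilon>' \<in> o(\<lambda>N. real N powr (3 * s - 2))" if "1 / 2 < s"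
    proof -
      have "(\<lambda>N. real N powr (- (1 - s))) \<in> o(\<lambda>N. real N powr (3 * s - 2))"
        using that by (subst powr_smallo_iff[OF filterlim_real_sequentially]) auto
      then have "\<epsilon> \<in> o(\<lambda>N. real N powr (3 * s - 2))"
        using \<epsilon>_O by (meson landau_o.big_small_trans)
      then have "(\<lambda>N. \<bar>\<epsilon> N\<bar> + \<bar>R N\<bar>) \<in> o(\<lambda>N. real N powr (3 * s - 2))"
        using R_o by (intro sum_in_smallo) auto
      then show ?thesis using bound by (rule landau_o.big_small_trans[rotated])
    qed
  qed
  moreover have "\<forall>\<^sub>F N in sequentially. weighted_paths c S N (\<gamma> N) = G N * (1 + \<epsilon> N)"
    using \<epsilon> by eventually_elim simp
  ultimately show ?thesis
    using \<epsilon>_O unfolding G_def main_term_def A[symmetric] by blast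
qed

end
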